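(* Let $\mathbf{k}$ be an algebraically closed field of characteristic $p>0$, let $\mathcal{C}$ be a symmetric tensor category over $\mathbf{k}$, and let $X\in\mathcal{C}$. (i) There exists a unique $d_+=d_+(X)\in\mathbb{Z}_p$ such that $$\sum_{j\ge 0}\dim(\mathbb{S}^jX)\,z^j=(1-z)^{-d_+}.$$ (ii) There exists a unique $d_-=d_-(X)\in\mathbb{Z}_p$ such that $$\sum_{j\ge 0}\dim(\Lambda^jX)\,z^j=(1+z)^{d_-}.$$ (Both equalities are equalities of formal power series in $\mathbf{k}[[z]]\supset\mathbb{F}_p[[z]]$.)
   Context: A symmetric tensor category over $\mathbf{k}$ is a $\mathbf{k}$-linear locally finite abelian rigid symmetric monoidal category with $\mathbf{k}$-bilinear tensor product and $\mathrm{End}(\mathbf{1})=\mathbf{k}$. Its commutativity constraint is $c_{X,Y}:X\otimes Y\to Y\otimes X$; the symmetric group $S_n$ acts on $X^{\otimes n}$ with $s_{i,i+1}$ acting by $c_i:=1^{\otimes (i-1)}\otimes c_{X,X}\otimes 1^{\otimes (n-i-1)}$. The trace of $A:X\to X$ is $\mathrm{Tr}_X(A):=\mathrm{ev}_X\circ c_{X,X^*}\circ(A\otimes 1)\circ\mathrm{coev}_X\in\mathrm{End}(\mathbf{1})=\mathbf{k}$, and $\dim(X):=\mathrm{Tr}_X(1)\in\mathbf{k}$. $\mathbb{S}^nX\subset X^{\otimes n}$ is the subobject of $S_n$-invariants, i.e. the intersection of the kernels of $c_i-1$, $i=1,\dots,n-1$ (equivalently $(S^nX^* )^*$, where $S^n$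 denotes the $S_n$-coinvariants of the $n$-th tensor power). $\Lambda^nX\subset X^{\otimes n}$ is the intersection of the images of $c_i-1$, $i=1,\dots,n-1$ (equivalently $(\wedge^nX^* )^*$, where $\wedge^n$ is the degree $n$ part of the quotient of the tensor algebra by the two-sided ideal generated by $\ker(c-1)$ in degree $2$). By convention the $0$-th powers are $\mathbf{1}$ and the first powers are $X$. For $t=\sum_{j\ge0}t_jp^j\in\mathbb{Z}_p$ with digits $t_j\in\{0,\dots,p-1\}$, one sets $(1+z)^t:=\prod_{j\ge0}(1+z^{p^j})^{t_j}\in\mathbb{F}_p[[z]]$; $(1-z)^t$ is obtained by substituting $-z$ for $z$. *)

theory Defs
  imports
    "HOL-Algebra.Module"
    "HOL-Computational_Algebra.Formal_Power_Series"
    "HOL-Computational_Algebra.Polynomial"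
    "HOL-Analysis.Infinite_Products"
begin

section \<open>The \<open>p\<close>-adic integers and binomial series with \<open>p\<close>-adic exponent\<close>

text \<open>
  \<open>\<int>\<^sub>p\<close> is the inverse limit of the rings \<open>\<int>/p\<^sup>n\<close>: a \<open>p\<close>-adic integer is a compatible
  sequence \<open>t\<close>, where \<open>t n\<close> is the representative in \<open>{0..<p^n}\<close> of the residue class modulo
  \<open>p^n\<close>.
\<close>

definition padic_ring :: "nat \<Rightarrow> (nat \<Rightarrow> int) ring" where
  "padic_ring p =
    \<lparr>carrier = {t. \<forall>n. 0 \<le> t n \<and> t n < int p ^ n \<and> t (Suc n) mod int p ^ n = t n},
     monoid.mult = (\<lambda>s t n. (s n * t n) mod int p ^ n),
     one = (\<lambda>n. 1 mod int p ^ n),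
     zero = (\<lambda>n. 0),
     add = (\<lambda>s t n. (s n + t n) mod int p ^ n)\<rparr>"

definition padic_digit :: "nat \<Rightarrow> (nat \<Rightarrow> int) \<Rightarrow> nat \<Rightarrow> nat" where
  "padic_digit p t j = nat (t (Suc j) div int p ^ j)"

text \<open>
  \<open>one_plus_power p t\<close> is \<open>(1 + z)\<^sup>t\<close>, formed directly in \<open>k[[z]]\<close>; its coefficients lie in the
  prime field. The infinite product converges in the \<open>z\<close>-adic topology (\<open>one_plus_power_has_prod\<close>).
\<close>

definition one_plus_power :: "nat \<Rightarrow> (nat \<Rightarrow> int) \<Rightarrow> 'k::field fps" where
  "one_plus_power p t = (\<Prod>j. (1 + fps_X ^ (p ^ j)) ^ padic_digit p t j)"

definition one_minus_power :: "nat \<Rightarrow> (nat \<Rightarrow> int) \<Rightarrow> 'k::field fps" where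
  "one_minus_power p t = one_plus_power p t oo (- fps_X)"

lemma padic_cring:
  assumes "p > 0"
  shows "cring (padic_ring p)"
proof -
  have dvd: "int p ^ n dvd int p ^ Suc n" for n by simp
  have proj: "x mod int p ^ Suc n mod int p ^ n = x mod int p ^ n" for x n
    using mod_mod_cancel[OF dvd] .
  have pos: "int p ^ n > 0" for n using assms by simp
  have compat: "t (Suc n) mod int p ^ n = t n" "t n mod int p ^ n = t n"
    if "t \<in> carrier (padic_ring p)" for t n
    using that by (auto simp: padic_ring_def)
  have op_closed: "(\<lambda>n. f n mod int p ^ n) \<in> carrier (padic_ring p)"
    if "\<And>n. f (Suc n) mod int p ^ n = f n mod int p ^ n" for f
    using that proj pos by (simp add: padic_ring_def)
  have add_closed: "(\<lambda>n. (s n + t n) mod int p ^ n) \<in> carrier (padic_ring p)"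
    and mult_closed: "(\<lambda>n. (s n * t n) mod int p ^ n) \<in> carrier (padic_ring p)"
    if "s \<in> carrier (padic_ring p)" "t \<in> carrier (padic_ring p)" for s t
    by (rule op_closed; metis compat(1)[OF that(1)] compat(1)[OF that(2)]
        mod_add_eq mod_mult_eq)+
  have neg_closed: "(\<lambda>n. (- t n) mod int p ^ n) \<in> carrier (padic_ring p)"
    if "t \<in> carrier (padic_ring p)" for t
    by (rule op_closed) (metis compat(1)[OF that] mod_minus_eq)
  have one_closed: "(\<lambda>n. 1 mod int p ^ n) \<in> carrier (padic_ring p)"
    by (rule op_closed) simp
  show ?thesis
  proof (rule cringI)
    show "abelian_group (padic_ring p)"
    proof (rule abelian_groupI)
      fix t assume t: "t \<in> carrier (padic_ring p)"
      show "\<exists>s \<in> carrier (padic_ring p). s \<oplus>\<^bsub>padic_ring p\<^esub> t = \<zero>\<^bsub>padic_ring p\<^esub>"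
        using neg_closed[OF t]
        by (rule rev_bexI) (simp add: padic_ring_def mod_simps)
    next
      show "\<zero>\<^bsub>padic_ring p\<^esub> \<in> carrier (padic_ring p)"
        using pos by (simp add: padic_ring_def)
    next
      fix s t assume "s \<in> carrier (padic_ring p)" "t \<in> carrier (padic_ring p)"
      from add_closed[OF this] show "s \<oplus>\<^bsub>padic_ring p\<^esub> t \<in> carrier (padic_ring p)"
        by (simp add: padic_ring_def)
    next
      fix t assume "t \<in> carrier (padic_ring p)"
      from compat(2)[OF this] show "\<zero>\<^bsub>padic_ring p\<^esub> \<oplus>\<^bsub>padic_ring p\<^esub> t = t"
        by (simp add: padic_ring_def)
    qed (simp_all add: padic_ring_def mod_simps algebra_simps)
    show "comm_monoid (padic_ring p)"
    proof (rule comm_monoidI)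
      fix s t assume "s \<in> carrier (padic_ring p)" "t \<in> carrier (padic_ring p)"
      from mult_closed[OF this] show "s \<otimes>\<^bsub>padic_ring p\<^esub> t \<in> carrier (padic_ring p)"
        by (simp add: padic_ring_def)
    next
      show "\<one>\<^bsub>padic_ring p\<^esub> \<in> carrier (padic_ring p)"
        using one_closed by (simp add: padic_ring_def)
    next
      fix t assume "t \<in> carrier (padic_ring p)"
      from compat(2)[OF this] show "\<one>\<^bsub>padic_ring p\<^esub> \<otimes>\<^bsub>padic_ring p\<^esub> t = t"
        by (simp add: padic_ring_def mod_simps)
    qed (simp_all add: padic_ring_def mod_simps algebra_simps)
  qed (simp add: padic_ring_def mod_simps algebra_simps)
qed

lemma padic_digit_less:
  assumes "p > 0" "t \<in> carrier (padic_ring p)"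
  shows "padic_digit p t j < p"
proof -
  have pos: "int p ^ j > 0" using assms(1) by simp
  have "t (Suc j) < int p * int p ^ j" "0 \<le> t (Suc j)"
    using assms(2) by (auto simp: padic_ring_def dest: spec[of _ "Suc j"])
  moreover have "t (Suc j) div int p ^ j * int p ^ j \<le> t (Suc j)"
    using pos div_mult_mod_eq[of "t (Suc j)" "int p ^ j"]
      pos_mod_sign[of "int p ^ j" "t (Suc j)"] by linarith
  ultimately have "t (Suc j) div int p ^ j * int p ^ j < int p * int p ^ j"
    by linarith
  then have "t (Suc j) div int p ^ j < int p"
    using pos by (simp only: mult_less_cancel_right)
  then show ?thesis using assms(1) by (simp add: padic_digit_def nat_less_iff)
qed

lemma padic_digit_expansion:
  assumes "p > 0" "t \<in> carrier (padic_ring p)"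
  shows "t n = (\<Sum>j<n. int (padic_digit p t j) * int p ^ j)"
proof (induction n)
  case 0
  have "\<forall>n. 0 \<le> t n \<and> t n < int p ^ n" using assms(2) by (simp add: padic_ring_def)
  from spec[OF this, of 0] show ?case by simp
next
  case (Suc n)
  have nonneg: "0 \<le> t (Suc n)" and compat: "t (Suc n) mod int p ^ n = t n"
    using assms(2) by (auto simp: padic_ring_def)
  have "t (Suc n) = t (Suc n) div int p ^ n * int p ^ n + t n"
    using compat div_mult_mod_eq[of "t (Suc n)" "int p ^ n"] by simp
  moreover have "t (Suc n) div int p ^ n = int (padic_digit p t n)"
    using nonneg by (simp add: padic_digit_def pos_imp_zdiv_nonneg_iff assms(1))
  ultimately show ?case using Suc by simp
qed

lemma one_plus_power_has_prod:
  assumes "p \<ge> 2"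
  shows "(\<lambda>j. (1 + fps_X ^ (p ^ j)) ^ padic_digit p t j) has_prod
    (one_plus_power p t :: 'k::field fps)"
proof -
  define f :: "nat \<Rightarrow> 'k fps" where "f j = (1 + fps_X ^ (p ^ j)) ^ padic_digit p t j" for j
  define P where "P n = (\<Prod>j\<le>n. f j)" for n
  have pj: "j < p ^ j" for j using assms by (simp add: power_gt_expt)
  have step: "fps_nth (P (Suc n)) i = fps_nth (P n) i" if "i \<le> n" for n i
  proof -
    have "fps_nth (f (Suc n)) m = (if m = 0 then 1 else 0)" if "m < p ^ Suc n" for m
    proof -
      have "fps_X ^ (p ^ Suc n) dvd f (Suc n) - 1"
        using dvd_triv_left[of "1 + fps_X ^ (p ^ Suc n) - 1"]
        by (simp add: f_def power_diff_1_eq)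
      then obtain g where "f (Suc n) - 1 = fps_X ^ (p ^ Suc n) * g" by (rule dvdE)
      then have "f (Suc n) = 1 + fps_X ^ (p ^ Suc n) * g" by (simp add: algebra_simps)
      then show ?thesis using that by (simp add: fps_X_power_mult_nth)
    qed
    moreover have "i < p ^ Suc n" using that pj[of "Suc n"] by simp
    ultimately have coeff: "fps_nth (f (Suc n)) m = (if m = 0 then 1 else 0)" if "m \<le> i" for m
      using that by simp
    have "fps_nth (P (Suc n)) i = (\<Sum>m=0..i. fps_nth (P n) m * fps_nth (f (Suc n)) (i - m))"
      by (simp add: P_def fps_mult_nth)
    also have "\<dots> = (\<Sum>m=0..i. if m = i then fps_nth (P n) m else 0)"
      by (rule sum.cong) (auto simp: coeff)
    finally show ?thesis by simp
  qed
  have stable: "fps_nth (P n) i = fps_nth (P i) i" if "i \<le> n" for n i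
    using that by (induction n rule: dec_induct) (simp_all add: step)
  have "P \<longlonglongrightarrow> Abs_fps (\<lambda>i. fps_nth (P i) i)"
  proof (rule tendsto_fpsI)
    fix i
    have "fps_nth (P n) i = fps_nth (Abs_fps (\<lambda>i. fps_nth (P i) i)) i" if "i \<le> n" for n
      unfolding fps_nth_Abs_fps using that by (rule stable)
    then show "eventually (\<lambda>n. fps_nth (P n) i =
        fps_nth (Abs_fps (\<lambda>i. fps_nth (P i) i)) i) sequentially"
      by (rule eventually_sequentiallyI)
  qed
  moreover have "fps_nth (Abs_fps (\<lambda>i. fps_nth (P i) i)) 0 = 1"
    using assms by (simp add: P_def f_def fps_nth_power_0)
  then have "Abs_fps (\<lambda>i. fps_nth (P i) i) \<noteq> 0"
    by (metis fps_zero_nth zero_neq_one)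
  ultimately have "raw_has_prod f 0 (Abs_fps (\<lambda>i. fps_nth (P i) i))"
    unfolding raw_has_prod_def P_def[abs_def] by simp
  then have "f has_prod Abs_fps (\<lambda>i. fps_nth (P i) i)"
    unfolding has_prod_def by (rule disjI1)
  moreover from this have "prodinf f = Abs_fps (\<lambda>i. fps_nth (P i) i)"
    by (rule has_prod_unique[symmetric])
  ultimately show ?thesis
    unfolding one_plus_power_def f_def[abs_def] by simp
qed


section \<open>Linear and abelian categories\<close>

text \<open>
  A category with the structure maps of a rigid symmetric monoidal \<open>'k\<close>-linear category: \<open>g \<cdot> f\<close>
  is the composite of \<open>f\<close> followed by \<open>g\<close>; \<open>Zero X Y\<close>, \<open>Add\<close> and \<open>Scale\<close> are the vector space
  operations on Hom sets; \<open>X \<star> Y\<close> and \<open>f \<boxtimes> g\<close> are the tensor product of objects and of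
  morphisms.
\<close>

record ('o, 'm, 'k) tensor_data =
  Obj :: "'o set"
  Arr :: "'m set"
  Dom :: "'m \<Rightarrow> 'o"
  Cod :: "'m \<Rightarrow> 'o"
  Id :: "'o \<Rightarrow> 'm"
  Comp :: "'m \<Rightarrow> 'm \<Rightarrow> 'm" (infixr \<open>\<cdot>\<index>\<close> 60)
  Zero :: "'o \<Rightarrow> 'o \<Rightarrow> 'm"
  Add :: "'m \<Rightarrow> 'm \<Rightarrow> 'm"
  Scale :: "'k \<Rightarrow> 'm \<Rightarrow> 'm"
  Unit :: "'o"
  TensorObj :: "'o \<Rightarrow> 'o \<Rightarrow> 'o" (infixr \<open>\<star>\<index>\<close> 75)
  TensorArr :: "'m \<Rightarrow> 'm \<Rightarrow> 'm" (infixr \<open>\<boxtimes>\<index>\<close> 75)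
  Assoc :: "'o \<Rightarrow> 'o \<Rightarrow> 'o \<Rightarrow> 'm"
  LUnit :: "'o \<Rightarrow> 'm"
  RUnit :: "'o \<Rightarrow> 'm"
  Braid :: "'o \<Rightarrow> 'o \<Rightarrow> 'm"
  Dual :: "'o \<Rightarrow> 'o"
  Ev :: "'o \<Rightarrow> 'm"
  Coev :: "'o \<Rightarrow> 'm"

definition arrows :: "('o, 'm, 'k, 'z) tensor_data_scheme \<Rightarrow> 'o \<Rightarrow> 'o \<Rightarrow> 'm set" where
  "arrows C X Y = {f \<in> Arr C. Dom C f = X \<and> Cod C f = Y}"

definition scalar_ring :: "'k::field ring" where
  "scalar_ring = \<lparr>carrier = UNIV, monoid.mult = (*), one = 1, zero = 0, add = (+)\<rparr>"

definition hom_space ::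
  "('o, 'm, 'k, 'z) tensor_data_scheme \<Rightarrow> 'o \<Rightarrow> 'o \<Rightarrow> ('k, 'm) module" where
  "hom_space C X Y =
    \<lparr>carrier = arrows C X Y, monoid.mult = undefined, one = undefined,
     zero = Zero C X Y, add = Add C, module.smult = Scale C\<rparr>"

definition inverse_arrows :: "('o, 'm, 'k, 'z) tensor_data_scheme \<Rightarrow> 'm \<Rightarrow> 'm \<Rightarrow> bool" where
  "inverse_arrows C f g \<longleftrightarrow>
    f \<in> Arr C \<and> g \<in> arrows C (Cod C f) (Dom C f) \<and>
    g \<cdot>\<^bsub>C\<^esub> f = Id C (Dom C f) \<and> f \<cdot>\<^bsub>C\<^esub> g = Id C (Cod C f)"

definition iso_arrow :: "('o, 'm, 'k, 'z) tensor_data_scheme \<Rightarrow> 'm \<Rightarrow> bool" where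
  "iso_arrow C f \<longleftrightarrow> (\<exists>g. inverse_arrows C f g)"

definition inv_arrow :: "('o, 'm, 'k, 'z) tensor_data_scheme \<Rightarrow> 'm \<Rightarrow> 'm" where
  "inv_arrow C f = (THE g. inverse_arrows C f g)"

definition mono_arrow :: "('o, 'm, 'k, 'z) tensor_data_scheme \<Rightarrow> 'm \<Rightarrow> bool" where
  "mono_arrow C m \<longleftrightarrow>
    m \<in> Arr C \<and>
    (\<forall>W. \<forall>f \<in> arrows C W (Dom C m). \<forall>g \<in> arrows C W (Dom C m).
      m \<cdot>\<^bsub>C\<^esub> f = m \<cdot>\<^bsub>C\<^esub> g \<longrightarrow> f = g)"

definition epi_arrow :: "('o, 'm, 'k, 'z) tensor_data_scheme \<Rightarrow> 'm \<Rightarrow> bool" where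
  "epi_arrow C q \<longleftrightarrow>
    q \<in> Arr C \<and>
    (\<forall>W. \<forall>f \<in> arrows C (Cod C q) W. \<forall>g \<in> arrows C (Cod C q) W.
      f \<cdot>\<^bsub>C\<^esub> q = g \<cdot>\<^bsub>C\<^esub> q \<longrightarrow> f = g)"

definition zero_object :: "('o, 'm, 'k, 'z) tensor_data_scheme \<Rightarrow> 'o \<Rightarrow> bool" where
  "zero_object C Z \<longleftrightarrow>
    Z \<in> Obj C \<and> (\<forall>X \<in> Obj C. (\<exists>!f. f \<in> arrows C Z X) \<and> (\<exists>!f. f \<in> arrows C X Z))"

definition is_kernel :: "('o, 'm, 'k, 'z) tensor_data_scheme \<Rightarrow> 'm \<Rightarrow> 'm \<Rightarrow> bool" where
  "is_kernel C f k \<longleftrightarrow>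
    f \<in> Arr C \<and> k \<in> Arr C \<and> Cod C k = Dom C f \<and>
    f \<cdot>\<^bsub>C\<^esub> k = Zero C (Dom C k) (Cod C f) \<and>
    (\<forall>W. \<forall>h \<in> arrows C W (Dom C f). f \<cdot>\<^bsub>C\<^esub> h = Zero C W (Cod C f) \<longrightarrow>
      (\<exists>!g. g \<in> arrows C W (Dom C k) \<and> k \<cdot>\<^bsub>C\<^esub> g = h))"

definition is_cokernel :: "('o, 'm, 'k, 'z) tensor_data_scheme \<Rightarrow> 'm \<Rightarrow> 'm \<Rightarrow> bool" where
  "is_cokernel C f q \<longleftrightarrow>
    f \<in> Arr C \<and> q \<in> Arr C \<and> Dom C q = Cod C f \<and>
    q \<cdot>\<^bsub>C\<^esub> f = Zero C (Dom C f) (Cod C q) \<and>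
    (\<forall>W. \<forall>h \<in> arrows C (Cod C f) W. h \<cdot>\<^bsub>C\<^esub> f = Zero C (Dom C f) W \<longrightarrow>
      (\<exists>!g. g \<in> arrows C (Cod C q) W \<and> g \<cdot>\<^bsub>C\<^esub> q = h))"

definition is_image :: "('o, 'm, 'k, 'z) tensor_data_scheme \<Rightarrow> 'm \<Rightarrow> 'm \<Rightarrow> bool" where
  "is_image C f m \<longleftrightarrow> (\<exists>q. is_cokernel C f q \<and> is_kernel C q m)"

definition factors_through :: "('o, 'm, 'k, 'z) tensor_data_scheme \<Rightarrow> 'm \<Rightarrow> 'm \<Rightarrow> bool" where
  "factors_through C m n \<longleftrightarrow> (\<exists>g \<in> arrows C (Dom C m) (Dom C n). n \<cdot>\<^bsub>C\<^esub> g = m)"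

text \<open>
  Subobjects of \<open>Y\<close> are represented by monomorphisms into \<open>Y\<close>; the intersection of a family is
  its greatest lower bound with respect to factorization.
\<close>

definition is_intersection ::
  "('o, 'm, 'k, 'z) tensor_data_scheme \<Rightarrow> 'o \<Rightarrow> 'm set \<Rightarrow> 'm \<Rightarrow> bool" where
  "is_intersection C Y M m \<longleftrightarrow>
    mono_arrow C m \<and> Cod C m = Y \<and> (\<forall>n \<in> M. factors_through C m n) \<and>
    (\<forall>m'. mono_arrow C m' \<and> Cod C m' = Y \<and> (\<forall>n \<in> M. factors_through C m' n) \<longrightarrow>
      factors_through C m' m)"

definition is_biproduct ::
  "('o, 'm, 'k, 'z) tensor_data_scheme \<Rightarrow> 'o \<Rightarrow> 'o \<Rightarrow> 'o \<Rightarrow> 'm \<Rightarrow> 'm \<Rightarrow> 'm \<Rightarrow> 'm \<Rightarrow> bool" where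
  "is_biproduct C X Y Z i\<^sub>1 i\<^sub>2 p\<^sub>1 p\<^sub>2 \<longleftrightarrow>
    Z \<in> Obj C \<and> i\<^sub>1 \<in> arrows C X Z \<and> i\<^sub>2 \<in> arrows C Y Z \<and>
    p\<^sub>1 \<in> arrows C Z X \<and> p\<^sub>2 \<in> arrows C Z Y \<and>
    p\<^sub>1 \<cdot>\<^bsub>C\<^esub> i\<^sub>1 = Id C X \<and> p\<^sub>2 \<cdot>\<^bsub>C\<^esub> i\<^sub>2 = Id C Y \<and>
    p\<^sub>2 \<cdot>\<^bsub>C\<^esub> i\<^sub>1 = Zero C X Y \<and> p\<^sub>1 \<cdot>\<^bsub>C\<^esub> i\<^sub>2 = Zero C Y X \<and>
    Add C (i\<^sub>1 \<cdot>\<^bsub>C\<^esub> p\<^sub>1) (i\<^sub>2 \<cdot>\<^bsub>C\<^esub> p\<^sub>2) = Id C Z"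

definition simple_object :: "('o, 'm, 'k, 'z) tensor_data_scheme \<Rightarrow> 'o \<Rightarrow> bool" where
  "simple_object C S \<longleftrightarrow>
    S \<in> Obj C \<and> \<not> zero_object C S \<and>
    (\<forall>m. mono_arrow C m \<and> Cod C m = S \<longrightarrow> zero_object C (Dom C m) \<or> iso_arrow C m)"

text \<open>
  \<open>X\<close> has finite length if it is obtained from \<open>0\<close> by finitely many extensions
  \<open>0 \<rightarrow> Y \<rightarrow> X \<rightarrow> S \<rightarrow> 0\<close> with \<open>S\<close> simple, i.e. if it has a Jordan--Hoelder filtration.
\<close>

inductive finite_length :: "('o, 'm, 'k, 'z) tensor_data_scheme \<Rightarrow> 'o \<Rightarrow> bool" for C where
  zero: "zero_object C X \<Longrightarrow> finite_length C X"
| extension: "finite_length C (Dom C m) \<Longrightarrow> is_kernel C q m \<Longrightarrow> is_cokernel C m q \<Longrightarrow>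
    simple_object C (Cod C q) \<Longrightarrow> finite_length C (Cod C m)"

definition finite_dim_hom :: "('o, 'm, 'k, 'z) tensor_data_scheme \<Rightarrow> 'o \<Rightarrow> 'o \<Rightarrow> bool" where
  "finite_dim_hom C X Y \<longleftrightarrow>
    (\<exists>B. finite B \<and> B \<subseteq> arrows C X Y \<and>
      (\<forall>f \<in> arrows C X Y. \<exists>a. f = finsum (hom_space C X Y) (\<lambda>b. Scale C (a b) b) B))"

locale small_category =
  fixes C :: "('o, 'm, 'k, 'z) tensor_data_scheme" (structure)
  assumes Dom_Obj: "f \<in> Arr C \<Longrightarrow> Dom C f \<in> Obj C"
    and Cod_Obj: "f \<in> Arr C \<Longrightarrow> Cod C f \<in> Obj C"
    and Id_arrows: "X \<in> Obj C \<Longrightarrow> Id C X \<in> arrows C X X"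
    and Comp_arrows: "f \<in> arrows C X Y \<Longrightarrow> g \<in> arrows C Y Z \<Longrightarrow> g \<cdot> f \<in> arrows C X Z"
    and Id_left: "f \<in> arrows C X Y \<Longrightarrow> Id C Y \<cdot> f = f"
    and Id_right: "f \<in> arrows C X Y \<Longrightarrow> f \<cdot> Id C X = f"
    and Comp_assoc:
      "f \<in> arrows C W X \<Longrightarrow> g \<in> arrows C X Y \<Longrightarrow> h \<in> arrows C Y Z \<Longrightarrow>
        (h \<cdot> g) \<cdot> f = h \<cdot> g \<cdot> f"

locale linear_category = small_category C
  for C :: "('o, 'm, 'k::field, 'z) tensor_data_scheme" (structure) +
  assumes hom_vector_space:
      "X \<in> Obj C \<Longrightarrow> Y \<in> Obj C \<Longrightarrow>
        Module.module (scalar_ring :: 'k ring) (hom_space C X Y)"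
    and Comp_Add_left:
      "f \<in> arrows C X Y \<Longrightarrow> g \<in> arrows C Y Z \<Longrightarrow> h \<in> arrows C Y Z \<Longrightarrow>
        Add C g h \<cdot> f = Add C (g \<cdot> f) (h \<cdot> f)"
    and Comp_Add_right:
      "f \<in> arrows C X Y \<Longrightarrow> g \<in> arrows C X Y \<Longrightarrow> h \<in> arrows C Y Z \<Longrightarrow>
        h \<cdot> Add C f g = Add C (h \<cdot> f) (h \<cdot> g)"
    and Comp_Scale_left:
      "f \<in> arrows C X Y \<Longrightarrow> g \<in> arrows C Y Z \<Longrightarrow> Scale C a g \<cdot> f = Scale C a (g \<cdot> f)"
    and Comp_Scale_right:
      "f \<in> arrows C X Y \<Longrightarrow> g \<in> arrows C Y Z \<Longrightarrow> g \<cdot> Scale C a f = Scale C a (g \<cdot> f)"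

locale linear_abelian_category = linear_category C
  for C :: "('o, 'm, 'k::field, 'z) tensor_data_scheme" (structure) +
  assumes ex_zero_object: "\<exists>Z. zero_object C Z"
    and ex_biproduct:
      "X \<in> Obj C \<Longrightarrow> Y \<in> Obj C \<Longrightarrow> \<exists>Z i\<^sub>1 i\<^sub>2 p\<^sub>1 p\<^sub>2. is_biproduct C X Y Z i\<^sub>1 i\<^sub>2 p\<^sub>1 p\<^sub>2"
    and ex_kernel: "f \<in> Arr C \<Longrightarrow> \<exists>k. is_kernel C f k"
    and ex_cokernel: "f \<in> Arr C \<Longrightarrow> \<exists>q. is_cokernel C f q"
    and mono_is_kernel: "mono_arrow C m \<Longrightarrow> \<exists>f. is_kernel C f m"
    and epi_is_cokernel: "epi_arrow C q \<Longrightarrow> \<exists>f. is_cokernel C f q"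

locale locally_finite_category = linear_abelian_category C
  for C :: "('o, 'm, 'k::field, 'z) tensor_data_scheme" (structure) +
  assumes hom_finite_dim: "X \<in> Obj C \<Longrightarrow> Y \<in> Obj C \<Longrightarrow> finite_dim_hom C X Y"
    and object_finite_length: "X \<in> Obj C \<Longrightarrow> finite_length C X"


section \<open>Symmetric tensor categories\<close>

locale symmetric_monoidal_category = small_category C
  for C :: "('o, 'm, 'k, 'z) tensor_data_scheme" (structure) +
  assumes Unit_Obj: "Unit C \<in> Obj C"
    and TensorObj_Obj: "X \<in> Obj C \<Longrightarrow> Y \<in> Obj C \<Longrightarrow> X \<star> Y \<in> Obj C"
    and TensorArr_arrows:
      "f \<in> arrows C X X' \<Longrightarrow> g \<in> arrows C Y Y' \<Longrightarrow> f \<boxtimes> g \<in> arrows C (X \<star> Y) (X' \<star> Y')"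
    and TensorArr_Id: "X \<in> Obj C \<Longrightarrow> Y \<in> Obj C \<Longrightarrow> Id C X \<boxtimes> Id C Y = Id C (X \<star> Y)"
    and TensorArr_Comp:
      "f \<in> arrows C X X' \<Longrightarrow> f' \<in> arrows C X' X'' \<Longrightarrow>
       g \<in> arrows C Y Y' \<Longrightarrow> g' \<in> arrows C Y' Y'' \<Longrightarrow>
        (f' \<cdot> f) \<boxtimes> (g' \<cdot> g) = (f' \<boxtimes> g') \<cdot> (f \<boxtimes> g)"
    and Assoc_arrows:
      "X \<in> Obj C \<Longrightarrow> Y \<in> Obj C \<Longrightarrow> Z \<in> Obj C \<Longrightarrow>
        Assoc C X Y Z \<in> arrows C ((X \<star> Y) \<star> Z) (X \<star> (Y \<star> Z))"
    and Assoc_iso: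
      "X \<in> Obj C \<Longrightarrow> Y \<in> Obj C \<Longrightarrow> Z \<in> Obj C \<Longrightarrow> iso_arrow C (Assoc C X Y Z)"
    and Assoc_natural:
      "f \<in> arrows C X X' \<Longrightarrow> g \<in> arrows C Y Y' \<Longrightarrow> h \<in> arrows C Z Z' \<Longrightarrow>
        Assoc C X' Y' Z' \<cdot> ((f \<boxtimes> g) \<boxtimes> h) = (f \<boxtimes> (g \<boxtimes> h)) \<cdot> Assoc C X Y Z"
    and LUnit_arrows: "X \<in> Obj C \<Longrightarrow> LUnit C X \<in> arrows C (Unit C \<star> X) X"
    and LUnit_iso: "X \<in> Obj C \<Longrightarrow> iso_arrow C (LUnit C X)"
    and LUnit_natural: "f \<in> arrows C X Y \<Longrightarrow> LUnit C Y \<cdot> (Id C (Unit C) \<boxtimes> f) = f \<cdot> LUnit C X"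
    and RUnit_arrows: "X \<in> Obj C \<Longrightarrow> RUnit C X \<in> arrows C (X \<star> Unit C) X"
    and RUnit_iso: "X \<in> Obj C \<Longrightarrow> iso_arrow C (RUnit C X)"
    and RUnit_natural: "f \<in> arrows C X Y \<Longrightarrow> RUnit C Y \<cdot> (f \<boxtimes> Id C (Unit C)) = f \<cdot> RUnit C X"
    and pentagon:
      "W \<in> Obj C \<Longrightarrow> X \<in> Obj C \<Longrightarrow> Y \<in> Obj C \<Longrightarrow> Z \<in> Obj C \<Longrightarrow>
        Assoc C W X (Y \<star> Z) \<cdot> Assoc C (W \<star> X) Y Z =
        (Id C W \<boxtimes> Assoc C X Y Z) \<cdot> Assoc C W (X \<star> Y) Z \<cdot> (Assoc C W X Y \<boxtimes> Id C Z)"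
    and triangle:
      "X \<in> Obj C \<Longrightarrow> Y \<in> Obj C \<Longrightarrow>
        (Id C X \<boxtimes> LUnit C Y) \<cdot> Assoc C X (Unit C) Y = RUnit C X \<boxtimes> Id C Y"
    and Braid_arrows: "X \<in> Obj C \<Longrightarrow> Y \<in> Obj C \<Longrightarrow> Braid C X Y \<in> arrows C (X \<star> Y) (Y \<star> X)"
    and Braid_natural:
      "f \<in> arrows C X X' \<Longrightarrow> g \<in> arrows C Y Y' \<Longrightarrow>
        Braid C X' Y' \<cdot> (f \<boxtimes> g) = (g \<boxtimes> f) \<cdot> Braid C X Y"
    and hexagon:
      "X \<in> Obj C \<Longrightarrow> Y \<in> Obj C \<Longrightarrow> Z \<in> Obj C \<Longrightarrow>
        Assoc C Y Z X \<cdot> Braid C X (Y \<star> Z) \<cdot> Assoc C X Y Z =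
        (Id C Y \<boxtimes> Braid C X Z) \<cdot> Assoc C Y X Z \<cdot> (Braid C X Y \<boxtimes> Id C Z)"
    and Braid_symmetric:
      "X \<in> Obj C \<Longrightarrow> Y \<in> Obj C \<Longrightarrow> Braid C Y X \<cdot> Braid C X Y = Id C (X \<star> Y)"

text \<open>
  \<open>Dual C X\<close> is a left dual of \<open>X\<close>; composing \<open>Ev\<close> and \<open>Coev\<close> with the symmetry makes it a right
  dual as well, so this is rigidity.
\<close>

locale rigid_symmetric_monoidal_category = symmetric_monoidal_category C
  for C :: "('o, 'm, 'k, 'z) tensor_data_scheme" (structure) +
  assumes Dual_Obj: "X \<in> Obj C \<Longrightarrow> Dual C X \<in> Obj C"
    and Ev_arrows: "X \<in> Obj C \<Longrightarrow> Ev C X \<in> arrows C (Dual C X \<star> X) (Unit C)"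
    and Coev_arrows: "X \<in> Obj C \<Longrightarrow> Coev C X \<in> arrows C (Unit C) (X \<star> Dual C X)"
    and zigzag_Obj:
      "X \<in> Obj C \<Longrightarrow>
        RUnit C X \<cdot> (Id C X \<boxtimes> Ev C X) \<cdot> Assoc C X (Dual C X) X \<cdot> (Coev C X \<boxtimes> Id C X)
          \<cdot> inv_arrow C (LUnit C X) = Id C X"
    and zigzag_Dual:
      "X \<in> Obj C \<Longrightarrow>
        LUnit C (Dual C X) \<cdot> (Ev C X \<boxtimes> Id C (Dual C X))
          \<cdot> inv_arrow C (Assoc C (Dual C X) X (Dual C X)) \<cdot> (Id C (Dual C X) \<boxtimes> Coev C X)
          \<cdot> inv_arrow C (RUnit C (Dual C X)) = Id C (Dual C X)"

locale symmetric_tensor_category =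
  locally_finite_category C + rigid_symmetric_monoidal_category C
  for C :: "('o, 'm, 'k::field, 'z) tensor_data_scheme" (structure) +
  assumes TensorArr_Add_left:
      "f \<in> arrows C X X' \<Longrightarrow> g \<in> arrows C X X' \<Longrightarrow> h \<in> arrows C Y Y' \<Longrightarrow>
        Add C f g \<boxtimes> h = Add C (f \<boxtimes> h) (g \<boxtimes> h)"
    and TensorArr_Add_right:
      "f \<in> arrows C X X' \<Longrightarrow> g \<in> arrows C Y Y' \<Longrightarrow> h \<in> arrows C Y Y' \<Longrightarrow>
        f \<boxtimes> Add C g h = Add C (f \<boxtimes> g) (f \<boxtimes> h)"
    and TensorArr_Scale_left:
      "f \<in> arrows C X X' \<Longrightarrow> g \<in> arrows C Y Y' \<Longrightarrow> Scale C a f \<boxtimes> g = Scale C a (f \<boxtimes> g)"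
    and TensorArr_Scale_right:
      "f \<in> arrows C X X' \<Longrightarrow> g \<in> arrows C Y Y' \<Longrightarrow> f \<boxtimes> Scale C a g = Scale C a (f \<boxtimes> g)"
    and End_Unit:
      "bij_betw (\<lambda>a. Scale C a (Id C (Unit C))) UNIV (arrows C (Unit C) (Unit C))"


section \<open>Dimensions of symmetric and exterior powers\<close>

definition scalar_of :: "('o, 'm, 'k, 'z) tensor_data_scheme \<Rightarrow> 'm \<Rightarrow> 'k" where
  "scalar_of C f = (THE a. Scale C a (Id C (Unit C)) = f)"

definition cat_trace :: "('o, 'm, 'k, 'z) tensor_data_scheme \<Rightarrow> 'o \<Rightarrow> 'm \<Rightarrow> 'k" where
  "cat_trace C X A =
    scalar_of C
      (Ev C X \<cdot>\<^bsub>C\<^esub> Braid C X (Dual C X) \<cdot>\<^bsub>C\<^esub> (A \<boxtimes>\<^bsub>C\<^esub> Id C (Dual C X)) \<cdot>\<^bsub>C\<^esub> Coev C X)"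

definition cat_dim :: "('o, 'm, 'k, 'z) tensor_data_scheme \<Rightarrow> 'o \<Rightarrow> 'k" where
  "cat_dim C X = cat_trace C X (Id C X)"

fun tensor_power :: "('o, 'm, 'k, 'z) tensor_data_scheme \<Rightarrow> 'o \<Rightarrow> nat \<Rightarrow> 'o" where
  "tensor_power C X 0 = Unit C"
| "tensor_power C X (Suc 0) = X"
| "tensor_power C X (Suc (Suc n)) = tensor_power C X (Suc n) \<star>\<^bsub>C\<^esub> X"

text \<open>
  \<open>adjacent_braid C X n i\<close> is \<open>c\<^sub>i = 1\<^sup>(\<^sup>i\<^sup>-\<^sup>1\<^sup>) \<otimes> c\<^sub>X\<^sub>X \<otimes> 1\<^sup>(\<^sup>n\<^sup>-\<^sup>i\<^sup>-\<^sup>1\<^sup>)\<close> on the \<open>n\<close>-th tensor power, for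
  \<open>1 \<le> i < n\<close>. Tensor powers are bracketed to the left, so the last one \<open>c\<^sub>n\<^sub>-\<^sub>1\<close> has to be
  conjugated by the associator when \<open>n \<ge> 3\<close>; the others are \<open>c\<^sub>i \<otimes> 1\<close> with \<open>c\<^sub>i\<close> on the
  \<open>(n - 1)\<close>-st power. The values for \<open>n < 2\<close> are irrelevant.
\<close>

fun adjacent_braid :: "('o, 'm, 'k, 'z) tensor_data_scheme \<Rightarrow> 'o \<Rightarrow> nat \<Rightarrow> nat \<Rightarrow> 'm" where
  "adjacent_braid C X 0 i = undefined"
| "adjacent_braid C X (Suc 0) i = undefined"
| "adjacent_braid C X (Suc (Suc 0)) i = Braid C X X"
| "adjacent_braid C X (Suc (Suc (Suc n))) i =
    (if i = Suc (Suc n)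
     then inv_arrow C (Assoc C (tensor_power C X (Suc n)) X X)
            \<cdot>\<^bsub>C\<^esub> (Id C (tensor_power C X (Suc n)) \<boxtimes>\<^bsub>C\<^esub> Braid C X X)
            \<cdot>\<^bsub>C\<^esub> Assoc C (tensor_power C X (Suc n)) X X
     else adjacent_braid C X (Suc (Suc n)) i \<boxtimes>\<^bsub>C\<^esub> Id C X)"

definition braid_minus_one ::
  "('o, 'm, 'k::field, 'z) tensor_data_scheme \<Rightarrow> 'o \<Rightarrow> nat \<Rightarrow> nat \<Rightarrow> 'm" where
  "braid_minus_one C X n i =
    Add C (adjacent_braid C X n i) (Scale C (- 1) (Id C (tensor_power C X n)))"

text \<open>
  The powers are the domains of arbitrarily chosen monomorphisms representing the subobjects
  in question; they are determined up to isomorphism, and so are their dimensions.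
\<close>

definition is_invariants ::
  "('o, 'm, 'k::field, 'z) tensor_data_scheme \<Rightarrow> 'o \<Rightarrow> nat \<Rightarrow> 'm \<Rightarrow> bool" where
  "is_invariants C X n m \<longleftrightarrow>
    (\<exists>K. (\<forall>i \<in> {1..<n}. is_kernel C (braid_minus_one C X n i) (K i)) \<and>
      is_intersection C (tensor_power C X n) (K ` {1..<n}) m)"

definition is_alternating ::
  "('o, 'm, 'k::field, 'z) tensor_data_scheme \<Rightarrow> 'o \<Rightarrow> nat \<Rightarrow> 'm \<Rightarrow> bool" where
  "is_alternating C X n m \<longleftrightarrow>
    (\<exists>K. (\<forall>i \<in> {1..<n}. is_image C (braid_minus_one C X n i) (K i)) \<and>
      is_intersection C (tensor_power C X n) (K ` {1..<n}) m)"

definition sym_power :: "('o, 'm, 'k::field, 'z) tensor_data_scheme \<Rightarrow> 'o \<Rightarrow> nat \<Rightarrow> 'o" where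
  "sym_power C X n =
    (if n = 0 then Unit C else if n = 1 then X else Dom C (SOME m. is_invariants C X n m))"

definition ext_power :: "('o, 'm, 'k::field, 'z) tensor_data_scheme \<Rightarrow> 'o \<Rightarrow> nat \<Rightarrow> 'o" where
  "ext_power C X n =
    (if n = 0 then Unit C else if n = 1 then X else Dom C (SOME m. is_alternating C X n m))"

end

theory Submission
  imports Defs "HOL-Number_Theory.Cong"
begin

text \<open>
  Symmetric and exterior powers are treated at once. Put \<open>s = 1\<close>, \<open>u = c - 1\<close> in the symmetric
  case and \<open>s = -1\<close>, \<open>u = coker (c - 1)\<close> in the exterior case; the power \<open>P\<^sub>n\<^sub>+\<^sub>2\<close> is then the
  kernel of \<open>u\<close>, acting on the last two factors, inside \<open>P\<^sub>n\<^sub>+\<^sub>1 \<otimes> X\<close>. Rigidity makes the tensor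
  product exact, and this yields a comultiplication \<open>\<Delta> : P\<^sub>a\<^sub>+\<^sub>b \<rightarrow> P\<^sub>b \<otimes> P\<^sub>a\<close> and a shuffle
  multiplication \<open>m\<close> in the other direction, with \<open>m \<Delta>\<close> equal to the binomial coefficient
  \<open>(a + b choose a)\<close>.

  The partial trace of \<open>\<Delta> m\<close> over \<open>P\<^sub>a\<close> is a scalar \<open>c b a\<close> on \<open>P\<^sub>b\<close>: detach one factor \<open>X\<close> from
  the output \<open>P\<^sub>b\<close>; it comes either from the input \<open>P\<^sub>b\<close> or from the loop \<open>P\<^sub>a\<close>, and in the second
  case the loop can be slid so that only \<open>P\<^sub>a\<^sub>-\<^sub>1\<close> is left in it. Hence
  \<open>c (b + 1) (a + 1) = c b (a + 1) + s * c (b + 1) a\<close>, and full traces give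
  \<open>(a + b choose a) * dim P\<^sub>a\<^sub>+\<^sub>b = c b a * dim P\<^sub>b\<close>.

  For \<open>s = 1\<close>, \<open>a = 1\<close> and \<open>b < p\<close> this forces the dimension of every object into the prime
  field. Taking for \<open>a\<close> the highest power of \<open>p\<close> below \<open>a + b\<close>, it determines all dimensions from
  those in the degrees \<open>p\<^sup>j\<close>. Up to sign the binomial coefficients \<open>(T choose n)\<close> satisfy the same
  relations, and the base \<open>p\<close> digits of \<open>T\<close> can be chosen one after the other so as to match the
  degrees \<open>p\<^sup>j\<close>.
\<close>

section \<open>Whiskering in symmetric monoidal categories\<close>

text \<open>In characteristic p there is no symmetrizer to project with, and dim X does not
  determine the dimensions of its powers: each degree p^j contributes one new p-adic digit. What
  survives without dividing by n! are \<open>comult\<close> and \<open>gmult\<close>, composed in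
  both orders. The scalars c b a need no closed form: if D(z) is the series of dimensions, the
  recurrence says that the sum over a of c b a * z^a is D(z) * (1 - s z)^(-b), so that D behaves
  like a power of 1 - s z whose exponent is shifted by b. The binomial coefficient used in degree n,
  with p^j <= n < p^(j+1), is the leading base p digit of n by Lucas, hence invertible.

  The two cases differ in u and not just in s: in characteristic 2 the signs coincide, while the
  image of c - 1 can be smaller than the kernel of c + 1. With the cokernel of c - 1 for u, the
  kernel of u is that image.

  The other obstacle is coherence. Products are bracketed to the left and traces over several
  factors are taken one factor at a time, so that duals of tensor products and of morphisms never
  appear.\<close>

context small_category
begin

lemma arrows_iff [simp]: "f \<in> arrows C X Y \<longleftrightarrow> f \<in> Arr C \<and> Dom C f = X \<and> Cod C f = Y"
  by (simp add: arrows_def)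

lemma Dom_Obj' [simp]: "f \<in> Arr C \<Longrightarrow> Dom C f \<in> Obj C"
  by (rule Dom_Obj)

lemma Cod_Obj' [simp]: "f \<in> Arr C \<Longrightarrow> Cod C f \<in> Obj C"
  by (rule Cod_Obj)

lemma Id_type [simp]:
  assumes "X \<in> Obj C"
  shows "Id C X \<in> Arr C" "Dom C (Id C X) = X" "Cod C (Id C X) = X"
  using Id_arrows[OF assms] by simp_all

lemma Comp_type [simp]:
  assumes "f \<in> Arr C" "g \<in> Arr C" "Dom C g = Cod C f"
  shows "g \<cdot> f \<in> Arr C" "Dom C (g \<cdot> f) = Dom C f" "Cod C (g \<cdot> f) = Cod C g"
  using Comp_arrows[of f "Dom C f" "Cod C f" g "Cod C g"] assms by simp_all

lemma Comp_Id_left [simp]: "f \<in> Arr C \<Longrightarrow> Cod C f = Y \<Longrightarrow> Id C Y \<cdot> f = f"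
  using Id_left[of f "Dom C f" Y] by simp

lemma Comp_Id_right [simp]: "f \<in> Arr C \<Longrightarrow> Dom C f = X \<Longrightarrow> f \<cdot> Id C X = f"
  using Id_right[of f X "Cod C f"] by simp

lemma Comp_assoc' [simp]:
  "f \<in> Arr C \<Longrightarrow> g \<in> Arr C \<Longrightarrow> h \<in> Arr C \<Longrightarrow> Dom C g = Cod C f \<Longrightarrow> Dom C h = Cod C g \<Longrightarrow>
    (h \<cdot> g) \<cdot> f = h \<cdot> g \<cdot> f"
  using Comp_assoc[of f "Dom C f" "Cod C f" g "Cod C g" h "Cod C h"] by simp

text \<open>Composites are normalised to right-nested form, where a rule for
  \<open>a \<cdot> b\<close> no longer matches inside a longer composite. Appending an arbitrary
  \<open>k\<close> restores the match; most diagram steps are applied as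
  \<open>reassoc[OF ...]\<close>.\<close>

lemma reassoc:
  "a \<cdot> b = c \<Longrightarrow> a \<in> Arr C \<Longrightarrow> b \<in> Arr C \<Longrightarrow> k \<in> Arr C \<Longrightarrow>
    Dom C a = Cod C b \<Longrightarrow> Dom C b = Cod C k \<Longrightarrow> a \<cdot> b \<cdot> k = c \<cdot> k"
  using Comp_assoc'[of k b a] by simp

lemma reassoc3:
  "a \<cdot> b \<cdot> c = d \<Longrightarrow> a \<in> Arr C \<Longrightarrow> b \<in> Arr C \<Longrightarrow> c \<in> Arr C \<Longrightarrow> k \<in> Arr C \<Longrightarrow>
    Dom C a = Cod C b \<Longrightarrow> Dom C b = Cod C c \<Longrightarrow> Dom C c = Cod C k \<Longrightarrow> a \<cdot> b \<cdot> c \<cdot> k = d \<cdot> k"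
  using Comp_assoc'[of k "b \<cdot> c" a] by simp

lemma inverse_unique:
  assumes "inverse_arrows C f g" "inverse_arrows C f h"
  shows "g = h"
proof -
  have "g \<cdot> f \<cdot> h = h"
    using assms Comp_assoc'[of h f g] by (simp add: inverse_arrows_def)
  then show ?thesis using assms by (simp add: inverse_arrows_def)
qed

lemma inv_arrow:
  assumes "iso_arrow C f"
  shows "inverse_arrows C f (inv_arrow C f)"
proof -
  obtain g where "inverse_arrows C f g" using assms by (auto simp: iso_arrow_def)
  then show ?thesis
    unfolding inv_arrow_def by (rule theI) (metis inverse_unique \<open>inverse_arrows C f g\<close>)
qed

lemma cancel_iso_left:
  assumes "f \<cdot> x = f \<cdot> y" "h \<cdot> f = Id C (Dom C f)" "h \<in> Arr C" "f \<in> Arr C" "Dom C h = Cod C f"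
    "x \<in> Arr C" "y \<in> Arr C" "Cod C x = Dom C f" "Cod C y = Dom C f"
  shows "x = y"
proof -
  have "h \<cdot> f \<cdot> x = h \<cdot> f \<cdot> y" using assms(1) by simp
  then show ?thesis using assms Comp_assoc'[of x f h] Comp_assoc'[of y f h] by simp
qed

lemma cancel_iso_right:
  assumes "x \<cdot> f = y \<cdot> f" "f \<cdot> h = Id C (Cod C f)" "h \<in> Arr C" "f \<in> Arr C" "Cod C h = Dom C f"
    "x \<in> Arr C" "y \<in> Arr C" "Dom C x = Cod C f" "Dom C y = Cod C f"
  shows "x = y"
proof -
  have "x = (x \<cdot> f) \<cdot> h" using assms(2-) by simp
  also have "\<dots> = y" unfolding assms(1) using assms(2-) by simp
  finally show ?thesis .
qed

end

context symmetric_monoidal_category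
begin

text \<open>Diagrams are written as composites of generators tensored with identities, which gives
  the simplifier one normal form; generators acting on disjoint factors commute by
  \<open>whisker_exchange\<close>.\<close>

definition "rwhisker f Z = f \<boxtimes> Id C Z"

definition "lwhisker A f = Id C A \<boxtimes> f"

definition "assoc_inv A B D = inv_arrow C (Assoc C A B D)"

text \<open>The symmetry on the last two factors of a left-bracketed product, with \<open>A\<close>
  as background. With every crossing in this form, associators hardly enter the string diagram
  arguments.\<close>

definition "swap_last A B D = assoc_inv A D B \<cdot> lwhisker A (Braid C B D) \<cdot> Assoc C A B D"

lemma Unit_Obj' [simp]: "Unit C \<in> Obj C"
  by (rule Unit_Obj)

lemma TensorObj_Obj' [simp]: "X \<in> Obj C \<Longrightarrow> Y \<in> Obj C \<Longrightarrow> X \<star> Y \<in> Obj C"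
  by (rule TensorObj_Obj)

lemma TensorArr_type [simp]:
  assumes "f \<in> Arr C" "g \<in> Arr C"
  shows "f \<boxtimes> g \<in> Arr C" "Dom C (f \<boxtimes> g) = Dom C f \<star> Dom C g" "Cod C (f \<boxtimes> g) = Cod C f \<star> Cod C g"
  using TensorArr_arrows[of f "Dom C f" "Cod C f" g "Dom C g" "Cod C g"] assms by simp_all

lemma rwhisker_type [simp]:
  assumes "f \<in> Arr C" "Z \<in> Obj C"
  shows "rwhisker f Z \<in> Arr C" "Dom C (rwhisker f Z) = Dom C f \<star> Z"
    "Cod C (rwhisker f Z) = Cod C f \<star> Z"
  using assms by (simp_all add: rwhisker_def)

lemma lwhisker_type [simp]:
  assumes "f \<in> Arr C" "Z \<in> Obj C"
  shows "lwhisker Z f \<in> Arr C" "Dom C (lwhisker Z f) = Z \<star> Dom C f"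
    "Cod C (lwhisker Z f) = Z \<star> Cod C f"
  using assms by (simp_all add: lwhisker_def)

lemma Assoc_type [simp]:
  assumes "X \<in> Obj C" "Y \<in> Obj C" "Z \<in> Obj C"
  shows "Assoc C X Y Z \<in> Arr C" "Dom C (Assoc C X Y Z) = (X \<star> Y) \<star> Z"
    "Cod C (Assoc C X Y Z) = X \<star> Y \<star> Z"
  using Assoc_arrows[OF assms] by simp_all

lemma assoc_inv [simp]:
  assumes "X \<in> Obj C" "Y \<in> Obj C" "Z \<in> Obj C"
  shows "assoc_inv X Y Z \<in> Arr C" "Cod C (assoc_inv X Y Z) = (X \<star> Y) \<star> Z"
    "Dom C (assoc_inv X Y Z) = X \<star> Y \<star> Z"
    "assoc_inv X Y Z \<cdot> Assoc C X Y Z = Id C ((X \<star> Y) \<star> Z)"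
    "Assoc C X Y Z \<cdot> assoc_inv X Y Z = Id C (X \<star> Y \<star> Z)"
  using inv_arrow[OF Assoc_iso[OF assms]] assms
  by (simp_all add: inverse_arrows_def assoc_inv_def)

lemmas assoc_inv_cancel [simp] =
  reassoc[OF assoc_inv(4)] reassoc[OF assoc_inv(5)]

lemma RUnit_type [simp]:
  assumes "X \<in> Obj C"
  shows "RUnit C X \<in> Arr C" "Dom C (RUnit C X) = X \<star> Unit C" "Cod C (RUnit C X) = X"
  using RUnit_arrows[OF assms] by simp_all

lemma LUnit_type [simp]:
  assumes "X \<in> Obj C"
  shows "LUnit C X \<in> Arr C" "Dom C (LUnit C X) = Unit C \<star> X" "Cod C (LUnit C X) = X"
  using LUnit_arrows[OF assms] by simp_all

definition "runit_inv X = inv_arrow C (RUnit C X)"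
definition "lunit_inv X = inv_arrow C (LUnit C X)"

lemma runit_inv [simp]:
  assumes "X \<in> Obj C"
  shows "runit_inv X \<in> Arr C" "Cod C (runit_inv X) = X \<star> Unit C" "Dom C (runit_inv X) = X"
    "runit_inv X \<cdot> RUnit C X = Id C (X \<star> Unit C)" "RUnit C X \<cdot> runit_inv X = Id C X"
  using inv_arrow[OF RUnit_iso[OF assms]] assms
  by (simp_all add: inverse_arrows_def runit_inv_def)

lemma lunit_inv [simp]:
  assumes "X \<in> Obj C"
  shows "lunit_inv X \<in> Arr C" "Cod C (lunit_inv X) = Unit C \<star> X" "Dom C (lunit_inv X) = X"
    "lunit_inv X \<cdot> LUnit C X = Id C (Unit C \<star> X)" "LUnit C X \<cdot> lunit_inv X = Id C X"
  using inv_arrow[OF LUnit_iso[OF assms]] assms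
  by (simp_all add: inverse_arrows_def lunit_inv_def)

lemmas unit_inv_cancel [simp] =
  reassoc[OF runit_inv(4)] reassoc[OF runit_inv(5)]
  reassoc[OF lunit_inv(4)] reassoc[OF lunit_inv(5)]

lemma Braid_type [simp]:
  assumes "X \<in> Obj C" "Y \<in> Obj C"
  shows "Braid C X Y \<in> Arr C" "Dom C (Braid C X Y) = X \<star> Y" "Cod C (Braid C X Y) = Y \<star> X"
  using Braid_arrows[OF assms] by simp_all

lemma Braid_Braid [simp]:
  "X \<in> Obj C \<Longrightarrow> Y \<in> Obj C \<Longrightarrow> Braid C Y X \<cdot> Braid C X Y = Id C (X \<star> Y)"
  by (rule Braid_symmetric)

lemmas Braid_cancel [simp] = reassoc[OF Braid_Braid]

lemma interchange:
  "f \<in> Arr C \<Longrightarrow> g \<in> Arr C \<Longrightarrow> f' \<in> Arr C \<Longrightarrow> g' \<in> Arr C \<Longrightarrow> Dom C f' = Cod C f \<Longrightarrow>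
    Dom C g' = Cod C g \<Longrightarrow> (f' \<boxtimes> g') \<cdot> (f \<boxtimes> g) = (f' \<cdot> f) \<boxtimes> (g' \<cdot> g)"
  using TensorArr_Comp[of f "Dom C f" "Cod C f" f' "Cod C f'" g "Dom C g" "Cod C g" g' "Cod C g'"]
  by simp

lemma whisker_Id [simp]:
  "A \<in> Obj C \<Longrightarrow> B \<in> Obj C \<Longrightarrow> rwhisker (Id C A) B = Id C (A \<star> B)"
  "A \<in> Obj C \<Longrightarrow> B \<in> Obj C \<Longrightarrow> lwhisker A (Id C B) = Id C (A \<star> B)"
  by (simp_all add: rwhisker_def lwhisker_def TensorArr_Id)

lemma rwhisker_Comp [simp]:
  "f \<in> Arr C \<Longrightarrow> g \<in> Arr C \<Longrightarrow> Dom C g = Cod C f \<Longrightarrow> Z \<in> Obj C \<Longrightarrow>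
    rwhisker (g \<cdot> f) Z = rwhisker g Z \<cdot> rwhisker f Z"
  by (simp add: rwhisker_def interchange)

lemma lwhisker_Comp [simp]:
  "f \<in> Arr C \<Longrightarrow> g \<in> Arr C \<Longrightarrow> Dom C g = Cod C f \<Longrightarrow> Z \<in> Obj C \<Longrightarrow>
    lwhisker Z (g \<cdot> f) = lwhisker Z g \<cdot> lwhisker Z f"
  by (simp add: lwhisker_def interchange)

lemma whisker_exchange:
  "f \<in> Arr C \<Longrightarrow> g \<in> Arr C \<Longrightarrow> Dom C f = A \<Longrightarrow> Cod C f = A' \<Longrightarrow> Dom C g = B \<Longrightarrow> Cod C g = B' \<Longrightarrow>
    rwhisker f B' \<cdot> lwhisker A g = lwhisker A' g \<cdot> rwhisker f B"
  by (auto simp add: rwhisker_def lwhisker_def interchange)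

lemma assoc_right:
  "f \<in> Arr C \<Longrightarrow> Y \<in> Obj C \<Longrightarrow> Z \<in> Obj C \<Longrightarrow> Dom C f = A \<Longrightarrow> Cod C f = A' \<Longrightarrow>
    Assoc C A' Y Z \<cdot> rwhisker (rwhisker f Y) Z = rwhisker f (Y \<star> Z) \<cdot> Assoc C A Y Z"
  using Assoc_natural[of f A A' "Id C Y" Y Y "Id C Z" Z Z]
  by (simp add: rwhisker_def TensorArr_Id)

lemma assoc_middle:
  "f \<in> Arr C \<Longrightarrow> Y \<in> Obj C \<Longrightarrow> Z \<in> Obj C \<Longrightarrow> Dom C f = A \<Longrightarrow> Cod C f = A' \<Longrightarrow>
    Assoc C Y A' Z \<cdot> rwhisker (lwhisker Y f) Z = lwhisker Y (rwhisker f Z) \<cdot> Assoc C Y A Z"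
  using Assoc_natural[of "Id C Y" Y Y f A A' "Id C Z" Z Z]
  by (simp add: rwhisker_def lwhisker_def)

lemma assoc_left:
  "f \<in> Arr C \<Longrightarrow> Y \<in> Obj C \<Longrightarrow> Z \<in> Obj C \<Longrightarrow> Dom C f = A \<Longrightarrow> Cod C f = A' \<Longrightarrow>
    Assoc C Y Z A' \<cdot> lwhisker (Y \<star> Z) f = lwhisker Y (lwhisker Z f) \<cdot> Assoc C Y Z A"
  using Assoc_natural[of "Id C Y" Y Y "Id C Z" Z Z f A A']
  by (simp add: lwhisker_def TensorArr_Id)

lemma Comp_iso_swap:
  assumes "a' \<cdot> f = g \<cdot> a" "b \<cdot> a' = Id C (Dom C a')" "a \<cdot> c = Id C (Cod C a)"
    "a \<in> Arr C" "a' \<in> Arr C" "b \<in> Arr C" "c \<in> Arr C" "f \<in> Arr C" "g \<in> Arr C"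
    "Cod C f = Dom C a'" "Dom C f = Dom C a" "Dom C g = Cod C a" "Dom C b = Cod C a'"
    "Cod C c = Dom C a" "Cod C g = Cod C a'"
  shows "b \<cdot> g = f \<cdot> c"
proof -
  have "b \<cdot> g = b \<cdot> (g \<cdot> a) \<cdot> c" using assms(2-) by simp
  also have "\<dots> = (b \<cdot> a') \<cdot> f \<cdot> c" unfolding assms(1)[symmetric] using assms(4-) by simp
  also have "\<dots> = f \<cdot> c" unfolding assms(2) using assms(3-) by simp
  finally show ?thesis .
qed

lemma assoc_inv_right:
  "f \<in> Arr C \<Longrightarrow> Y \<in> Obj C \<Longrightarrow> Z \<in> Obj C \<Longrightarrow> Dom C f = A \<Longrightarrow> Cod C f = A' \<Longrightarrow>
    assoc_inv A' Y Z \<cdot> rwhisker f (Y \<star> Z) = rwhisker (rwhisker f Y) Z \<cdot> assoc_inv A Y Z"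
  by (rule Comp_iso_swap[OF assoc_right]) auto

lemma assoc_inv_middle:
  "f \<in> Arr C \<Longrightarrow> Y \<in> Obj C \<Longrightarrow> Z \<in> Obj C \<Longrightarrow> Dom C f = A \<Longrightarrow> Cod C f = A' \<Longrightarrow>
    assoc_inv Y A' Z \<cdot> lwhisker Y (rwhisker f Z) = rwhisker (lwhisker Y f) Z \<cdot> assoc_inv Y A Z"
  by (rule Comp_iso_swap[OF assoc_middle]) auto

lemma assoc_inv_left:
  "f \<in> Arr C \<Longrightarrow> Y \<in> Obj C \<Longrightarrow> Z \<in> Obj C \<Longrightarrow> Dom C f = A \<Longrightarrow> Cod C f = A' \<Longrightarrow>
    assoc_inv Y Z A' \<cdot> lwhisker Y (lwhisker Z f) = lwhisker (Y \<star> Z) f \<cdot> assoc_inv Y Z A"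
  by (rule Comp_iso_swap[OF assoc_left]) auto

lemma runit_natural:
  "f \<in> Arr C \<Longrightarrow> Dom C f = A \<Longrightarrow> Cod C f = A' \<Longrightarrow> RUnit C A' \<cdot> rwhisker f (Unit C) = f \<cdot> RUnit C A"
  using RUnit_natural[of f A A'] by (simp add: rwhisker_def)

lemma lunit_natural:
  "f \<in> Arr C \<Longrightarrow> Dom C f = A \<Longrightarrow> Cod C f = A' \<Longrightarrow> LUnit C A' \<cdot> lwhisker (Unit C) f = f \<cdot> LUnit C A"
  using LUnit_natural[of f A A'] by (simp add: lwhisker_def)

lemma runit_inv_natural:
  "f \<in> Arr C \<Longrightarrow> Dom C f = A \<Longrightarrow> Cod C f = A' \<Longrightarrow> runit_inv A' \<cdot> f = rwhisker f (Unit C) \<cdot> runit_inv A"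
  by (rule Comp_iso_swap[OF runit_natural]) auto

lemma lunit_inv_natural:
  "f \<in> Arr C \<Longrightarrow> Dom C f = A \<Longrightarrow> Cod C f = A' \<Longrightarrow> lunit_inv A' \<cdot> f = lwhisker (Unit C) f \<cdot> lunit_inv A"
  by (rule Comp_iso_swap[OF lunit_natural]) auto

lemma braid_right:
  "f \<in> Arr C \<Longrightarrow> Y \<in> Obj C \<Longrightarrow> Dom C f = A \<Longrightarrow> Cod C f = A' \<Longrightarrow>
    Braid C A' Y \<cdot> rwhisker f Y = lwhisker Y f \<cdot> Braid C A Y"
  using Braid_natural[of f A A' "Id C Y" Y Y] by (simp add: lwhisker_def rwhisker_def)

lemma braid_left:
  "f \<in> Arr C \<Longrightarrow> Y \<in> Obj C \<Longrightarrow> Dom C f = A \<Longrightarrow> Cod C f = A' \<Longrightarrow>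
    Braid C Y A' \<cdot> lwhisker Y f = rwhisker f Y \<cdot> Braid C Y A"
  using Braid_natural[of "Id C Y" Y Y f A A'] by (simp add: lwhisker_def rwhisker_def)

lemma pentagon':
  "W \<in> Obj C \<Longrightarrow> X \<in> Obj C \<Longrightarrow> Y \<in> Obj C \<Longrightarrow> Z \<in> Obj C \<Longrightarrow>
    Assoc C W X (Y \<star> Z) \<cdot> Assoc C (W \<star> X) Y Z =
    lwhisker W (Assoc C X Y Z) \<cdot> Assoc C W (X \<star> Y) Z \<cdot> rwhisker (Assoc C W X Y) Z"
  using pentagon by (simp add: lwhisker_def rwhisker_def)

lemma triangle':
  "X \<in> Obj C \<Longrightarrow> Y \<in> Obj C \<Longrightarrow>
    lwhisker X (LUnit C Y) \<cdot> Assoc C X (Unit C) Y = rwhisker (RUnit C X) Y"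
  using triangle by (simp add: lwhisker_def rwhisker_def)

lemma hexagon':
  "X \<in> Obj C \<Longrightarrow> Y \<in> Obj C \<Longrightarrow> Z \<in> Obj C \<Longrightarrow>
    Assoc C Y Z X \<cdot> Braid C X (Y \<star> Z) \<cdot> Assoc C X Y Z =
    lwhisker Y (Braid C X Z) \<cdot> Assoc C Y X Z \<cdot> rwhisker (Braid C X Y) Z"
  using hexagon by (simp add: lwhisker_def rwhisker_def)

text \<open>Tensoring with the unit is naturally isomorphic to the identity functor, hence faithful.
  The coherence lemmas introduce an extra unit to make the pentagon or the hexagon applicable and
  cancel it afterwards.\<close>

lemma rwhisker_Unit_cancel:
  assumes "rwhisker f (Unit C) = rwhisker g (Unit C)" "f \<in> Arr C" "g \<in> Arr C"
    "Dom C f = Dom C g" "Cod C f = Cod C g"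
  shows "f = g"
proof (rule cancel_iso_right[where f = "RUnit C (Dom C f)" and h = "runit_inv (Dom C f)"])
  show "f \<cdot> RUnit C (Dom C f) = g \<cdot> RUnit C (Dom C f)"
    using runit_natural[of f] runit_natural[of g] assms by simp
qed (use assms in auto)

lemma lwhisker_Unit_cancel:
  assumes "lwhisker (Unit C) f = lwhisker (Unit C) g" "f \<in> Arr C" "g \<in> Arr C"
    "Dom C f = Dom C g" "Cod C f = Cod C g"
  shows "f = g"
proof (rule cancel_iso_right[where f = "LUnit C (Dom C f)" and h = "lunit_inv (Dom C f)"])
  show "f \<cdot> LUnit C (Dom C f) = g \<cdot> LUnit C (Dom C f)"
    using lunit_natural[of f] lunit_natural[of g] assms by simp
qed (use assms in auto)


subsection \<open>Coherence\<close>

text \<open>Pentagon for A, B, 1, 1: the triangle axiom applies to both composites, and once the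
  associator and the extra unit are cancelled the claim is left. \<open>lunit_tensor\<close> is the
  mirror image with 1, 1, A, B.\<close>

lemma runit_tensor:
  assumes [simp]: "A \<in> Obj C" "B \<in> Obj C"
  shows "lwhisker A (RUnit C B) \<cdot> Assoc C A B (Unit C) = RUnit C (A \<star> B)"
proof -
  let ?I = "Unit C"
  have "Assoc C A B ?I \<cdot> rwhisker (lwhisker A (RUnit C B) \<cdot> Assoc C A B ?I) ?I
      = lwhisker A (rwhisker (RUnit C B) ?I) \<cdot> Assoc C A (B \<star> ?I) ?I \<cdot> rwhisker (Assoc C A B ?I) ?I"
    by (simp add: reassoc[OF assoc_middle])
  also have "\<dots> = lwhisker A (lwhisker B (LUnit C ?I)) \<cdot> Assoc C A B (?I \<star> ?I) \<cdot>
      Assoc C (A \<star> B) ?I ?I"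
    by (simp add: pentagon' triangle'[symmetric])
  also have "\<dots> = Assoc C A B ?I \<cdot> rwhisker (RUnit C (A \<star> B)) ?I"
    by (simp add: triangle'[symmetric] reassoc[OF assoc_left])
  finally have "Assoc C A B ?I \<cdot> rwhisker (lwhisker A (RUnit C B) \<cdot> Assoc C A B ?I) ?I
      = Assoc C A B ?I \<cdot> rwhisker (RUnit C (A \<star> B)) ?I" .
  then have "rwhisker (lwhisker A (RUnit C B) \<cdot> Assoc C A B ?I) ?I = rwhisker (RUnit C (A \<star> B)) ?I"
    by (rule cancel_iso_left[where h = "assoc_inv A B ?I"]) auto
  then show ?thesis
    by (rule rwhisker_Unit_cancel) auto
qed

lemma lunit_tensor:
  assumes [simp]: "A \<in> Obj C" "B \<in> Obj C"
  shows "LUnit C (A \<star> B) \<cdot> Assoc C (Unit C) A B = rwhisker (LUnit C A) B"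
proof -
  let ?I = "Unit C"
  let ?k = "Assoc C ?I (?I \<star> A) B \<cdot> rwhisker (Assoc C ?I ?I A) B"
  let ?k' = "rwhisker (assoc_inv ?I ?I A) B \<cdot> assoc_inv ?I (?I \<star> A) B"
  have "lwhisker ?I (LUnit C (A \<star> B) \<cdot> Assoc C ?I A B) \<cdot> ?k
      = lwhisker ?I (LUnit C (A \<star> B)) \<cdot> Assoc C ?I ?I (A \<star> B) \<cdot> Assoc C (?I \<star> ?I) A B"
    by (simp add: pentagon')
  also have "\<dots> = Assoc C ?I A B \<cdot> rwhisker (rwhisker (RUnit C ?I) A) B"
    by (simp add: reassoc[OF triangle'] assoc_right)
  also have "\<dots> = lwhisker ?I (rwhisker (LUnit C A) B) \<cdot> ?k"
    by (simp add: triangle'[symmetric] reassoc[OF assoc_middle])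
  finally have "lwhisker ?I (LUnit C (A \<star> B) \<cdot> Assoc C ?I A B) \<cdot> ?k
      = lwhisker ?I (rwhisker (LUnit C A) B) \<cdot> ?k" .
  moreover have "?k \<cdot> ?k' = Id C (?I \<star> (?I \<star> A) \<star> B)"
    by (simp add: reassoc[OF rwhisker_Comp[symmetric]] del: rwhisker_Comp) 
  ultimately have "lwhisker ?I (LUnit C (A \<star> B) \<cdot> Assoc C ?I A B) =
      lwhisker ?I (rwhisker (LUnit C A) B)"
    by - (rule cancel_iso_right[where f = ?k and h = ?k'], auto)
  then show ?thesis
    by (rule lwhisker_Unit_cancel) auto
qed

text \<open>Hexagon for X, 1, 1: both composites become the braiding after a whiskered unitor, and
  cancelling the braiding and the extra unit leaves the claim.\<close>

lemma braid_Unit: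
  assumes [simp]: "X \<in> Obj C"
  shows "LUnit C X \<cdot> Braid C X (Unit C) = RUnit C X"
proof -
  let ?I = "Unit C"
  let ?b = "Braid C X ?I"
  have "LUnit C (?I \<star> X) \<cdot> Assoc C ?I ?I X \<cdot> Braid C X (?I \<star> ?I) \<cdot> Assoc C X ?I ?I
      = ?b \<cdot> rwhisker (RUnit C X) ?I"
    by (simp add: reassoc[OF lunit_tensor] reassoc[OF braid_left[symmetric]] triangle')
  moreover have "LUnit C (?I \<star> X) \<cdot> lwhisker ?I ?b \<cdot> Assoc C ?I X ?I \<cdot> rwhisker ?b ?I
      = ?b \<cdot> rwhisker (LUnit C X \<cdot> ?b) ?I"
    by (simp add: reassoc[OF lunit_natural] reassoc[OF lunit_tensor])
  ultimately have "?b \<cdot> rwhisker (RUnit C X) ?I = ?b \<cdot> rwhisker (LUnit C X \<cdot> ?b) ?I"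
    by (simp add: hexagon')
  then have "rwhisker (RUnit C X) ?I = rwhisker (LUnit C X \<cdot> ?b) ?I"
    by (rule cancel_iso_left[where f = ?b and h = "Braid C ?I X"]) auto
  from rwhisker_Unit_cancel[OF this] show ?thesis by simp
qed

lemma swap_last_type [simp]:
  assumes "A \<in> Obj C" "B \<in> Obj C" "D \<in> Obj C"
  shows "swap_last A B D \<in> Arr C" "Dom C (swap_last A B D) = (A \<star> B) \<star> D"
    "Cod C (swap_last A B D) = (A \<star> D) \<star> B"
  using assms by (simp_all add: swap_last_def)

lemma swap_last_swap_last [simp]:
  assumes [simp]: "A \<in> Obj C" "B \<in> Obj C" "D \<in> Obj C"
  shows "swap_last A D B \<cdot> swap_last A B D = Id C ((A \<star> B) \<star> D)"
  by (simp add: swap_last_def reassoc[OF lwhisker_Comp[symmetric]] del: lwhisker_Comp)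

lemmas swap_last_cancel [simp] = reassoc[OF swap_last_swap_last]

lemma swap_last_right:
  assumes [simp]: "f \<in> Arr C" "Dom C f = A" "Cod C f = A'" "A \<in> Obj C" "A' \<in> Obj C" "B \<in> Obj C"
      "D \<in> Obj C"
  shows "swap_last A' B D \<cdot> rwhisker (rwhisker f B) D =
    rwhisker (rwhisker f D) B \<cdot> swap_last A B D"
  by (simp add: swap_last_def assoc_right reassoc[OF assoc_inv_right[symmetric]]
      reassoc[OF whisker_exchange[symmetric]])

lemma swap_last_middle:
  assumes [simp]: "f \<in> Arr C" "Dom C f = B" "Cod C f = B'" "A \<in> Obj C" "B \<in> Obj C" "B' \<in> Obj C"
      "D \<in> Obj C"
  shows "swap_last A B' D \<cdot> rwhisker (lwhisker A f) D =
    lwhisker (A \<star> D) f \<cdot> swap_last A B D"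
proof -
  have "lwhisker A (Braid C B' D) \<cdot> lwhisker A (rwhisker f D) =
    lwhisker A (lwhisker D f) \<cdot> lwhisker A (Braid C B D)"
    using arg_cong[OF braid_right[of f D B B'], of "lwhisker A"] by simp
  from reassoc[OF this] show ?thesis
    by (simp add: swap_last_def assoc_middle reassoc[OF assoc_inv_left[symmetric]])
qed

lemma swap_last_left:
  assumes [simp]: "f \<in> Arr C" "Dom C f = D" "Cod C f = D'" "A \<in> Obj C" "B \<in> Obj C" "D \<in> Obj C"
      "D' \<in> Obj C"
  shows "swap_last A B D' \<cdot> lwhisker (A \<star> B) f =
    rwhisker (lwhisker A f) B \<cdot> swap_last A B D"
proof -
  have "lwhisker A (Braid C B D') \<cdot> lwhisker A (lwhisker B f) =
    lwhisker A (rwhisker f B) \<cdot> lwhisker A (Braid C B D)"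
    using arg_cong[OF braid_left[of f B D D'], of "lwhisker A"] by simp
  from reassoc[OF this] show ?thesis
    by (simp add: swap_last_def assoc_left reassoc[OF assoc_inv_middle[symmetric]])
qed


lemma lwhisker_inverse:
  "g \<cdot> f = Id C (Dom C f) \<Longrightarrow> f \<in> Arr C \<Longrightarrow> g \<in> Arr C \<Longrightarrow> Dom C g = Cod C f \<Longrightarrow> Z \<in> Obj C \<Longrightarrow>
    lwhisker Z g \<cdot> lwhisker Z f = Id C (Z \<star> Dom C f)"
  using lwhisker_Comp[of f g Z] by simp

lemma rwhisker_inverse:
  "g \<cdot> f = Id C (Dom C f) \<Longrightarrow> f \<in> Arr C \<Longrightarrow> g \<in> Arr C \<Longrightarrow> Dom C g = Cod C f \<Longrightarrow> Z \<in> Obj C \<Longrightarrow>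
    rwhisker g Z \<cdot> rwhisker f Z = Id C (Dom C f \<star> Z)"
  using rwhisker_Comp[of f g Z] by simp

lemma whisker_cancel [simp]:
  assumes [simp]: "W \<in> Obj C" "X \<in> Obj C" "Y \<in> Obj C" "Z \<in> Obj C"
  shows "lwhisker W (assoc_inv X Y Z) \<cdot> lwhisker W (Assoc C X Y Z) = Id C (W \<star> (X \<star> Y) \<star> Z)"
    "lwhisker W (Assoc C X Y Z) \<cdot> lwhisker W (assoc_inv X Y Z) = Id C (W \<star> X \<star> Y \<star> Z)"
    "rwhisker (assoc_inv X Y Z) W \<cdot> rwhisker (Assoc C X Y Z) W = Id C (((X \<star> Y) \<star> Z) \<star> W)"
    "rwhisker (Assoc C X Y Z) W \<cdot> rwhisker (assoc_inv X Y Z) W = Id C ((X \<star> Y \<star> Z) \<star> W)"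
    "rwhisker (swap_last X Z Y) W \<cdot> rwhisker (swap_last X Y Z) W = Id C (((X \<star> Y) \<star> Z) \<star> W)"
  by (simp_all add: lwhisker_inverse rwhisker_inverse)

lemma whisker_unit_cancel [simp]:
  assumes [simp]: "W \<in> Obj C" "X \<in> Obj C"
  shows "lwhisker W (LUnit C X) \<cdot> lwhisker W (lunit_inv X) = Id C (W \<star> X)"
    "lwhisker W (lunit_inv X) \<cdot> lwhisker W (LUnit C X) = Id C (W \<star> Unit C \<star> X)"
    "rwhisker (RUnit C X) W \<cdot> rwhisker (runit_inv X) W = Id C (X \<star> W)"
    "rwhisker (runit_inv X) W \<cdot> rwhisker (RUnit C X) W = Id C ((X \<star> Unit C) \<star> W)"
    "rwhisker (LUnit C X) W \<cdot> rwhisker (lunit_inv X) W = Id C (X \<star> W)"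
    "rwhisker (lunit_inv X) W \<cdot> rwhisker (LUnit C X) W = Id C ((Unit C \<star> X) \<star> W)"
  by (simp_all add: lwhisker_inverse rwhisker_inverse)

lemma whisker_Braid_cancel [simp]:
  assumes [simp]: "W \<in> Obj C" "X \<in> Obj C" "Y \<in> Obj C"
  shows "lwhisker W (Braid C Y X) \<cdot> lwhisker W (Braid C X Y) = Id C (W \<star> X \<star> Y)"
  by (simp_all add: lwhisker_inverse rwhisker_inverse)

lemmas whisker_cancel' [simp] =
  whisker_cancel[THEN reassoc] whisker_unit_cancel[THEN reassoc]
  whisker_Braid_cancel[THEN reassoc]

lemma pentagon_inv:
  assumes [simp]: "A \<in> Obj C" "P \<in> Obj C" "Z \<in> Obj C" "X \<in> Obj C"
  shows "rwhisker (assoc_inv A P Z) X \<cdot> assoc_inv A (P \<star> Z) X =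
    assoc_inv (A \<star> P) Z X \<cdot> assoc_inv A P (Z \<star> X) \<cdot> lwhisker A (Assoc C P Z X)"
proof -
  have "assoc_inv (A \<star> P) Z X \<cdot> assoc_inv A P (Z \<star> X) \<cdot>
      (lwhisker A (Assoc C P Z X) \<cdot> Assoc C A (P \<star> Z) X \<cdot> rwhisker (Assoc C A P Z) X) \<cdot>
      rwhisker (assoc_inv A P Z) X \<cdot> assoc_inv A (P \<star> Z) X
    = rwhisker (assoc_inv A P Z) X \<cdot> assoc_inv A (P \<star> Z) X"
    by (subst pentagon'[symmetric]) simp_all
  then show ?thesis by simp
qed

lemma pentagon_middle:
  assumes [simp]: "A \<in> Obj C" "P \<in> Obj C" "X \<in> Obj C" "Z \<in> Obj C"
  shows "Assoc C (A \<star> P) X Z \<cdot> rwhisker (assoc_inv A P X) Z =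
    assoc_inv A P (X \<star> Z) \<cdot> lwhisker A (Assoc C P X Z) \<cdot> Assoc C A (P \<star> X) Z"
proof -
  have "assoc_inv A P (X \<star> Z) \<cdot>
      (lwhisker A (Assoc C P X Z) \<cdot> Assoc C A (P \<star> X) Z \<cdot> rwhisker (Assoc C A P X) Z) \<cdot>
      rwhisker (assoc_inv A P X) Z = Assoc C (A \<star> P) X Z \<cdot> rwhisker (assoc_inv A P X) Z"
    by (subst pentagon'[symmetric]) simp_all
  then show ?thesis by simp
qed

lemma pentagon_right:
  assumes [simp]: "A \<in> Obj C" "X \<in> Obj C" "P \<in> Obj C" "Z \<in> Obj C"
  shows "Assoc C A (X \<star> P) Z \<cdot> rwhisker (Assoc C A X P) Z \<cdot> assoc_inv (A \<star> X) P Z =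
    lwhisker A (assoc_inv X P Z) \<cdot> Assoc C A X (P \<star> Z)"
proof -
  have "lwhisker A (assoc_inv X P Z) \<cdot>
      (lwhisker A (Assoc C X P Z) \<cdot> Assoc C A (X \<star> P) Z \<cdot> rwhisker (Assoc C A X P) Z) \<cdot>
      assoc_inv (A \<star> X) P Z = lwhisker A (assoc_inv X P Z) \<cdot> Assoc C A X (P \<star> Z)"
    by (subst pentagon'[symmetric]) simp_all
  then show ?thesis by simp
qed

text \<open>The hexagon in left-bracketed form: \<open>X\<close> crosses \<open>P \<star> Z\<close>
  by crossing \<open>P\<close> and then \<open>Z\<close>. The variants of the pentagon above move
  the associators out of the way.\<close>

lemma swap_last_tensor:
  assumes [simp]: "A \<in> Obj C" "X \<in> Obj C" "P \<in> Obj C" "Z \<in> Obj C"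
  shows "rwhisker (assoc_inv A P Z) X \<cdot> swap_last A X (P \<star> Z) =
    swap_last (A \<star> P) X Z \<cdot> rwhisker (swap_last A X P) Z \<cdot> assoc_inv (A \<star> X) P Z"
proof -
  have hex: "Assoc C P Z X \<cdot> Braid C X (P \<star> Z) =
      lwhisker P (Braid C X Z) \<cdot> Assoc C P X Z \<cdot> rwhisker (Braid C X P) Z \<cdot> assoc_inv X P Z"
    using arg_cong[OF hexagon'[of X P Z], of "\<lambda>f. f \<cdot> assoc_inv X P Z"] by simp
  have "rwhisker (assoc_inv A P Z) X \<cdot> swap_last A X (P \<star> Z) =
      assoc_inv (A \<star> P) Z X \<cdot> assoc_inv A P (Z \<star> X) \<cdot>
        lwhisker A (Assoc C P Z X \<cdot> Braid C X (P \<star> Z)) \<cdot> Assoc C A X (P \<star> Z)"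
    by (simp add: swap_last_def reassoc[OF pentagon_inv])
  also have "\<dots> = assoc_inv (A \<star> P) Z X \<cdot> assoc_inv A P (Z \<star> X) \<cdot>
        lwhisker A (lwhisker P (Braid C X Z)) \<cdot> lwhisker A (Assoc C P X Z) \<cdot>
        lwhisker A (rwhisker (Braid C X P) Z) \<cdot> lwhisker A (assoc_inv X P Z) \<cdot> Assoc C A X (P \<star> Z)"
    unfolding hex by simp
  also have "\<dots> = swap_last (A \<star> P) X Z \<cdot> rwhisker (swap_last A X P) Z \<cdot> assoc_inv (A \<star> X) P Z"
    by (simp add: swap_last_def pentagon_right reassoc[OF pentagon_middle]
        reassoc[OF assoc_inv_left] reassoc[OF assoc_middle])
  finally show ?thesis .
qed

lemma swap_last_tensor':
  assumes [simp]: "A \<in> Obj C" "X \<in> Obj C" "P \<in> Obj C" "Z \<in> Obj C"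
  shows "assoc_inv (A \<star> X) P Z \<cdot> swap_last A (P \<star> Z) X =
    rwhisker (swap_last A P X) Z \<cdot> swap_last (A \<star> P) Z X \<cdot> rwhisker (assoc_inv A P Z) X"
proof -
  have "rwhisker (swap_last A P X) Z \<cdot> swap_last (A \<star> P) Z X \<cdot>
      (rwhisker (assoc_inv A P Z) X \<cdot> swap_last A X (P \<star> Z)) \<cdot> swap_last A (P \<star> Z) X
    = assoc_inv (A \<star> X) P Z \<cdot> swap_last A (P \<star> Z) X"
    by (subst swap_last_tensor) simp_all
  then show ?thesis by simp
qed

lemma swap_last_Unit:
  assumes [simp]: "A \<in> Obj C" "B \<in> Obj C"
  shows "rwhisker (RUnit C A) B \<cdot> swap_last A B (Unit C) = RUnit C (A \<star> B)"
proof -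
  have "rwhisker (RUnit C A) B \<cdot> swap_last A B (Unit C) =
      lwhisker A (LUnit C B \<cdot> Braid C B (Unit C)) \<cdot> Assoc C A B (Unit C)"
    by (simp add: swap_last_def triangle'[symmetric])
  also have "\<dots> = RUnit C (A \<star> B)" by (simp only: braid_Unit assms runit_tensor)
  finally show ?thesis .
qed

lemma RUnit_Unit: "A \<in> Obj C \<Longrightarrow> RUnit C (A \<star> Unit C) = rwhisker (RUnit C A) (Unit C)"
  using runit_natural[of "RUnit C A" "A \<star> Unit C" A]
  by - (rule cancel_iso_left[where f = "RUnit C A" and h = "runit_inv A"], auto)

lemma swap_last_Unit_Unit:
  assumes [simp]: "A \<in> Obj C"
  shows "swap_last A (Unit C) (Unit C) = Id C ((A \<star> Unit C) \<star> Unit C)"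
  using swap_last_Unit[of A "Unit C"]
  by - (rule cancel_iso_left[where f = "rwhisker (RUnit C A) (Unit C)" and h =
      "rwhisker (runit_inv A) (Unit C)"],
      simp_all add: RUnit_Unit)

text \<open>The braid relation. \<open>X\<close> has to cross the pair \<open>P \<star> Z\<close>,
  and by naturality \<open>P\<close> and \<open>Z\<close> may be exchanged before or after that
  crossing.\<close>

lemma swap_last_braid:
  assumes [simp]: "A \<in> Obj C" "X \<in> Obj C" "P \<in> Obj C" "Z \<in> Obj C"
  shows "swap_last (A \<star> Z) X P \<cdot> rwhisker (swap_last A X Z) P \<cdot> swap_last (A \<star> X) P Z =
    rwhisker (swap_last A P Z) X \<cdot> swap_last (A \<star> P) X Z \<cdot> rwhisker (swap_last A X P) Z"
proof -
  have "rwhisker (assoc_inv A Z P \<cdot> lwhisker A (Braid C P Z)) X \<cdot> swap_last A X (P \<star> Z) =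
    (swap_last (A \<star> Z) X P \<cdot> rwhisker (swap_last A X Z) P \<cdot> swap_last (A \<star> X) P Z) \<cdot>
        assoc_inv (A \<star> X) P Z"
  proof -
    have "rwhisker (assoc_inv A Z P \<cdot> lwhisker A (Braid C P Z)) X \<cdot> swap_last A X (P \<star> Z) =
        rwhisker (assoc_inv A Z P) X \<cdot> swap_last A X (Z \<star> P) \<cdot> lwhisker (A \<star> X) (Braid C P Z)"
      by (simp add: swap_last_left)
    also have "\<dots> = swap_last (A \<star> Z) X P \<cdot> rwhisker (swap_last A X Z) P \<cdot> 
        assoc_inv (A \<star> X) Z P \<cdot> lwhisker (A \<star> X) (Braid C P Z)"
      by (simp add: reassoc[OF swap_last_tensor])
    finally show ?thesis by (simp add: swap_last_def[of "A \<star> X" P Z])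
  qed
  moreover have "rwhisker (assoc_inv A Z P \<cdot> lwhisker A (Braid C P Z)) X \<cdot> swap_last A X (P \<star> Z) =
    (rwhisker (swap_last A P Z) X \<cdot> swap_last (A \<star> P) X Z \<cdot> rwhisker (swap_last A X P) Z) \<cdot>
        assoc_inv (A \<star> X) P Z"
  proof -
    have "assoc_inv A Z P \<cdot> lwhisker A (Braid C P Z) = swap_last A P Z \<cdot> assoc_inv A P Z"
      by (simp add: swap_last_def)
    then have "rwhisker (assoc_inv A Z P \<cdot> lwhisker A (Braid C P Z)) X =
        rwhisker (swap_last A P Z) X \<cdot> rwhisker (assoc_inv A P Z) X"
      by simp
    then show ?thesis by (simp add: swap_last_tensor)
  qed
  ultimately have "(swap_last (A \<star> Z) X P \<cdot> rwhisker (swap_last A X Z) P \<cdot> swap_last (A \<star> X) P Z)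
      \<cdot> assoc_inv (A \<star> X) P Z
    = (rwhisker (swap_last A P Z) X \<cdot> swap_last (A \<star> P) X Z \<cdot> rwhisker (swap_last A X P) Z) \<cdot>
        assoc_inv (A \<star> X) P Z"
    by (simp only:)
  then show ?thesis
    by (rule cancel_iso_right[where h = "Assoc C (A \<star> X) P Z"]) simp_all
qed

end

section \<open>Partial traces\<close>

context rigid_symmetric_monoidal_category
begin

text \<open>The unit of the adjunction that makes tensoring with \<open>Z\<close> left adjoint to
  tensoring with its dual; \<open>dual_counit\<close> is the counit. \<open>dual_counit'\<close>
  corrects the order of \<open>Z\<close> and its dual by the symmetry: it closes a loop, and is the
  counit of the adjunction in the opposite direction.\<close>

definition "dual_unit Z A = assoc_inv A Z (Dual C Z) \<cdot> lwhisker A (Coev C Z) \<cdot> runit_inv A"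

definition "dual_counit Z A = RUnit C A \<cdot> lwhisker A (Ev C Z) \<cdot> Assoc C A (Dual C Z) Z"

definition "dual_counit' Z A = dual_counit Z A \<cdot> swap_last A Z (Dual C Z)"

definition "ptrace Z A B f = dual_counit' Z B \<cdot> rwhisker f (Dual C Z) \<cdot> dual_unit Z A"

lemma Dual_Obj' [simp]: "X \<in> Obj C \<Longrightarrow> Dual C X \<in> Obj C"
  by (rule Dual_Obj)

lemma Ev_type [simp]:
  assumes "X \<in> Obj C"
  shows "Ev C X \<in> Arr C" "Dom C (Ev C X) = Dual C X \<star> X" "Cod C (Ev C X) = Unit C"
    "Coev C X \<in> Arr C" "Dom C (Coev C X) = Unit C" "Cod C (Coev C X) = X \<star> Dual C X"
  using Ev_arrows[OF assms] Coev_arrows[OF assms] by simp_all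

lemma dual_type [simp]:
  assumes [simp]: "A \<in> Obj C" "Z \<in> Obj C"
  shows "dual_unit Z A \<in> Arr C" "Dom C (dual_unit Z A) = A" "Cod C (dual_unit Z A) =
      (A \<star> Z) \<star> Dual C Z"
    "dual_counit Z A \<in> Arr C" "Dom C (dual_counit Z A) = (A \<star> Dual C Z) \<star> Z"
        "Cod C (dual_counit Z A) = A"
    "dual_counit' Z A \<in> Arr C" "Dom C (dual_counit' Z A) = (A \<star> Z) \<star> Dual C Z"
        "Cod C (dual_counit' Z A) = A"
  by (simp_all add: dual_unit_def dual_counit_def dual_counit'_def)

lemma dual_counit'_eq:
  assumes [simp]: "A \<in> Obj C" "Z \<in> Obj C"
  shows "dual_counit' Z A =
    RUnit C A \<cdot> lwhisker A (Ev C Z \<cdot> Braid C Z (Dual C Z)) \<cdot> Assoc C A Z (Dual C Z)"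
  by (simp add: dual_counit'_def dual_counit_def swap_last_def)

lemma dual_unit_natural:
  assumes [simp]: "f \<in> Arr C" "Dom C f = A" "Cod C f = A'" "A \<in> Obj C" "A' \<in> Obj C" "Z \<in> Obj C"
  shows "dual_unit Z A' \<cdot> f = rwhisker (rwhisker f Z) (Dual C Z) \<cdot> dual_unit Z A"
  by (simp add: dual_unit_def runit_inv_natural reassoc[OF assoc_inv_right[symmetric]]
      reassoc[OF whisker_exchange])

lemma dual_counit_natural:
  assumes [simp]: "f \<in> Arr C" "Dom C f = A" "Cod C f = A'" "A \<in> Obj C" "A' \<in> Obj C" "Z \<in> Obj C"
  shows "dual_counit Z A' \<cdot> rwhisker (rwhisker f (Dual C Z)) Z = f \<cdot> dual_counit Z A"
  by (simp add: dual_counit_def assoc_right reassoc[OF runit_natural[symmetric]]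
      reassoc[OF whisker_exchange[symmetric]])

lemma dual_counit'_natural:
  assumes [simp]: "f \<in> Arr C" "Dom C f = A" "Cod C f = A'" "A \<in> Obj C" "A' \<in> Obj C" "Z \<in> Obj C"
  shows "dual_counit' Z A' \<cdot> rwhisker (rwhisker f Z) (Dual C Z) = f \<cdot> dual_counit' Z A"
  by (simp add: dual_counit'_def swap_last_right reassoc[OF dual_counit_natural])

text \<open>\<open>Coev\<close> starts at the unit, and the unit crosses \<open>W\<close> trivially
  by \<open>swap_last_Unit\<close>; so \<open>W\<close> can be pulled across the newly created
  pair.\<close>

lemma dual_unit_tensor:
  assumes [simp]: "A \<in> Obj C" "W \<in> Obj C" "Z \<in> Obj C"
  shows "dual_unit Z (A \<star> W) = rwhisker (swap_last A Z W) (Dual C Z) \<cdot>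
    swap_last (A \<star> Z) (Dual C Z) W \<cdot> rwhisker (dual_unit Z A) W"
proof -
  let ?I = "Unit C"
  have "RUnit C (A \<star> W) \<cdot> swap_last A ?I W \<cdot> rwhisker (runit_inv A) W = Id C (A \<star> W)"
    by (simp add: swap_last_Unit[symmetric])
  then have r: "swap_last A ?I W \<cdot> rwhisker (runit_inv A) W = runit_inv (A \<star> W)"
    by - (rule cancel_iso_left[where f = "RUnit C (A \<star> W)" and h = "runit_inv (A \<star> W)"], auto)
  show ?thesis
    by (simp add: dual_unit_def reassoc3[OF swap_last_tensor'[symmetric]]
        reassoc[OF swap_last_middle] r)
qed

lemma dual_counit'_tensor:
  assumes [simp]: "A \<in> Obj C" "W \<in> Obj C" "Z \<in> Obj C"
  shows "dual_counit' Z (A \<star> W) = rwhisker (dual_counit' Z A) W \<cdot>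
    swap_last (A \<star> Z) W (Dual C Z) \<cdot> rwhisker (swap_last A W Z) (Dual C Z)"
proof -
  let ?e = "Ev C Z \<cdot> Braid C Z (Dual C Z)"
  have eq: "swap_last (A \<star> Z) W (Dual C Z) \<cdot> rwhisker (swap_last A W Z) (Dual C Z) =
      rwhisker (assoc_inv A Z (Dual C Z)) W \<cdot> swap_last A W (Z \<star> Dual C Z) \<cdot>
          Assoc C (A \<star> W) Z (Dual C Z)"
    by (simp add: reassoc[OF swap_last_tensor])
  have "rwhisker (lwhisker A ?e) W \<cdot> swap_last A W (Z \<star> Dual C Z) =
      swap_last A W (Unit C) \<cdot> lwhisker (A \<star> W) ?e"
    using swap_last_left[of ?e "Z \<star> Dual C Z" "Unit C" A W] by simp
  note e = reassoc[OF this]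
  show ?thesis
    unfolding eq dual_counit'_eq[OF assms(1,3)] dual_counit'_eq[OF TensorObj_Obj'[OF assms(1,2)]
        assms(3)]
    using e by (simp add: swap_last_Unit[symmetric] del: lwhisker_Comp)
qed

lemma lwhisker_zigzag:
  assumes [simp]: "A \<in> Obj C" "Z \<in> Obj C"
  shows "lwhisker A (RUnit C Z) \<cdot> lwhisker A (lwhisker Z (Ev C Z)) \<cdot>
      lwhisker A (Assoc C Z (Dual C Z) Z) \<cdot>
     lwhisker A (rwhisker (Coev C Z) Z) \<cdot> lwhisker A (lunit_inv Z) = Id C (A \<star> Z)"
  using arg_cong[OF zigzag_Obj[of Z], of "lwhisker A"]
  by (simp add: lwhisker_def[symmetric] rwhisker_def[symmetric] lunit_inv_def[symmetric])

lemma dual_counit_unit: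
  assumes [simp]: "A \<in> Obj C" "Z \<in> Obj C"
  shows "dual_counit Z (A \<star> Z) \<cdot> rwhisker (dual_unit Z A) Z = Id C (A \<star> Z)"
proof -
  let ?I = "Unit C"
  have l: "Assoc C A ?I Z \<cdot> rwhisker (runit_inv A) Z = lwhisker A (lunit_inv Z)"
  proof -
    have "lwhisker A (LUnit C Z) \<cdot> Assoc C A ?I Z \<cdot> rwhisker (runit_inv A) Z = Id C (A \<star> Z)"
      by (simp add: reassoc[OF triangle'])
    then show ?thesis
      by - (rule cancel_iso_left[where f = "lwhisker A (LUnit C Z)" and h =
          "lwhisker A (lunit_inv Z)"], auto)
  qed
  have r: "RUnit C (A \<star> Z) \<cdot> assoc_inv A Z ?I = lwhisker A (RUnit C Z)"
    by (simp add: runit_tensor[symmetric])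
  show ?thesis
    by (simp add: dual_counit_def dual_unit_def reassoc[OF pentagon_middle]
        reassoc[OF assoc_middle] l
      reassoc[OF assoc_inv_left[symmetric]] reassoc[OF r] lwhisker_zigzag)
qed

text \<open>The triangle identity of the opposite adjunction. The crossings coming from
  \<open>dual_counit'\<close> and from \<open>dual_unit_tensor\<close> cancel, which leaves the
  zigzag \<open>dual_counit_unit\<close>.\<close>

lemma dual_yank:
  assumes [simp]: "A \<in> Obj C" "Z \<in> Obj C"
  shows "rwhisker (dual_counit' Z A) Z \<cdot> swap_last (A \<star> Z) Z (Dual C Z) \<cdot> dual_unit Z (A \<star> Z) =
      Id C (A \<star> Z)"
proof -
  have "rwhisker (dual_counit' Z A) Z \<cdot> swap_last (A \<star> Z) Z (Dual C Z) =
      dual_counit' Z (A \<star> Z) \<cdot> rwhisker (swap_last A Z Z) (Dual C Z)"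
    by (simp add: dual_counit'_tensor)
  from reassoc[OF this]
  have "rwhisker (dual_counit' Z A) Z \<cdot> swap_last (A \<star> Z) Z (Dual C Z) \<cdot> dual_unit Z (A \<star> Z) =
      dual_counit Z (A \<star> Z) \<cdot> swap_last (A \<star> Z) Z (Dual C Z) \<cdot>
          rwhisker (swap_last A Z Z) (Dual C Z) \<cdot> dual_unit Z (A \<star> Z)"
    by (simp add: dual_counit'_def)
  then show ?thesis by (simp add: dual_unit_tensor dual_counit_unit)
qed

lemma ptrace_type [simp]:
  assumes "f \<in> Arr C" "Dom C f = A \<star> Z" "Cod C f = B \<star> Z" "A \<in> Obj C" "B \<in> Obj C" "Z \<in> Obj C"
  shows "ptrace Z A B f \<in> Arr C" "Dom C (ptrace Z A B f) = A" "Cod C (ptrace Z A B f) = B"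
  using assms by (simp_all add: ptrace_def)

lemma ptrace_swap:
  assumes [simp]: "A \<in> Obj C" "Z \<in> Obj C"
  shows "ptrace Z (A \<star> Z) (A \<star> Z) (swap_last A Z Z) = Id C (A \<star> Z)"
  using dual_yank[of A Z] by (simp add: ptrace_def dual_counit'_tensor)

lemma ptrace_left:
  assumes [simp]: "f \<in> Arr C" "Dom C f = A \<star> Z" "Cod C f = B \<star> Z" "k \<in> Arr C" "Dom C k = B"
      "Cod C k = B'"
    "A \<in> Obj C" "B \<in> Obj C" "B' \<in> Obj C" "Z \<in> Obj C"
  shows "ptrace Z A B' (rwhisker k Z \<cdot> f) = k \<cdot> ptrace Z A B f"
  by (simp add: ptrace_def reassoc[OF dual_counit'_natural])

lemma ptrace_right:
  assumes [simp]: "f \<in> Arr C" "Dom C f = A \<star> Z" "Cod C f = B \<star> Z" "k \<in> Arr C" "Dom C k = A'"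
      "Cod C k = A"
    "A \<in> Obj C" "A' \<in> Obj C" "B \<in> Obj C" "Z \<in> Obj C"
  shows "ptrace Z A' B (f \<cdot> rwhisker k Z) = ptrace Z A B f \<cdot> k"
  by (simp add: ptrace_def dual_unit_natural)

text \<open>A composite through \<open>D \<star> Z\<close> is a partial trace in which the middle
  \<open>Z\<close> forms the loop. Read from right to left this turns composition into a trace,
  which is how cyclicity is obtained.\<close>

lemma ptrace_yank:
  assumes [simp]: "l \<in> Arr C" "Dom C l = A" "Cod C l = D \<star> Z" "k \<in> Arr C" "Dom C k = D \<star> Z"
      "Cod C k = B"
    "A \<in> Obj C" "B \<in> Obj C" "D \<in> Obj C" "Z \<in> Obj C"
  shows "ptrace Z A B (rwhisker k Z \<cdot> swap_last D Z Z \<cdot> rwhisker l Z) = k \<cdot> l"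
  using ptrace_left[of "swap_last D Z Z \<cdot> rwhisker l Z" A Z "D \<star> Z" k B]
    ptrace_right[of "swap_last D Z Z" "D \<star> Z" Z "D \<star> Z" l A]
  by (simp add: ptrace_swap)

text \<open>\<open>X\<close> never meets the loop: its crossings with \<open>Z\<close> are absorbed
  by pulling \<open>X\<close> across the creation and the closing of the loop.\<close>

lemma ptrace_whisker:
  assumes [simp]: "g \<in> Arr C" "Dom C g = A \<star> Z" "Cod C g = B \<star> Z"
    "A \<in> Obj C" "B \<in> Obj C" "X \<in> Obj C" "Z \<in> Obj C"
  shows "ptrace Z (A \<star> X) (B \<star> X) (swap_last B Z X \<cdot> rwhisker g X \<cdot> swap_last A X Z) =
    rwhisker (ptrace Z A B g) X"
  by (simp add: ptrace_def dual_unit_tensor dual_counit'_tensor reassoc[OF swap_last_right])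

lemma dual_counit'_exchange:
  assumes [simp]: "B \<in> Obj C" "W \<in> Obj C" "Z \<in> Obj C"
  shows "dual_counit' Z B \<cdot> rwhisker (dual_counit' W (B \<star> Z)) (Dual C Z) =
    dual_counit' W B \<cdot> rwhisker (dual_counit' Z (B \<star> W)) (Dual C W) \<cdot>
    swap_last ((B \<star> W) \<star> Z) (Dual C W) (Dual C Z) \<cdot>
    rwhisker (rwhisker (swap_last B Z W) (Dual C W)) (Dual C Z)"
proof -
  have "dual_counit' Z B \<cdot> rwhisker (dual_counit' W (B \<star> Z)) (Dual C Z) =
    dual_counit' W B \<cdot> dual_counit' Z ((B \<star> W) \<star> Dual C W) \<cdot>
    rwhisker (swap_last (B \<star> W) Z (Dual C W)) (Dual C Z) \<cdot>
    rwhisker (rwhisker (swap_last B Z W) (Dual C W)) (Dual C Z)"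
    by (simp add: dual_counit'_tensor[of B Z W] reassoc[OF dual_counit'_natural])
  then show ?thesis by (simp add: dual_counit'_tensor[of "B \<star> W" "Dual C W" Z])
qed

lemma dual_unit_exchange:
  assumes [simp]: "A \<in> Obj C" "W \<in> Obj C" "Z \<in> Obj C"
  shows "rwhisker (dual_unit W (A \<star> Z)) (Dual C Z) \<cdot> dual_unit Z A =
    rwhisker (rwhisker (swap_last A W Z) (Dual C W)) (Dual C Z) \<cdot>
    swap_last ((A \<star> W) \<star> Z) (Dual C Z) (Dual C W) \<cdot>
    rwhisker (dual_unit Z (A \<star> W)) (Dual C W) \<cdot> dual_unit W A"
proof -
  have "rwhisker (dual_unit W (A \<star> Z)) (Dual C Z) \<cdot> dual_unit Z A =
    rwhisker (rwhisker (swap_last A W Z) (Dual C W)) (Dual C Z) \<cdot>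
    rwhisker (swap_last (A \<star> W) (Dual C W) Z) (Dual C Z) \<cdot>
    dual_unit Z ((A \<star> W) \<star> Dual C W) \<cdot> dual_unit W A"
    by (simp add: dual_unit_tensor[of A Z W] dual_unit_natural[symmetric])
  then show ?thesis by (simp add: dual_unit_tensor[of "A \<star> W" "Dual C W" Z])
qed

text \<open>
  The two loops are disentangled by moving \<open>Z\<close> and its dual past \<open>W\<close> and its dual
  (\<open>dual_unit_tensor\<close>, \<open>dual_counit'_tensor\<close>).
\<close>

lemma ptrace_exchange:
  assumes [simp]: "h \<in> Arr C" "Dom C h = (A \<star> Z) \<star> W" "Cod C h = (B \<star> Z) \<star> W"
    "A \<in> Obj C" "B \<in> Obj C" "W \<in> Obj C" "Z \<in> Obj C"
  shows "ptrace Z A B (ptrace W (A \<star> Z) (B \<star> Z) h) =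
    ptrace W A B (ptrace Z (A \<star> W) (B \<star> W) (swap_last B Z W \<cdot> h \<cdot> swap_last A W Z))"
proof -
  let ?k = "swap_last B Z W \<cdot> h \<cdot> swap_last A W Z"
  have "ptrace Z A B (ptrace W (A \<star> Z) (B \<star> Z) h) =
    (dual_counit' Z B \<cdot> rwhisker (dual_counit' W (B \<star> Z)) (Dual C Z)) \<cdot>
    rwhisker (rwhisker h (Dual C W)) (Dual C Z) \<cdot>
    (rwhisker (dual_unit W (A \<star> Z)) (Dual C Z) \<cdot> dual_unit Z A)"
    by (simp add: ptrace_def)
  also have "\<dots> = dual_counit' W B \<cdot> rwhisker (dual_counit' Z (B \<star> W)) (Dual C W) \<cdot>
    (swap_last ((B \<star> W) \<star> Z) (Dual C W) (Dual C Z) \<cdot>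
    rwhisker (rwhisker ?k (Dual C W)) (Dual C Z)) \<cdot>
    swap_last ((A \<star> W) \<star> Z) (Dual C Z) (Dual C W) \<cdot>
    rwhisker (dual_unit Z (A \<star> W)) (Dual C W) \<cdot> dual_unit W A"
    unfolding dual_counit'_exchange[OF assms(5-7)] dual_unit_exchange[OF assms(4,6,7)] by simp
  also have "swap_last ((B \<star> W) \<star> Z) (Dual C W) (Dual C Z) \<cdot>
    rwhisker (rwhisker ?k (Dual C W)) (Dual C Z) =
    rwhisker (rwhisker ?k (Dual C Z)) (Dual C W) \<cdot> swap_last ((A \<star> W) \<star> Z) (Dual C W) (Dual C Z)"
    by (rule swap_last_right) simp_all
  finally show ?thesis by (simp add: ptrace_def)
qed

text \<open>
  Both sides are a double partial trace of the same morphism: yanking a swap out of one loop gives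
  the left-hand side, yanking it out of the other one gives the right-hand side.
\<close>

lemma ptrace_cyclic:
  assumes [simp]: "f \<in> Arr C" "Dom C f = A \<star> Z" "Cod C f = B \<star> W" "g \<in> Arr C" "Dom C g = W"
      "Cod C g = Z"
    "A \<in> Obj C" "B \<in> Obj C" "W \<in> Obj C" "Z \<in> Obj C"
  shows "ptrace Z A B (lwhisker B g \<cdot> f) = ptrace W A B (f \<cdot> lwhisker A g)"
proof -
  let ?h = "rwhisker (lwhisker B g) W \<cdot> swap_last B W W \<cdot> rwhisker f W"
  have "ptrace W (A \<star> Z) (B \<star> Z) ?h = lwhisker B g \<cdot> f"
    using ptrace_yank[of f "A \<star> Z" B W "lwhisker B g" "B \<star> Z"] by simp
  then have "ptrace Z A B (lwhisker B g \<cdot> f) =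
      ptrace W A B (ptrace Z (A \<star> W) (B \<star> W) (swap_last B Z W \<cdot> ?h \<cdot> swap_last A W Z))"
    using ptrace_exchange[of ?h A Z W B] by simp
  also have "swap_last B Z W \<cdot> ?h \<cdot> swap_last A W Z = rwhisker f Z \<cdot> swap_last A Z Z \<cdot>
      rwhisker (lwhisker A g) Z"
    by (simp add: reassoc[OF swap_last_middle] swap_last_middle
        reassoc[OF whisker_exchange[of f g, symmetric]])
  also have "ptrace Z (A \<star> W) (B \<star> W) \<dots> = f \<cdot> lwhisker A g"
    using ptrace_yank[of "lwhisker A g" "A \<star> W" A Z f "B \<star> W"] by simp
  finally show ?thesis .
qed

end

context small_category
begin

lemma mono_cancel:
  "mono_arrow C k \<Longrightarrow> k \<cdot> f = k \<cdot> g \<Longrightarrow> f \<in> Arr C \<Longrightarrow> g \<in> Arr C \<Longrightarrow> Dom C f = Dom C g \<Longrightarrow>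
    Cod C f = Dom C k \<Longrightarrow> Cod C g = Dom C k \<Longrightarrow> f = g"
  unfolding mono_arrow_def by auto

end

section \<open>Splitting off a tensor factor and sliding the splitting round a loop\<close>

context symmetric_monoidal_category
begin

definition "split_last Y P X d = assoc_inv Y P X \<cdot> lwhisker Y d"

lemma split_last_type [simp]:
  assumes "d \<in> Arr C" "Cod C d = P \<star> X" "Y \<in> Obj C" "P \<in> Obj C" "X \<in> Obj C"
  shows "split_last Y P X d \<in> Arr C" "Dom C (split_last Y P X d) = Y \<star> Dom C d"
    "Cod C (split_last Y P X d) = (Y \<star> P) \<star> X"
  using assms by (simp_all add: split_last_def)

lemma split_last_natural:
  assumes [simp]: "f \<in> Arr C" "Dom C f = A" "Cod C f = B" "d \<in> Arr C" "Dom C d = Q" "Cod C d =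
      P \<star> X"
    "A \<in> Obj C" "B \<in> Obj C" "P \<in> Obj C" "X \<in> Obj C" "Q \<in> Obj C"
  shows "split_last B P X d \<cdot> rwhisker f Q = rwhisker (rwhisker f P) X \<cdot> split_last A P X d"
  by (simp add: split_last_def reassoc[OF assoc_inv_right[symmetric]]
      whisker_exchange[of f d, symmetric])

lemma swap_last_split_last:
  assumes [simp]: "d \<in> Arr C" "Dom C d = Q" "Cod C d = P \<star> X"
    "B \<in> Obj C" "P \<in> Obj C" "X \<in> Obj C" "Q \<in> Obj C" "Z \<in> Obj C"
  shows "split_last (B \<star> Z) P X d \<cdot> swap_last B Q Z =
    rwhisker (swap_last B P Z) X \<cdot> swap_last (B \<star> P) X Z \<cdot> rwhisker (split_last B P X d) Z"
  by (simp add: split_last_def swap_last_middle[symmetric] reassoc[OF swap_last_tensor'])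

lemma split_last_swap_last:
  assumes [simp]: "d \<in> Arr C" "Dom C d = Q" "Cod C d = P \<star> X"
    "B \<in> Obj C" "P \<in> Obj C" "X \<in> Obj C" "Q \<in> Obj C" "Z \<in> Obj C"
  shows "rwhisker (split_last B P X d) Z \<cdot> swap_last B Z Q =
    swap_last (B \<star> P) Z X \<cdot> rwhisker (swap_last B Z P) X \<cdot> split_last (B \<star> Z) P X d"
  by (simp add: split_last_def swap_last_left[symmetric] reassoc[OF swap_last_tensor])

end

context rigid_symmetric_monoidal_category
begin

text \<open>The strand \<open>Q\<close> is split by \<open>d\<close> into \<open>P\<close> and
  \<open>X\<close>, and both are closed up. This is yanking done twice, for \<open>X\<close> and
  then for \<open>P\<close>.\<close>

lemma ptrace_block_swap:
  assumes [simp]: "d \<in> Arr C" "Dom C d = Q" "Cod C d = P \<star> X"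
    "A \<in> Obj C" "P \<in> Obj C" "X \<in> Obj C" "Q \<in> Obj C"
  shows "ptrace P (A \<star> Q) ((A \<star> P) \<star> X) (ptrace X ((A \<star> Q) \<star> P) (((A \<star> P) \<star> X) \<star> P)
    (split_last ((A \<star> P) \<star> X) P X d \<cdot> swap_last (A \<star> P) Q X \<cdot> rwhisker (swap_last A Q P) X)) =
    split_last A P X d"
proof -
  have e1: "split_last ((A \<star> P) \<star> X) P X d \<cdot> swap_last (A \<star> P) Q X \<cdot> rwhisker (swap_last A Q P) X =
      rwhisker (swap_last (A \<star> P) P X) X \<cdot> swap_last ((A \<star> P) \<star> P) X X \<cdot>
      rwhisker (split_last (A \<star> P) P X d \<cdot> swap_last A Q P) X"
    by (simp add: reassoc[OF swap_last_split_last])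
  have e2: "ptrace X ((A \<star> Q) \<star> P) (((A \<star> P) \<star> X) \<star> P) (rwhisker (swap_last (A \<star> P) P X) X \<cdot>
      swap_last ((A \<star> P) \<star> P) X X \<cdot> rwhisker (split_last (A \<star> P) P X d \<cdot> swap_last A Q P) X) =
      swap_last (A \<star> P) P X \<cdot> split_last (A \<star> P) P X d \<cdot> swap_last A Q P"
    by (rule ptrace_yank) simp_all
  \<comment> \<open>With the loop \<open>X\<close> pulled straight, naturality of the splitting and
    the braid relation expose a crossing of \<open>P\<close> with itself, which is the form that
    \<open>ptrace_yank\<close> needs for the second loop.\<close>
  have e3: "swap_last (A \<star> P) P X \<cdot> split_last (A \<star> P) P X d \<cdot> swap_last A Q P =
      rwhisker (swap_last A X P) P \<cdot> swap_last (A \<star> X) P P \<cdot>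
      rwhisker (swap_last A P X \<cdot> split_last A P X d) P"
    by (simp add: swap_last_split_last reassoc3[OF swap_last_braid])
  have e4: "ptrace P (A \<star> Q) ((A \<star> P) \<star> X) (rwhisker (swap_last A X P) P \<cdot> swap_last (A \<star> X) P P \<cdot>
      rwhisker (swap_last A P X \<cdot> split_last A P X d) P) = swap_last A X P \<cdot> swap_last A P X \<cdot>
          split_last A P X d"
    by (rule ptrace_yank) simp_all
  show ?thesis unfolding e1 e2 e3 e4 by simp
qed

text \<open>
  Cyclicity for \<open>d : Q \<rightarrow> P \<star> X\<close>, where the loop \<open>Q\<close> turns into two loops \<open>P\<close> and \<open>X\<close>; this
  avoids comparing the dual of \<open>P \<star> X\<close> with the duals of its factors.
\<close>

lemma ptrace_split:
  assumes [simp]: "d \<in> Arr C" "Dom C d = Q" "Cod C d = P \<star> X"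
    "f \<in> Arr C" "Dom C f = (A \<star> P) \<star> X" "Cod C f = B \<star> Q"
    "A \<in> Obj C" "B \<in> Obj C" "P \<in> Obj C" "X \<in> Obj C" "Q \<in> Obj C"
  shows "ptrace Q A B (f \<cdot> split_last A P X d) =
    ptrace P A B (ptrace X (A \<star> P) (B \<star> P) (split_last B P X d \<cdot> f))"
proof -
  let ?h = "rwhisker (split_last B P X d) Q \<cdot> swap_last B Q Q \<cdot> rwhisker f Q"
  let ?h' = "swap_last (B \<star> P) X Q \<cdot> ?h \<cdot> swap_last (A \<star> P) Q X"
  let ?M = "swap_last (A \<star> P) Q X \<cdot> rwhisker (swap_last A Q P) X"
  let ?t = "split_last ((A \<star> P) \<star> X) P X d \<cdot> ?M"
  have e1: "ptrace Q ((A \<star> P) \<star> X) ((B \<star> P) \<star> X) ?h = split_last B P X d \<cdot> f"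
    by (rule ptrace_yank) simp_all
  have e2: "ptrace X (A \<star> P) (B \<star> P) (ptrace Q ((A \<star> P) \<star> X) ((B \<star> P) \<star> X) ?h) =
      ptrace Q (A \<star> P) (B \<star> P) (ptrace X ((A \<star> P) \<star> Q) ((B \<star> P) \<star> Q) ?h')"
    by (rule ptrace_exchange) simp_all
  have e3: "ptrace P A B (ptrace Q (A \<star> P) (B \<star> P) (ptrace X ((A \<star> P) \<star> Q) ((B \<star> P) \<star> Q) ?h')) =
      ptrace Q A B (ptrace P (A \<star> Q) (B \<star> Q)
      (swap_last B P Q \<cdot> ptrace X ((A \<star> P) \<star> Q) ((B \<star> P) \<star> Q) ?h' \<cdot> swap_last A Q P))"
    by (rule ptrace_exchange) simp_all
  have e4: "swap_last B P Q \<cdot> ptrace X ((A \<star> P) \<star> Q) ((B \<star> P) \<star> Q) ?h' \<cdot> swap_last A Q P =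
      ptrace X ((A \<star> Q) \<star> P) ((B \<star> Q) \<star> P)
        (rwhisker (swap_last B P Q) X \<cdot> ?h' \<cdot> rwhisker (swap_last A Q P) X)"
    using ptrace_left[of "?h' \<cdot> rwhisker (swap_last A Q P) X" "(A \<star> Q) \<star> P" X "(B \<star> P) \<star> Q"
        "swap_last B P Q" "(B \<star> Q) \<star> P"]
      ptrace_right[of ?h' "(A \<star> P) \<star> Q" X "(B \<star> P) \<star> Q" "swap_last A Q P" "(A \<star> Q) \<star> P"] by simp
  have e5: "rwhisker (swap_last B P Q) X \<cdot> ?h' \<cdot> rwhisker (swap_last A Q P) X =
      rwhisker (rwhisker f P) X \<cdot> ?t"
    by (simp add: reassoc3[OF swap_last_split_last[symmetric]] reassoc[OF split_last_natural])
  have e6: "ptrace X ((A \<star> Q) \<star> P) ((B \<star> Q) \<star> P) (rwhisker (rwhisker f P) X \<cdot> ?t) =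
      rwhisker f P \<cdot> ptrace X ((A \<star> Q) \<star> P) (((A \<star> P) \<star> X) \<star> P) ?t"
    by (rule ptrace_left) simp_all
  have e7: "ptrace P (A \<star> Q) (B \<star> Q) (rwhisker f P \<cdot>
      ptrace X ((A \<star> Q) \<star> P) (((A \<star> P) \<star> X) \<star> P) ?t) =
      f \<cdot> ptrace P (A \<star> Q) ((A \<star> P) \<star> X) (ptrace X ((A \<star> Q) \<star> P) (((A \<star> P) \<star> X) \<star> P) ?t)"
    by (rule ptrace_left) simp_all
  have e8: "ptrace P (A \<star> Q) ((A \<star> P) \<star> X) (ptrace X ((A \<star> Q) \<star> P) (((A \<star> P) \<star> X) \<star> P) ?t) =
      split_last A P X d"
    by (rule ptrace_block_swap) simp_all
  show ?thesis using e2 e3 unfolding e1 e4 e5 e6 e7 e8 by (simp only:)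
qed

text \<open>\<open>d\<close> is pushed round the loop: on the left it acts before \<open>g\<close>,
  on the right after it. The loop shrinks from \<open>Q\<close> to \<open>P\<close> and
  \<open>X\<close> leaves it on the way, which is the degree-lowering step of the trace recursion.
  \<open>ptrace_split\<close> opens two loops, and the one for \<open>X\<close> is yanked.\<close>

lemma ptrace_slide:
  assumes [simp]: "d \<in> Arr C" "Dom C d = Q" "Cod C d = P \<star> X"
    "g \<in> Arr C" "Dom C g = A \<star> P" "Cod C g = B \<star> Q"
    "A \<in> Obj C" "B \<in> Obj C" "P \<in> Obj C" "X \<in> Obj C" "Q \<in> Obj C"
  shows "ptrace Q A (B \<star> X) (swap_last B Q X \<cdot> rwhisker g X \<cdot> split_last A P X d) =
    ptrace P A (B \<star> X) (swap_last B P X \<cdot> split_last B P X d \<cdot> g)"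
proof -
  have e1: "ptrace Q A (B \<star> X) ((swap_last B Q X \<cdot> rwhisker g X) \<cdot> split_last A P X d) =
    ptrace P A (B \<star> X) (ptrace X (A \<star> P) ((B \<star> X) \<star> P)
      (split_last (B \<star> X) P X d \<cdot> swap_last B Q X \<cdot> rwhisker g X))"
    by (rule ptrace_split) simp_all
  have e2: "split_last (B \<star> X) P X d \<cdot> swap_last B Q X \<cdot> rwhisker g X =
      rwhisker (swap_last B P X) X \<cdot> swap_last (B \<star> P) X X \<cdot> rwhisker (split_last B P X d \<cdot> g) X"
    by (simp add: reassoc[OF swap_last_split_last])
  have e3: "ptrace X (A \<star> P) ((B \<star> X) \<star> P) (rwhisker (swap_last B P X) X \<cdot> swap_last (B \<star> P) X X \<cdot>
      rwhisker (split_last B P X d \<cdot> g) X) = swap_last B P X \<cdot> split_last B P X d \<cdot> g"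
    by (rule ptrace_yank) simp_all
  show ?thesis using e1 unfolding e2 e3 by simp
qed

section \<open>Transposition along the dual of an object\<close>

definition "transpose_left Z A h = dual_counit' Z A \<cdot> rwhisker h (Dual C Z)"

definition "transpose_right Z A h = rwhisker h (Dual C Z) \<cdot> dual_unit Z A"

lemma transpose_left_type [simp]:
  assumes "h \<in> Arr C" "Cod C h = A \<star> Z" "A \<in> Obj C" "Z \<in> Obj C"
  shows "transpose_left Z A h \<in> Arr C" "Dom C (transpose_left Z A h) = Dom C h \<star> Dual C Z"
    "Cod C (transpose_left Z A h) = A"
  using assms by (simp_all add: transpose_left_def)

lemma transpose_right_type [simp]:
  assumes "h \<in> Arr C" "Dom C h = A \<star> Z" "A \<in> Obj C" "Z \<in> Obj C"
  shows "transpose_right Z A h \<in> Arr C" "Dom C (transpose_right Z A h) = A"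
    "Cod C (transpose_right Z A h) = Cod C h \<star> Dual C Z"
  using assms by (simp_all add: transpose_right_def)

lemma transpose_left_Comp:
  assumes [simp]: "h \<in> Arr C" "Cod C h = A \<star> Z" "f \<in> Arr C" "Dom C f = A" "Cod C f = B"
      "A \<in> Obj C" "B \<in> Obj C" "Z \<in> Obj C"
  shows "transpose_left Z B (rwhisker f Z \<cdot> h) = f \<cdot> transpose_left Z A h"
  by (simp add: transpose_left_def reassoc[OF dual_counit'_natural])

lemma transpose_right_Comp:
  assumes [simp]: "h \<in> Arr C" "Dom C h = A \<star> Z" "f \<in> Arr C" "Dom C f = B" "Cod C f = A"
      "A \<in> Obj C" "B \<in> Obj C" "Z \<in> Obj C"
  shows "transpose_right Z B (h \<cdot> rwhisker f Z) = transpose_right Z A h \<cdot> f"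
  by (simp add: transpose_right_def dual_unit_natural)

definition "untranspose_left Z W h = rwhisker h Z \<cdot> swap_last W Z (Dual C Z) \<cdot> dual_unit Z W"

lemma untranspose_left_type [simp]:
  assumes "h \<in> Arr C" "Dom C h = W \<star> Dual C Z" "W \<in> Obj C" "Z \<in> Obj C"
  shows "untranspose_left Z W h \<in> Arr C" "Dom C (untranspose_left Z W h) = W"
    "Cod C (untranspose_left Z W h) = Cod C h \<star> Z"
  using assms by (simp_all add: untranspose_left_def)

text \<open>Naturality moves \<open>h\<close> through the unit, and \<open>dual_yank\<close>
  remains. This half of the adjunction serves for monomorphisms and kernels,
  \<open>untranspose_transpose_right\<close> for cokernels: a factorization is found on the
  transposed side and carried back.\<close>

lemma untranspose_transpose_left:
  assumes [simp]: "h \<in> Arr C" "Dom C h = W" "Cod C h = A \<star> Z" "A \<in> Obj C" "W \<in> Obj C" "Z \<in> Obj C"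
  shows "untranspose_left Z W (transpose_left Z A h) = h"
proof -
  have "swap_last (A \<star> Z) Z (Dual C Z) \<cdot> dual_unit Z (A \<star> Z) \<cdot> h =
      rwhisker (rwhisker h (Dual C Z)) Z \<cdot> swap_last W Z (Dual C Z) \<cdot> dual_unit Z W"
    by (simp add: dual_unit_natural reassoc[OF swap_last_right])
  then have "untranspose_left Z W (transpose_left Z A h) =
      (rwhisker (dual_counit' Z A) Z \<cdot> swap_last (A \<star> Z) Z (Dual C Z) \<cdot> dual_unit Z (A \<star> Z)) \<cdot> h"
    by (simp add: untranspose_left_def transpose_left_def)
  also have "\<dots> = h" unfolding dual_yank[OF assms(4,6)] by simp
  finally show ?thesis .
qed

lemma untranspose_left_Comp:
  assumes [simp]: "h \<in> Arr C" "Dom C h = W \<star> Dual C Z" "f \<in> Arr C" "Dom C f = Cod C h" "W \<in> Obj C"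
      "Z \<in> Obj C"
  shows "untranspose_left Z W (f \<cdot> h) = rwhisker f Z \<cdot> untranspose_left Z W h"
  by (simp add: untranspose_left_def)

definition "untranspose_right Z W h = dual_counit Z W \<cdot> rwhisker h Z"

lemma untranspose_right_type [simp]:
  assumes "h \<in> Arr C" "Cod C h = W \<star> Dual C Z" "W \<in> Obj C" "Z \<in> Obj C"
  shows "untranspose_right Z W h \<in> Arr C" "Dom C (untranspose_right Z W h) = Dom C h \<star> Z"
    "Cod C (untranspose_right Z W h) = W"
  using assms by (simp_all add: untranspose_right_def)

lemma untranspose_transpose_right:
  assumes [simp]: "h \<in> Arr C" "Dom C h = A \<star> Z" "Cod C h = W" "A \<in> Obj C" "W \<in> Obj C" "Z \<in> Obj C"
  shows "untranspose_right Z W (transpose_right Z A h) = h"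
  by (simp add: untranspose_right_def transpose_right_def reassoc[OF dual_counit_natural]
      dual_counit_unit)

lemma untranspose_right_Comp:
  assumes [simp]: "h \<in> Arr C" "Cod C h = W \<star> Dual C Z" "f \<in> Arr C" "Dom C h = Cod C f" "W \<in> Obj C"
      "Z \<in> Obj C"
  shows "untranspose_right Z W (h \<cdot> f) = untranspose_right Z W h \<cdot> rwhisker f Z"
  by (simp add: untranspose_right_def)

text \<open>Right adjoints preserve monomorphisms: transposing moves \<open>Z\<close> into the
  domain, where \<open>k\<close> can be cancelled.\<close>

lemma mono_rwhisker:
  assumes m: "mono_arrow C k" and [simp]: "Z \<in> Obj C"
  shows "mono_arrow C (rwhisker k Z)"
  unfolding mono_arrow_def
proof (intro conjI allI ballI impI)
  have [simp]: "k \<in> Arr C" using m by (simp add: mono_arrow_def)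
  then show "rwhisker k Z \<in> Arr C" by simp
  fix W x y assume "x \<in> arrows C W (Dom C (rwhisker k Z))" "y \<in> arrows C W (Dom C (rwhisker k Z))"
    and eq: "rwhisker k Z \<cdot> x = rwhisker k Z \<cdot> y"
  then have [simp]: "x \<in> Arr C" "y \<in> Arr C" "Dom C x = W" "Cod C x = Dom C k \<star> Z" "Dom C y = W"
      "Cod C y = Dom C k \<star> Z"
    by auto
  have [simp]: "W \<in> Obj C" using Dom_Obj[of x] by simp
  have "k \<cdot> transpose_left Z (Dom C k) x = k \<cdot> transpose_left Z (Dom C k) y"
    using arg_cong[OF eq, of "transpose_left Z (Cod C k)"] by (simp add: transpose_left_Comp)
  then have eq': "transpose_left Z (Dom C k) x = transpose_left Z (Dom C k) y"
    by (rule mono_cancel[OF m]) simp_all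
  have "x = untranspose_left Z W (transpose_left Z (Dom C k) x)"
    by (simp add: untranspose_transpose_left)
  also have "\<dots> = y" unfolding eq' by (simp add: untranspose_transpose_left)
  finally show "x = y" .
qed

end

section \<open>Linear structure, kernels and cokernels\<close>

context linear_category
begin

lemma hom_space_simps [simp]:
  "carrier (hom_space C X Y) = arrows C X Y" "add (hom_space C X Y) = Add C"
  "zero (hom_space C X Y) = Zero C X Y" "module.smult (hom_space C X Y) = Scale C"
  by (simp_all add: hom_space_def)

lemma scalar_ring_simps [simp]:
  "carrier scalar_ring = UNIV" "add scalar_ring = (+)" "zero scalar_ring = 0"
  "monoid.mult scalar_ring = (*)" "one scalar_ring = 1"
  by (simp_all add: scalar_ring_def)

lemma Zero_type [simp]:
  assumes "X \<in> Obj C" "Y \<in> Obj C"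
  shows "Zero C X Y \<in> Arr C" "Dom C (Zero C X Y) = X" "Cod C (Zero C X Y) = Y"
proof -
  interpret Module.module scalar_ring "hom_space C X Y"
    using hom_vector_space[OF assms] .
  show "Zero C X Y \<in> Arr C" "Dom C (Zero C X Y) = X" "Cod C (Zero C X Y) = Y"
    using M.zero_closed by simp_all
qed

lemma Add_type [simp]:
  assumes "f \<in> Arr C" "g \<in> Arr C" "Dom C g = Dom C f" "Cod C g = Cod C f"
  shows "Add C f g \<in> Arr C" "Dom C (Add C f g) = Dom C f" "Cod C (Add C f g) = Cod C f"
proof -
  interpret Module.module scalar_ring "hom_space C (Dom C f) (Cod C f)"
    using hom_vector_space assms by simp
  show "Add C f g \<in> Arr C" "Dom C (Add C f g) = Dom C f" "Cod C (Add C f g) = Cod C f"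
    using M.add.m_closed[of f g] assms by simp_all
qed

lemma Scale_type [simp]:
  assumes "f \<in> Arr C"
  shows "Scale C a f \<in> Arr C" "Dom C (Scale C a f) = Dom C f" "Cod C (Scale C a f) = Cod C f"
proof -
  interpret Module.module scalar_ring "hom_space C (Dom C f) (Cod C f)"
    using hom_vector_space assms by simp
  show "Scale C a f \<in> Arr C" "Dom C (Scale C a f) = Dom C f" "Cod C (Scale C a f) = Cod C f"
    using smult_closed[of a f] assms by simp_all
qed

lemma Scale_simps [simp]:
  assumes "f \<in> Arr C"
  shows "Scale C 1 f = f" "Scale C a (Scale C b f) = Scale C (a * b) f"
    "Scale C 0 f = Zero C (Dom C f) (Cod C f)"
proof -
  interpret Module.module scalar_ring "hom_space C (Dom C f) (Cod C f)"
    using hom_vector_space assms by simp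
  show "Scale C 1 f = f" using smult_one[of f] assms by simp
  show "Scale C a (Scale C b f) = Scale C (a * b) f" using smult_assoc1[of a b f] assms by simp
  show "Scale C 0 f = Zero C (Dom C f) (Cod C f)" using smult_l_null[of f] assms by simp
qed

lemma Add_Scale:
  assumes "f \<in> Arr C"
  shows "Add C (Scale C a f) (Scale C b f) = Scale C (a + b) f"
proof -
  interpret Module.module scalar_ring "hom_space C (Dom C f) (Cod C f)"
    using hom_vector_space assms by simp
  show ?thesis using smult_l_distr[of a b f] assms by simp
qed

lemma Scale_Add [simp]:
  assumes "f \<in> Arr C" "g \<in> Arr C" "Dom C g = Dom C f" "Cod C g = Cod C f"
  shows "Scale C a (Add C f g) = Add C (Scale C a f) (Scale C a g)"
proof -
  interpret Module.module scalar_ring "hom_space C (Dom C f) (Cod C f)"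
    using hom_vector_space assms by simp
  show ?thesis using smult_r_distr[of a f g] assms by simp
qed

lemma Add_Zero [simp]:
  assumes "f \<in> Arr C" "Dom C f = X" "Cod C f = Y"
  shows "Add C f (Zero C X Y) = f" "Add C (Zero C X Y) f = f"
proof -
  interpret Module.module scalar_ring "hom_space C X Y"
    using hom_vector_space assms by auto
  show "Add C f (Zero C X Y) = f" "Add C (Zero C X Y) f = f"
    using M.r_zero[of f] M.l_zero[of f] assms by simp_all
qed

lemma Add_assoc:
  assumes "f \<in> Arr C" "g \<in> Arr C" "h \<in> Arr C" "Dom C g = Dom C f" "Cod C g = Cod C f" "Dom C h =
      Dom C f" "Cod C h = Cod C f"
  shows "Add C (Add C f g) h = Add C f (Add C g h)"
proof -
  interpret Module.module scalar_ring "hom_space C (Dom C f) (Cod C f)"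
    using hom_vector_space assms by simp
  show ?thesis using M.a_assoc[of f g h] assms by simp
qed

lemma Add_commute:
  assumes "f \<in> Arr C" "g \<in> Arr C" "Dom C g = Dom C f" "Cod C g = Cod C f"
  shows "Add C f g = Add C g f"
proof -
  interpret Module.module scalar_ring "hom_space C (Dom C f) (Cod C f)"
    using hom_vector_space assms by simp
  show ?thesis using M.a_comm[of f g] assms by simp
qed

lemma Add_minus:
  assumes "f \<in> Arr C"
  shows "Add C f (Scale C (- 1) f) = Zero C (Dom C f) (Cod C f)"
  using Add_Scale[of f 1 "- 1"] assms by simp

lemma eq_if_diff_Zero:
  assumes "Add C f (Scale C (- 1) g) = Zero C (Dom C f) (Cod C f)"
    "f \<in> Arr C" "g \<in> Arr C" "Dom C g = Dom C f" "Cod C g = Cod C f"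
  shows "f = g"
proof -
  have "f = Add C f (Add C g (Scale C (- 1) g))" using assms by (simp add: Add_minus)
  also have "\<dots> = Add C g (Add C f (Scale C (- 1) g))"
    using assms(2-) Add_commute[of f g] Add_assoc[of f g "Scale C (- 1) g"]
        Add_assoc[of g f "Scale C (- 1) g"] by simp
  also have "\<dots> = g" unfolding assms(1) using assms(2-) by simp
  finally show ?thesis .
qed

lemma Add_Comp [simp]:
  "f \<in> Arr C \<Longrightarrow> g \<in> Arr C \<Longrightarrow> h \<in> Arr C \<Longrightarrow> Dom C g = Cod C f \<Longrightarrow> Dom C h = Dom C g \<Longrightarrow> Cod C h = Cod C g \<Longrightarrow>
    Add C g h \<cdot> f = Add C (g \<cdot> f) (h \<cdot> f)"
  using Comp_Add_left[of f "Dom C f" "Cod C f" g "Cod C g" h] by simp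

lemma Comp_Add [simp]:
  "f \<in> Arr C \<Longrightarrow> g \<in> Arr C \<Longrightarrow> h \<in> Arr C \<Longrightarrow> Dom C h = Cod C f \<Longrightarrow> Dom C g = Dom C f \<Longrightarrow> Cod C g = Cod C f \<Longrightarrow>
    h \<cdot> Add C f g = Add C (h \<cdot> f) (h \<cdot> g)"
  using Comp_Add_right[of f "Dom C f" "Cod C f" g h "Cod C h"] by simp

lemma Scale_Comp [simp]:
  "f \<in> Arr C \<Longrightarrow> g \<in> Arr C \<Longrightarrow> Dom C g = Cod C f \<Longrightarrow> Scale C a g \<cdot> f = Scale C a (g \<cdot> f)"
  using Comp_Scale_left[of f "Dom C f" "Cod C f" g "Cod C g" a] by simp

lemma Comp_Scale [simp]:
  "f \<in> Arr C \<Longrightarrow> g \<in> Arr C \<Longrightarrow> Dom C g = Cod C f \<Longrightarrow> g \<cdot> Scale C a f = Scale C a (g \<cdot> f)"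
  using Comp_Scale_right[of f "Dom C f" "Cod C f" g "Cod C g" a] by simp

lemma Zero_Comp [simp]:
  assumes "f \<in> Arr C" "Cod C f = X" "Y \<in> Obj C"
  shows "Zero C X Y \<cdot> f = Zero C (Dom C f) Y"
proof -
  have X: "X \<in> Obj C" using assms by auto
  have "Zero C X Y \<cdot> f = Scale C 0 (Zero C X Y) \<cdot> f" using assms X by simp
  also have "\<dots> = Zero C (Dom C f) Y" using assms X by (simp del: Scale_simps) (simp add: assms X)
  finally show ?thesis .
qed

lemma Comp_Zero [simp]:
  assumes "f \<in> Arr C" "Dom C f = Y" "X \<in> Obj C"
  shows "f \<cdot> Zero C X Y = Zero C X (Cod C f)"
proof -
  have Y: "Y \<in> Obj C" using assms by auto
  have "f \<cdot> Zero C X Y = f \<cdot> Scale C 0 (Zero C X Y)" using assms Y by simp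
  also have "\<dots> = Zero C X (Cod C f)" using assms Y by (simp del: Scale_simps) (simp add: assms Y)
  finally show ?thesis .
qed

lemma Scale_Zero [simp]:
  "X \<in> Obj C \<Longrightarrow> Y \<in> Obj C \<Longrightarrow> Scale C a (Zero C X Y) = Zero C X Y"
  using Scale_simps(2)[of "Zero C X Y" a 0] by (simp del: Scale_simps(2))

lemma kernel_type:
  assumes "is_kernel C f k"
  shows "f \<in> Arr C" "k \<in> Arr C" "Cod C k = Dom C f" "f \<cdot> k = Zero C (Dom C k) (Cod C f)"
  using assms by (simp_all add: is_kernel_def)

lemma kernel_lift:
  assumes "is_kernel C f k" "h \<in> Arr C" "Cod C h = Dom C f" "f \<cdot> h = Zero C (Dom C h) (Cod C f)"
  obtains g where "g \<in> Arr C" "Dom C g = Dom C h" "Cod C g = Dom C k" "k \<cdot> g = h"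
proof -
  have "h \<in> arrows C (Dom C h) (Dom C f)" using assms by simp
  then have "\<exists>!g. g \<in> arrows C (Dom C h) (Dom C k) \<and> k \<cdot> g = h"
    using assms unfolding is_kernel_def by blast
  then show thesis using that by auto
qed

lemma kernel_mono:
  assumes k: "is_kernel C f k"
  shows "mono_arrow C k"
  unfolding mono_arrow_def
proof (intro conjI allI ballI impI)
  note [simp] = kernel_type[OF k]
  show "k \<in> Arr C" by simp
  fix W x y assume x: "x \<in> arrows C W (Dom C k)" and y: "y \<in> arrows C W (Dom C k)" and eq: "k \<cdot>
      x = k \<cdot> y"
  have "f \<cdot> k \<cdot> x = Zero C W (Cod C f)" using x by (simp add: reassoc[OF kernel_type(4)[OF k]])
  moreover have "k \<cdot> x \<in> arrows C W (Dom C f)" using x by simp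
  ultimately have "\<exists>!g. g \<in> arrows C W (Dom C k) \<and> k \<cdot> g = k \<cdot> x"
    using k unfolding is_kernel_def by blast
  then show "x = y" using x y eq by metis
qed

lemma cokernel_type:
  assumes "is_cokernel C f q"
  shows "f \<in> Arr C" "q \<in> Arr C" "Dom C q = Cod C f" "q \<cdot> f = Zero C (Dom C f) (Cod C q)"
  using assms by (simp_all add: is_cokernel_def)

lemma cokernel_desc:
  assumes "is_cokernel C f q" "h \<in> Arr C" "Dom C h = Cod C f" "h \<cdot> f = Zero C (Dom C f) (Cod C h)"
  obtains g where "g \<in> Arr C" "Dom C g = Cod C q" "Cod C g = Cod C h" "g \<cdot> q = h"
proof -
  have "h \<in> arrows C (Cod C f) (Cod C h)" using assms by simp
  then have "\<exists>!g. g \<in> arrows C (Cod C q) (Cod C h) \<and> g \<cdot> q = h"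
    using assms unfolding is_cokernel_def by blast
  then show thesis using that by auto
qed

end

section \<open>Linearity of traces; kernels and cokernels under tensoring\<close>

context symmetric_tensor_category
begin

lemma rwhisker_linear [simp]:
  assumes "f \<in> Arr C" "g \<in> Arr C" "Dom C g = Dom C f" "Cod C g = Cod C f" "Z \<in> Obj C"
  shows "rwhisker (Add C f g) Z = Add C (rwhisker f Z) (rwhisker g Z)"
  using TensorArr_Add_left[of f "Dom C f" "Cod C f" g "Id C Z" Z Z] assms by
      (simp add: rwhisker_def)

lemma lwhisker_linear [simp]:
  assumes "f \<in> Arr C" "g \<in> Arr C" "Dom C g = Dom C f" "Cod C g = Cod C f" "Z \<in> Obj C"
  shows "lwhisker Z (Add C f g) = Add C (lwhisker Z f) (lwhisker Z g)"
  using TensorArr_Add_right[of "Id C Z" Z Z f "Dom C f" "Cod C f" g] assms by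
      (simp add: lwhisker_def)

lemma whisker_Scale [simp]:
  assumes "f \<in> Arr C" "Z \<in> Obj C"
  shows "rwhisker (Scale C a f) Z = Scale C a (rwhisker f Z)"
    "lwhisker Z (Scale C a f) = Scale C a (lwhisker Z f)"
  using TensorArr_Scale_left[of f "Dom C f" "Cod C f" "Id C Z" Z Z a]
    TensorArr_Scale_right[of "Id C Z" Z Z f "Dom C f" "Cod C f" a] assms
  by (simp_all add: rwhisker_def lwhisker_def)

lemma whisker_Zero [simp]:
  assumes [simp]: "X \<in> Obj C" "Y \<in> Obj C" "Z \<in> Obj C"
  shows "rwhisker (Zero C X Y) Z = Zero C (X \<star> Z) (Y \<star> Z)"
    "lwhisker Z (Zero C X Y) = Zero C (Z \<star> X) (Z \<star> Y)"
  using whisker_Scale[of "Zero C X Y" Z 0] by simp_all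

lemma ptrace_Add:
  assumes [simp]: "f \<in> Arr C" "Dom C f = A \<star> Z" "Cod C f = B \<star> Z" "g \<in> Arr C" "Dom C g = A \<star> Z"
      "Cod C g = B \<star> Z"
    "A \<in> Obj C" "B \<in> Obj C" "Z \<in> Obj C"
  shows "ptrace Z A B (Add C f g) = Add C (ptrace Z A B f) (ptrace Z A B g)"
  by (simp add: ptrace_def)

lemma ptrace_Scale:
  assumes [simp]: "f \<in> Arr C" "Dom C f = A \<star> Z" "Cod C f = B \<star> Z" "A \<in> Obj C" "B \<in> Obj C"
      "Z \<in> Obj C"
  shows "ptrace Z A B (Scale C a f) = Scale C a (ptrace Z A B f)"
  by (simp add: ptrace_def)

lemma Scale_Id_Unit_inject:
  "Scale C a (Id C (Unit C)) = Scale C b (Id C (Unit C)) \<longleftrightarrow> a = b"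
  using End_Unit by (auto simp: bij_betw_def inj_on_def)

lemma Scale_scalar_of:
  assumes "f \<in> Arr C" "Dom C f = Unit C" "Cod C f = Unit C"
  shows "Scale C (scalar_of C f) (Id C (Unit C)) = f"
proof -
  have "f \<in> (\<lambda>a. Scale C a (Id C (Unit C))) ` UNIV"
    using End_Unit assms by (simp add: bij_betw_def)
  then obtain a where "f = Scale C a (Id C (Unit C))" by blast
  then show ?thesis unfolding scalar_of_def by (simp add: Scale_Id_Unit_inject)
qed

text \<open>\<open>cat_trace\<close> closes \<open>g\<close> by the braiding and evaluation that
  occur in \<open>dual_counit'_eq\<close>; the resulting endomorphism of the unit is a scalar,
  acting on the background \<open>A\<close>.\<close>

lemma ptrace_lwhisker:
  assumes [simp]: "g \<in> Arr C" "Dom C g = Z" "Cod C g = Z" "A \<in> Obj C" "Z \<in> Obj C"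
  shows "ptrace Z A A (lwhisker A g) = Scale C (cat_trace C Z g) (Id C A)"
proof -
  let ?D = "Dual C Z"
  let ?t = "Ev C Z \<cdot> Braid C Z ?D \<cdot> rwhisker g ?D \<cdot> Coev C Z"
  have t: "?t = Scale C (cat_trace C Z g) (Id C (Unit C))"
    using Scale_scalar_of[of ?t] by (simp add: cat_trace_def rwhisker_def)
  have "ptrace Z A A (lwhisker A g) = RUnit C A \<cdot> lwhisker A ?t \<cdot> runit_inv A"
    by (simp add: ptrace_def dual_counit'_eq dual_unit_def reassoc[OF assoc_middle])
  then show ?thesis unfolding t by simp
qed

lemma ptrace_Scale_Id:
  assumes [simp]: "A \<in> Obj C" "Z \<in> Obj C"
  shows "ptrace Z A A (Scale C a (Id C (A \<star> Z))) = Scale C (a * cat_dim C Z) (Id C A)"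
  using ptrace_lwhisker[of "Id C Z" Z A]
  by (simp add: ptrace_Scale cat_dim_def)

text \<open>Cyclicity of the full trace of \<open>m\<close> and \<open>d\<close>. The trace over
  \<open>P \<star> X\<close> is a loop \<open>X\<close> inside a loop \<open>P\<close>, which is
  where the partial trace \<open>dm\<close> enters. The background is the unit, so that full traces
  become scalars.\<close>

lemma trace_split:
  assumes [simp]: "m \<in> Arr C" "Dom C m = P \<star> X" "Cod C m = Q" "d \<in> Arr C" "Dom C d = Q" "Cod C d =
      P \<star> X"
    "P \<in> Obj C" "Q \<in> Obj C" "X \<in> Obj C"
    and md: "m \<cdot> d = Scale C k (Id C Q)"
    and dm: "ptrace X P P (d \<cdot> m) = Scale C c (Id C P)"
  shows "k * cat_dim C Q = c * cat_dim C P"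
proof -
  let ?I = "Unit C"
  let ?f = "lwhisker ?I m \<cdot> Assoc C ?I P X"
  have l: "assoc_inv ?I P X = rwhisker (lunit_inv P) X \<cdot> LUnit C (P \<star> X)"
  proof -
    have "rwhisker (lunit_inv P) X \<cdot> (LUnit C (P \<star> X) \<cdot> Assoc C ?I P X) \<cdot> assoc_inv ?I P X =
        assoc_inv ?I P X"
      unfolding lunit_tensor[OF assms(7,9)] by simp
    then show ?thesis by simp
  qed
  have "?f \<cdot> split_last ?I P X d = lwhisker ?I (m \<cdot> d)" by (simp add: split_last_def)
  then have e1: "ptrace Q ?I ?I (?f \<cdot> split_last ?I P X d) = Scale C (k * cat_dim C Q) (Id C ?I)"
    unfolding md by (simp add: ptrace_Scale_Id)
  have e2: "split_last ?I P X d \<cdot> ?f = rwhisker (lunit_inv P) X \<cdot> (d \<cdot> m) \<cdot> rwhisker (LUnit C P) X"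
    by (simp add: split_last_def l reassoc[OF lunit_natural] lunit_tensor)
  have e3: "ptrace X (?I \<star> P) (?I \<star> P) (split_last ?I P X d \<cdot> ?f) = Scale C c (Id C (?I \<star> P))"
    unfolding e2
    using ptrace_left[of "(d \<cdot> m) \<cdot> rwhisker (LUnit C P) X" "?I \<star> P" X P "lunit_inv P" "?I \<star> P"]
      ptrace_right[of "d \<cdot> m" P X P "LUnit C P" "?I \<star> P"] dm by simp
  have "ptrace Q ?I ?I (?f \<cdot> split_last ?I P X d) = Scale C (c * cat_dim C P) (Id C ?I)"
    using ptrace_split[of d Q P X ?f ?I ?I] unfolding e3 by (simp add: ptrace_Scale_Id)
  then show ?thesis unfolding e1 by (simp add: Scale_Id_Unit_inject)
qed

lemma cat_dim_iso:
  assumes [simp]: "f \<in> Arr C" "Dom C f = A" "Cod C f = B" "g \<in> Arr C" "Dom C g = B" "Cod C g = A"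
    "A \<in> Obj C" "B \<in> Obj C"
    and gf: "g \<cdot> f = Id C A" and fg: "f \<cdot> g = Id C B"
  shows "cat_dim C A = cat_dim C B"
proof -
  let ?I = "Unit C"
  have "ptrace A ?I ?I (lwhisker ?I (g \<cdot> f)) = ptrace B ?I ?I (lwhisker ?I (f \<cdot> g))"
    using ptrace_cyclic[of "lwhisker ?I f" ?I A ?I B g] by simp
  then show ?thesis
    using ptrace_Scale_Id[of ?I A 1] ptrace_Scale_Id[of ?I B 1]
    unfolding gf fg by (simp add: Scale_Id_Unit_inject)
qed

text \<open>The partial trace of the swap of two unit factors is the identity by yanking. This swap
  is itself an identity, and the partial trace of an identity is the dimension.\<close>

lemma cat_dim_Unit: "cat_dim C (Unit C) = 1"
proof -
  let ?I = "Unit C"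
  have "Scale C 1 (Id C (?I \<star> ?I)) = Scale C (cat_dim C ?I) (Id C (?I \<star> ?I))"
    using ptrace_swap[of ?I ?I] ptrace_Scale_Id[of "?I \<star> ?I" ?I 1] by
        (simp add: swap_last_Unit_Unit)
  then have "RUnit C ?I \<cdot> Scale C 1 (Id C (?I \<star> ?I)) \<cdot> runit_inv ?I =
      RUnit C ?I \<cdot> Scale C (cat_dim C ?I) (Id C (?I \<star> ?I)) \<cdot> runit_inv ?I" by (simp only:)
  then have "Scale C 1 (Id C ?I) = Scale C (cat_dim C ?I) (Id C ?I)" by simp
  then show ?thesis by (simp only: Scale_Id_Unit_inject)
qed

text \<open>A right adjoint preserves kernels: \<open>f\<close> annihilates the transpose of
  \<open>h\<close>, so the lift exists there and is transposed back. Its uniqueness is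
  \<open>mono_rwhisker\<close>.\<close>

lemma kernel_lift_right:
  assumes k: "is_kernel C f k" and [simp]: "h \<in> Arr C" "Cod C h = Dom C f \<star> Z" "Z \<in> Obj C"
    and z: "rwhisker f Z \<cdot> h = Zero C (Dom C h) (Cod C f \<star> Z)"
  obtains g where "g \<in> Arr C" "Dom C g = Dom C h" "Cod C g = Dom C k \<star> Z" "rwhisker k Z \<cdot> g = h"
proof -
  note [simp] = kernel_type(1-3)[OF k]
  have "f \<cdot> transpose_left Z (Dom C f) h = transpose_left Z (Cod C f) (rwhisker f Z \<cdot> h)"
    by (simp add: transpose_left_Comp)
  also have "\<dots> = Zero C (Dom C h \<star> Dual C Z) (Cod C f)"
    unfolding z by (simp add: transpose_left_def)
  finally have z': "f \<cdot> transpose_left Z (Dom C f) h = Zero C (Dom C h \<star> Dual C Z) (Cod C f)" .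
  obtain g where [simp]: "g \<in> Arr C" "Dom C g = Dom C h \<star> Dual C Z" "Cod C g = Dom C k"
    and g: "k \<cdot> g = transpose_left Z (Dom C f) h"
    by (rule kernel_lift[OF k, of "transpose_left Z (Dom C f) h"]) (simp_all add: z')
  have "rwhisker k Z \<cdot> untranspose_left Z (Dom C h) g = untranspose_left Z (Dom C h) (k \<cdot> g)"
    by (simp add: untranspose_left_Comp)
  also have "\<dots> = h" unfolding g by (simp add: untranspose_transpose_left)
  finally show thesis by (intro that[of "untranspose_left Z (Dom C h) g"]) simp_all
qed

text \<open>Conjugating with the braiding reduces whiskering on the left to whiskering on the right;
  kernels and cokernels are treated in the same way.\<close>

lemma mono_lwhisker:
  assumes m: "mono_arrow C k" and [simp]: "Z \<in> Obj C"
  shows "mono_arrow C (lwhisker Z k)"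
  unfolding mono_arrow_def
proof (intro conjI allI ballI impI)
  have [simp]: "k \<in> Arr C" using m by (simp add: mono_arrow_def)
  show "lwhisker Z k \<in> Arr C" by simp
  fix W x y assume x: "x \<in> arrows C W (Dom C (lwhisker Z k))"
      and y: "y \<in> arrows C W (Dom C (lwhisker Z k))"
    and eq: "lwhisker Z k \<cdot> x = lwhisker Z k \<cdot> y"
  let ?b = "Braid C Z (Dom C k)" and ?b' = "Braid C Z (Cod C k)"
  have "rwhisker k Z \<cdot> ?b \<cdot> x = ?b' \<cdot> lwhisker Z k \<cdot> x"
    using x by (simp add: reassoc[OF braid_left])
  also have "\<dots> = rwhisker k Z \<cdot> ?b \<cdot> y"
    unfolding eq using y by (simp add: reassoc[OF braid_left])
  finally have "?b \<cdot> x = ?b \<cdot> y"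
    using x y by - (rule mono_cancel[OF mono_rwhisker[OF m, of Z]], auto)
  then show "x = y"
    using x y by - (rule cancel_iso_left[where f = ?b and h = "Braid C (Dom C k) Z"], auto)
qed

lemma kernel_lift_left:
  assumes k: "is_kernel C f k" and [simp]: "h \<in> Arr C" "Cod C h = Z \<star> Dom C f" "Z \<in> Obj C"
    and z: "lwhisker Z f \<cdot> h = Zero C (Dom C h) (Z \<star> Cod C f)"
  obtains g where "g \<in> Arr C" "Dom C g = Dom C h" "Cod C g = Z \<star> Dom C k" "lwhisker Z k \<cdot> g = h"
proof -
  note [simp] = kernel_type(1-3)[OF k]
  let ?b = "Braid C Z (Dom C f)"
  have "rwhisker f Z \<cdot> ?b \<cdot> h = Braid C Z (Cod C f) \<cdot> lwhisker Z f \<cdot> h"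
    by (simp add: reassoc[OF braid_left])
  then have z': "rwhisker f Z \<cdot> ?b \<cdot> h = Zero C (Dom C h) (Cod C f \<star> Z)"
    unfolding z by simp
  obtain g where [simp]: "g \<in> Arr C" "Dom C g = Dom C h" "Cod C g = Dom C k \<star> Z"
      and g: "rwhisker k Z \<cdot> g = ?b \<cdot> h"
    by (rule kernel_lift_right[OF k, of "?b \<cdot> h" Z]) (simp_all add: z')
  have "lwhisker Z k \<cdot> Braid C (Dom C k) Z \<cdot> g = Braid C (Dom C f) Z \<cdot> rwhisker k Z \<cdot> g"
    by (simp add: reassoc[OF braid_right])
  also have "\<dots> = h" unfolding g by simp
  finally show thesis by (intro that[of "Braid C (Dom C k) Z \<cdot> g"]) simp_all
qed

text \<open>Tensoring with \<open>Z\<close> is also a left adjoint, hence preserves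
  cokernels.\<close>

lemma cokernel_desc_right:
  assumes q: "is_cokernel C f q" and [simp]: "h \<in> Arr C" "Dom C h = Cod C f \<star> Z" "Z \<in> Obj C"
    and z: "h \<cdot> rwhisker f Z = Zero C (Dom C f \<star> Z) (Cod C h)"
  obtains g where "g \<in> Arr C" "Dom C g = Cod C q \<star> Z" "Cod C g = Cod C h" "g \<cdot> rwhisker q Z = h"
proof -
  note [simp] = cokernel_type(1-3)[OF q]
  have "transpose_right Z (Cod C f) h \<cdot> f = transpose_right Z (Dom C f) (h \<cdot> rwhisker f Z)"
    by (simp add: transpose_right_Comp)
  also have "\<dots> = Zero C (Dom C f) (Cod C h \<star> Dual C Z)"
    unfolding z by (simp add: transpose_right_def)
  finally have z': "transpose_right Z (Cod C f) h \<cdot> f = Zero C (Dom C f) (Cod C h \<star> Dual C Z)" .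
  obtain g where [simp]: "g \<in> Arr C" "Dom C g = Cod C q" "Cod C g = Cod C h \<star> Dual C Z"
    and g: "g \<cdot> q = transpose_right Z (Cod C f) h"
    by (rule cokernel_desc[OF q, of "transpose_right Z (Cod C f) h"]) (simp_all add: z')
  have "untranspose_right Z (Cod C h) g \<cdot> rwhisker q Z = untranspose_right Z (Cod C h) (g \<cdot> q)"
    by (simp add: untranspose_right_Comp)
  also have "\<dots> = h" unfolding g by (simp add: untranspose_transpose_right)
  finally show thesis by (intro that[of "untranspose_right Z (Cod C h) g"]) simp_all
qed

lemma cokernel_desc_left:
  assumes q: "is_cokernel C f q" and [simp]: "h \<in> Arr C" "Dom C h = Z \<star> Cod C f" "Z \<in> Obj C"
    and z: "h \<cdot> lwhisker Z f = Zero C (Z \<star> Dom C f) (Cod C h)"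
  obtains g where "g \<in> Arr C" "Dom C g = Z \<star> Cod C q" "Cod C g = Cod C h" "g \<cdot> lwhisker Z q = h"
proof -
  note [simp] = cokernel_type(1-3)[OF q]
  let ?b = "Braid C (Cod C f) Z"
  have "(h \<cdot> ?b) \<cdot> rwhisker f Z = (h \<cdot> lwhisker Z f) \<cdot> Braid C (Dom C f) Z"
    by (simp add: braid_right)
  then have z': "(h \<cdot> ?b) \<cdot> rwhisker f Z = Zero C (Dom C f \<star> Z) (Cod C h)"
    unfolding z by simp
  obtain g where [simp]: "g \<in> Arr C" "Dom C g = Cod C q \<star> Z" "Cod C g = Cod C h" and g: "g \<cdot>
      rwhisker q Z = h \<cdot> ?b"
    by (rule cokernel_desc_right[OF q, of "h \<cdot> ?b" Z]) (use z' in simp_all)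
  have "(g \<cdot> Braid C Z (Cod C q)) \<cdot> lwhisker Z q = (g \<cdot> rwhisker q Z) \<cdot> Braid C Z (Cod C f)"
    by (simp add: braid_left)
  also have "\<dots> = h" unfolding g by simp
  finally show thesis by (intro that[of "g \<cdot> Braid C Z (Cod C q)"]) simp_all
qed


section \<open>Braids on tensor powers\<close>

lemma adjacent_braid_simps:
  "adjacent_braid C X (Suc (Suc (Suc n))) (Suc (Suc n)) = swap_last (tensor_power C X (Suc n)) X X"
  "i \<noteq> Suc (Suc n) \<Longrightarrow> adjacent_braid C X (Suc (Suc (Suc n))) i =
      rwhisker (adjacent_braid C X (Suc (Suc n)) i) X"
  by (simp_all add: swap_last_def assoc_inv_def lwhisker_def rwhisker_def)

lemma tensor_power_Obj [simp]: "X \<in> Obj C \<Longrightarrow> tensor_power C X (Suc n) \<in> Obj C"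
  by (induction n) simp_all

lemma adjacent_braid_type:
  "X \<in> Obj C \<Longrightarrow> adjacent_braid C X (Suc (Suc n)) i \<in> Arr C \<and>
    Dom C (adjacent_braid C X (Suc (Suc n)) i) = tensor_power C X (Suc (Suc n)) \<and>
    Cod C (adjacent_braid C X (Suc (Suc n)) i) = tensor_power C X (Suc (Suc n))"
proof (induction n)
  case (Suc n)
  then show ?case
    by (cases "i = Suc (Suc n)") (simp_all add: adjacent_braid_simps del: adjacent_braid.simps)
qed simp

lemma braid_minus_one_type [simp]:
  assumes "X \<in> Obj C"
  shows "braid_minus_one C X (Suc (Suc n)) i \<in> Arr C"
    "Dom C (braid_minus_one C X (Suc (Suc n)) i) = tensor_power C X (Suc (Suc n))"
    "Cod C (braid_minus_one C X (Suc (Suc n)) i) = tensor_power C X (Suc (Suc n))"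
  using adjacent_braid_type[OF assms, of n i] assms
  by (simp_all add: braid_minus_one_def del: adjacent_braid.simps)

lemma braid_minus_one_last:
  assumes "X \<in> Obj C"
  shows "braid_minus_one C X (Suc (Suc (Suc n))) (Suc (Suc n)) =
    assoc_inv (tensor_power C X (Suc n)) X X \<cdot>
    lwhisker (tensor_power C X (Suc n)) (braid_minus_one C X (Suc (Suc 0)) (Suc 0)) \<cdot>
        Assoc C (tensor_power C X (Suc n)) X X"
  using assms
  by (simp add: braid_minus_one_def adjacent_braid_simps swap_last_def del: adjacent_braid.simps)
    (simp add: assms)

lemma braid_minus_one_whisker:
  assumes "X \<in> Obj C" "i \<noteq> Suc (Suc n)"
  shows "braid_minus_one C X (Suc (Suc (Suc n))) i =
      rwhisker (braid_minus_one C X (Suc (Suc n)) i) X"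
  using assms adjacent_braid_type[OF assms(1), of n i]
  by (simp add: braid_minus_one_def adjacent_braid_simps del: adjacent_braid.simps)

lemma braid_minus_one_2: "braid_minus_one C X (Suc (Suc 0)) (Suc 0) =
    Add C (Braid C X X) (Scale C (- 1) (Id C (X \<star> X)))"
  by (simp add: braid_minus_one_def)

end

section \<open>Graded powers\<close>

text \<open>\<open>v\<close> witnesses that 1 - s * c factors through \<open>u\<close>. This is
  weaker than equality of the kernels of \<open>u\<close> and 1 - s * c, as it must be: for exterior
  powers in characteristic 2 the kernel of \<open>u\<close>, the image of c - 1, can be the smaller
  one.\<close>

locale graded_power = symmetric_tensor_category C
  for C :: "('o, 'm, 'k::field, 'z) tensor_data_scheme" (structure) +
  fixes X V :: 'o and u v :: 'm and s :: 'k
  assumes X_Obj [simp]: "X \<in> Obj C"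
    and u_arrows: "u \<in> arrows C (X \<star> X) V"
    and v_arrows: "v \<in> arrows C V (X \<star> X)"
    and sign: "s * s = 1"
    and u_Braid: "u \<cdot> Braid C X X = Scale C (- s) u"
    and Braid_v_u: "Add C (Scale C s (Braid C X X)) (v \<cdot> u) = Id C (X \<star> X)"
begin

lemma u_v_type [simp]:
  "u \<in> Arr C" "Dom C u = X \<star> X" "Cod C u = V" "v \<in> Arr C" "Dom C v = V" "Cod C v = X \<star> X"
  using u_arrows v_arrows by simp_all

lemma V_Obj [simp]: "V \<in> Obj C"
  using Cod_Obj[of u] by simp

lemma sign_power: "s ^ n * s ^ n = 1"
  by (simp add: power_mult_distrib[symmetric] sign)

text \<open>
  A morphism \<open>h\<close> with \<open>tail A \<cdot> h = 0\<close> has its last two tensor factors in the kernel of \<open>u\<close>. The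
  two conditions on \<open>u\<close> say that \<open>s * c\<close> fixes such an \<open>h\<close> (\<open>swap_fixed\<close>) and that every
  \<open>h + s * c h\<close> is of this kind.
\<close>

definition "tail A = lwhisker A u \<cdot> Assoc C A X X"

lemma tail_type [simp]:
  assumes "A \<in> Obj C"
  shows "tail A \<in> Arr C" "Dom C (tail A) = (A \<star> X) \<star> X" "Cod C (tail A) = A \<star> V"
  using assms by (simp_all add: tail_def)

lemma tail_natural:
  assumes [simp]: "f \<in> Arr C" "Dom C f = A" "Cod C f = B" "A \<in> Obj C" "B \<in> Obj C"
  shows "tail B \<cdot> rwhisker (rwhisker f X) X = rwhisker f V \<cdot> tail A"
  by (simp add: tail_def assoc_right reassoc[OF whisker_exchange[of f u A B, symmetric]])

lemma tail_swap:
  assumes [simp]: "A \<in> Obj C"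
  shows "tail A \<cdot> swap_last A X X = Scale C (- s) (tail A)"
proof -
  have "tail A \<cdot> swap_last A X X = lwhisker A (u \<cdot> Braid C X X) \<cdot> Assoc C A X X"
    by (simp add: tail_def swap_last_def)
  then show ?thesis unfolding u_Braid by (simp add: tail_def)
qed

lemma swap_fixed:
  assumes [simp]: "h \<in> Arr C" "Cod C h = (A \<star> X) \<star> X" "A \<in> Obj C" and z: "tail A \<cdot> h =
      Zero C (Dom C h) (A \<star> V)"
  shows "swap_last A X X \<cdot> h = Scale C s h"
proof -
  let ?k = "lwhisker A v \<cdot> tail A \<cdot> h"
  have "assoc_inv A X X \<cdot> lwhisker A (Add C (Scale C s (Braid C X X)) (v \<cdot> u)) \<cdot> Assoc C A X X \<cdot>
      h = h"
    unfolding Braid_v_u by simp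
  then have "Add C (Scale C s (swap_last A X X \<cdot> h)) (assoc_inv A X X \<cdot> ?k) = h"
    by (simp add: swap_last_def tail_def)
  then have "Scale C s (Scale C s (swap_last A X X \<cdot> h)) = Scale C s h"
    unfolding z by simp
  then show ?thesis by (simp add: sign)
qed

text \<open>Naturality of the crossing with \<open>Z\<close> with respect to \<open>u\<close>, once
  the crossing of \<open>Z\<close> with \<open>X \<star> X\<close> is resolved into two crossings
  with \<open>X\<close>.\<close>

lemma tail_move:
  assumes [simp]: "A \<in> Obj C" "Z \<in> Obj C"
  shows "tail (A \<star> Z) \<cdot> rwhisker (swap_last A X Z) X \<cdot> swap_last (A \<star> X) X Z =
    swap_last A V Z \<cdot> rwhisker (tail A) Z"
proof -
  have "Assoc C (A \<star> Z) X X \<cdot> (rwhisker (swap_last A X Z) X \<cdot> swap_last (A \<star> X) X Z \<cdot>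
      rwhisker (assoc_inv A X X) Z) \<cdot>
      rwhisker (Assoc C A X X) Z = swap_last A (X \<star> X) Z \<cdot> rwhisker (Assoc C A X X) Z"
    by (subst swap_last_tensor'[symmetric]) simp_all
  then have "Assoc C (A \<star> Z) X X \<cdot> rwhisker (swap_last A X Z) X \<cdot> swap_last (A \<star> X) X Z =
      swap_last A (X \<star> X) Z \<cdot> rwhisker (Assoc C A X X) Z"
    by simp
  then show ?thesis by (simp add: tail_def reassoc[OF swap_last_middle])
qed

text \<open>
  The state is \<open>(P\<^sub>n, P\<^sub>n\<^sub>+\<^sub>1, P\<^sub>n\<^sub>+\<^sub>1 \<rightarrow> P\<^sub>n \<star> X)\<close>.
\<close>

primrec power_data :: "nat \<Rightarrow> 'o \<times> 'o \<times> 'm" where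
  "power_data 0 = (Unit C, X, lunit_inv X)"
| "power_data (Suc n) = (case power_data n of (A, B, d) \<Rightarrow>
    let k = SOME k. is_kernel C (tail A \<cdot> rwhisker d X) k in (B, Dom C k, k))"

definition "gpow n = fst (power_data n)"

definition "peel n = snd (snd (power_data n))"

lemma gpow_peel [simp]: "gpow n \<in> Obj C" "peel n \<in> Arr C" "Dom C (peel n) = gpow (Suc n)"
    "Cod C (peel n) = gpow n \<star> X"
  and peel_kernel: "is_kernel C (tail (gpow n) \<cdot> rwhisker (peel n) X) (peel (Suc n))"
proof -
  have main: "gpow n \<in> Obj C \<and> peel n \<in> Arr C \<and> Dom C (peel n) = gpow (Suc n) \<and> Cod C (peel n) =
      gpow n \<star> X" for n
  proof (induction n)
    case 0
    show ?case by (simp add: gpow_def peel_def Let_def)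
  next
    case (Suc n)
    obtain A B d where n: "power_data n = (A, B, d)" by (cases "power_data n") auto
    define k where "k = (SOME k. is_kernel C (tail A \<cdot> rwhisker d X) k)"
    have Sn: "power_data (Suc n) = (B, Dom C k, k)" by (simp add: n k_def Let_def)
    have A: "A \<in> Obj C" "d \<in> Arr C" "Dom C d = B" "Cod C d = A \<star> X"
      using Suc n Sn by (simp_all add: gpow_def peel_def del: power_data.simps)
    then have [simp]: "B \<in> Obj C" using Dom_Obj[of d] by simp
    have "\<exists>k. is_kernel C (tail A \<cdot> rwhisker d X) k" by (rule ex_kernel) (simp add: A)
    then have "is_kernel C (tail A \<cdot> rwhisker d X) k" unfolding k_def by (rule someI_ex)
    note k = kernel_type[OF this]
    have SSn: "fst (power_data (Suc (Suc n))) = Dom C k"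
      unfolding power_data.simps(2)[of "Suc n"] Sn by (simp add: Let_def)
    show ?case using Sn SSn k A by (simp add: gpow_def peel_def del: power_data.simps)
  qed
  then show "gpow n \<in> Obj C" "peel n \<in> Arr C" "Dom C (peel n) = gpow (Suc n)" "Cod C (peel n) =
      gpow n \<star> X" by simp_all
  have "\<exists>k. is_kernel C (tail (gpow n) \<cdot> rwhisker (peel n) X) k"
    by (rule ex_kernel) (simp add: main)
  from someI_ex[OF this] show "is_kernel C (tail (gpow n) \<cdot> rwhisker (peel n) X) (peel (Suc n))"
    by (cases "power_data n") (simp add: gpow_def peel_def Let_def)
qed

lemma gpow_0 [simp]: "gpow 0 = Unit C" and gpow_1: "gpow (Suc 0) = X" and peel_0: "peel 0 =
    lunit_inv X"
  by (simp_all add: gpow_def peel_def Let_def)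

lemma mono_peel: "mono_arrow C (peel n)"
proof (cases n)
  case 0
  have "x = y" if "lunit_inv X \<cdot> x = lunit_inv X \<cdot> y" "x \<in> Arr C" "y \<in> Arr C" "Cod C x = X"
      "Cod C y = X" for x y
    using that by - (rule cancel_iso_left[where f = "lunit_inv X" and h = "LUnit C X"], simp_all)
  then show ?thesis by (simp add: 0 peel_0 mono_arrow_def)
qed (use kernel_mono[OF peel_kernel] in simp)

definition "peel_at Y n = split_last Y (gpow n) X (peel n)"

lemma peel_at_type [simp]:
  assumes "Y \<in> Obj C"
  shows "peel_at Y n \<in> Arr C" "Dom C (peel_at Y n) = Y \<star> gpow (Suc n)" "Cod C (peel_at Y n) =
      (Y \<star> gpow n) \<star> X"
  using assms by (simp_all add: peel_at_def)

lemma mono_peel_at: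
  assumes [simp]: "Y \<in> Obj C"
  shows "mono_arrow C (peel_at Y n)"
  unfolding mono_arrow_def
proof (intro conjI allI ballI impI)
  show "peel_at Y n \<in> Arr C" by simp
  fix W x y assume x: "x \<in> arrows C W (Dom C (peel_at Y n))"
      and y: "y \<in> arrows C W (Dom C (peel_at Y n))"
    and eq: "peel_at Y n \<cdot> x = peel_at Y n \<cdot> y"
  have "lwhisker Y (peel n) \<cdot> x = Assoc C Y (gpow n) X \<cdot> peel_at Y n \<cdot> x"
    using x by (simp add: peel_at_def split_last_def)
  also have "\<dots> = lwhisker Y (peel n) \<cdot> y"
    unfolding eq using y by (simp add: peel_at_def split_last_def)
  finally show "x = y"
    using x y by - (rule mono_cancel[OF mono_lwhisker[OF mono_peel[of n], of Y]], auto)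
qed

lemma tail_peel_at:
  assumes [simp]: "Y \<in> Obj C"
  shows "tail (Y \<star> gpow n) \<cdot> rwhisker (peel_at Y n) X =
    assoc_inv Y (gpow n) V \<cdot> lwhisker Y (tail (gpow n) \<cdot> rwhisker (peel n) X) \<cdot>
        Assoc C Y (gpow (Suc n)) X"
  by (simp add: tail_def peel_at_def split_last_def reassoc[OF pentagon_middle] assoc_middle
      reassoc[OF assoc_inv_left[symmetric]])

lemma tail_peel_zero: "tail (gpow n) \<cdot> rwhisker (peel n) X \<cdot> peel (Suc n) =
    Zero C (gpow (Suc (Suc n))) (gpow n \<star> V)"
  using kernel_type(4)[OF peel_kernel[of n]] by simp

lemma tail_peel_at_zero:
  assumes [simp]: "Y \<in> Obj C"
  shows "tail (Y \<star> gpow n) \<cdot> rwhisker (peel_at Y n) X \<cdot> peel_at Y (Suc n) =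
      Zero C (Y \<star> gpow (Suc (Suc n))) ((Y \<star> gpow n) \<star> V)"
proof -
  have "tail (Y \<star> gpow n) \<cdot> rwhisker (peel_at Y n) X \<cdot> peel_at Y (Suc n) =
      (tail (Y \<star> gpow n) \<cdot> rwhisker (peel_at Y n) X) \<cdot> peel_at Y (Suc n)" by simp
  also have "\<dots> = assoc_inv Y (gpow n) V \<cdot> lwhisker Y
      (tail (gpow n) \<cdot> rwhisker (peel n) X \<cdot> peel (Suc n))"
    unfolding tail_peel_at[OF assms] by (simp add: peel_at_def[of Y "Suc n"] split_last_def)
  finally show ?thesis unfolding tail_peel_zero by simp
qed

text \<open>Tensoring with \<open>Y\<close> preserves the kernel that defines
  \<open>gpow (Suc n)\<close>; \<open>tail_peel_at\<close> identifies the two forms of the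
  condition. For n = 0 nothing has to be tested, since \<open>peel 0\<close> is invertible.\<close>

lemma peel_at_lift:
  assumes [simp]: "Y \<in> Obj C" "h \<in> Arr C" "Cod C h = (Y \<star> gpow n) \<star> X"
    and z: "\<And>n'. n = Suc n' \<Longrightarrow> tail (Y \<star> gpow n') \<cdot> rwhisker (peel_at Y n') X \<cdot> h =
        Zero C (Dom C h) ((Y \<star> gpow n') \<star> V)"
  shows "\<exists>g. g \<in> arrows C (Dom C h) (Y \<star> gpow (Suc n)) \<and> peel_at Y n \<cdot> g = h"
proof (cases n)
  case 0
  show ?thesis
  proof (intro exI conjI)
    show "lwhisker Y (LUnit C X) \<cdot> Assoc C Y (Unit C) X \<cdot> h \<in> arrows C (Dom C h) (Y \<star> gpow (Suc n))"
      using assms(3) by (simp add: 0 gpow_1)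
    show "peel_at Y n \<cdot> lwhisker Y (LUnit C X) \<cdot> Assoc C Y (Unit C) X \<cdot> h = h"
      using assms(3) by (simp add: 0 peel_at_def split_last_def peel_0)
  qed
next
  case (Suc n')
  note n [simp] = Suc
  let ?h = "Assoc C Y (gpow n) X \<cdot> h"
  let ?f = "tail (gpow n') \<cdot> rwhisker (peel n') X"
  have "assoc_inv Y (gpow n') V \<cdot> lwhisker Y ?f \<cdot> ?h =
      (tail (Y \<star> gpow n') \<cdot> rwhisker (peel_at Y n') X) \<cdot> h"
    unfolding tail_peel_at[OF assms(1)] using assms(3) by simp
  also have "\<dots> = Zero C (Dom C h) ((Y \<star> gpow n') \<star> V)"
    using z[OF n] assms(3) by simp
  finally have "Assoc C Y (gpow n') V \<cdot> assoc_inv Y (gpow n') V \<cdot> lwhisker Y ?f \<cdot> ?h =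
      Assoc C Y (gpow n') V \<cdot> Zero C (Dom C h) ((Y \<star> gpow n') \<star> V)" by (simp only:)
  then have z': "lwhisker Y ?f \<cdot> ?h = Zero C (Dom C h) (Y \<star> gpow n' \<star> V)"
    using assms(3) by simp
  obtain g where [simp]: "g \<in> Arr C" "Dom C g = Dom C h" "Cod C g = Y \<star> gpow (Suc n)"
      and g: "lwhisker Y (peel n) \<cdot> g = ?h"
    by (rule kernel_lift_left[OF peel_kernel[of n'], of ?h Y]) (use assms(3) z' in simp_all)
  have "peel_at Y n \<cdot> g = assoc_inv Y (gpow n) X \<cdot> (lwhisker Y (peel n) \<cdot> g)"
    by (simp add: peel_at_def split_last_def)
  also have "\<dots> = h" unfolding g using assms(3) by simp
  finally show ?thesis by (intro exI[of _ g]) simp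
qed

lemma peel_lift:
  assumes [simp]: "h \<in> Arr C" "Cod C h = gpow n \<star> X"
    and z: "\<And>n'. n = Suc n' \<Longrightarrow> tail (gpow n') \<cdot> rwhisker (peel n') X \<cdot> h =
        Zero C (Dom C h) (gpow n' \<star> V)"
  shows "\<exists>g. g \<in> arrows C (Dom C h) (gpow (Suc n)) \<and> peel n \<cdot> g = h"
proof (cases n)
  case 0
  show ?thesis
  proof (intro exI conjI)
    show "LUnit C X \<cdot> h \<in> arrows C (Dom C h) (gpow (Suc n))"
      using assms(2) by (simp add: 0 gpow_1)
    show "peel n \<cdot> LUnit C X \<cdot> h = h"
      using assms(2) by (simp add: 0 peel_0)
  qed
next
  case (Suc n')
  show ?thesis
    by (rule kernel_lift[OF peel_kernel[of n'], of h]) (use z[OF Suc] assms Suc in auto)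
qed


subsection \<open>Bialgebra structure\<close>

text \<open>Seen inside tensor powers this is the inclusion of degree b + a into the product of
  degrees b and a, with the right factor built up one \<open>X\<close> at a time.
  \<open>SOME\<close> picks the only possible lift, because \<open>peel_at\<close> is a
  monomorphism.\<close>

primrec comult :: "nat \<Rightarrow> nat \<Rightarrow> 'm" where
  "comult b 0 = runit_inv (gpow b)"
| "comult b (Suc a) = (SOME g. g \<in> arrows C (gpow (Suc (b + a))) (gpow b \<star> gpow (Suc a)) \<and>
    peel_at (gpow b) a \<cdot> g = rwhisker (comult b a) X \<cdot> peel (b + a))"

lemma comult_main:
  "comult b a \<in> arrows C (gpow (b + a)) (gpow b \<star> gpow a) \<and>
   comult b (Suc a) \<in> arrows C (gpow (Suc (b + a))) (gpow b \<star> gpow (Suc a)) \<and>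
   peel_at (gpow b) a \<cdot> comult b (Suc a) = rwhisker (comult b a) X \<cdot> peel (b + a)"
proof (induction a)
  case 0
  let ?h = "rwhisker (comult b 0) X \<cdot> peel (b + 0)"
  have "\<exists>g. g \<in> arrows C (Dom C ?h) (gpow b \<star> gpow (Suc 0)) \<and> peel_at (gpow b) 0 \<cdot> g = ?h"
    by (rule peel_at_lift) simp_all
  then have "\<exists>g. g \<in> arrows C (gpow (Suc (b + 0))) (gpow b \<star> gpow (Suc 0)) \<and> peel_at (gpow b) 0 \<cdot>
      g = ?h" by simp
  from someI_ex[OF this] show ?case by simp
next
  case (Suc a)
  then have [simp]: "comult b a \<in> Arr C" "Dom C (comult b a) = gpow (b + a)" "Cod C (comult b a) =
      gpow b \<star> gpow a"
    "comult b (Suc a) \<in> Arr C" "Dom C (comult b (Suc a)) = gpow (Suc (b + a))"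
        "Cod C (comult b (Suc a)) = gpow b \<star> gpow (Suc a)"
    by (simp_all del: comult.simps)
  have eq: "peel_at (gpow b) a \<cdot> comult b (Suc a) = rwhisker (comult b a) X \<cdot> peel (b + a)"
    using Suc by simp
  let ?h = "rwhisker (comult b (Suc a)) X \<cdot> peel (b + Suc a)"
  have "rwhisker (peel_at (gpow b) a) X \<cdot> ?h = rwhisker (peel_at (gpow b) a \<cdot> comult b (Suc a)) X
      \<cdot> peel (b + Suc a)"
    by (simp del: comult.simps)
  also have "\<dots> = rwhisker (rwhisker (comult b a) X) X \<cdot> rwhisker (peel (b + a)) X \<cdot>
      peel (Suc (b + a))"
    unfolding eq by simp
  finally have h: "rwhisker (peel_at (gpow b) a) X \<cdot> ?h =
    rwhisker (rwhisker (comult b a) X) X \<cdot> rwhisker (peel (b + a)) X \<cdot> peel (Suc (b + a))" .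
  \<comment> \<open>By \<open>h\<close> two factors have been peeled off degree b + a + 2, where the
    test vanishes by the choice of the kernel. This is the lifting condition for the next
    \<open>a\<close>.\<close>
  have z: "tail (gpow b \<star> gpow a) \<cdot> rwhisker (peel_at (gpow b) a) X \<cdot> ?h =
      Zero C (gpow (Suc (Suc (b + a)))) ((gpow b \<star> gpow a) \<star> V)"
    unfolding h by (simp add: reassoc[OF tail_natural] tail_peel_zero)
  have "\<exists>g. g \<in> arrows C (Dom C ?h) (gpow b \<star> gpow (Suc (Suc a))) \<and> peel_at (gpow b) (Suc a) \<cdot> g =
      ?h"
  proof (intro peel_at_lift)
    fix n' assume "Suc a = Suc n'"
    then have [simp]: "n' = a" by simp
    show "tail (gpow b \<star> gpow n') \<cdot> rwhisker (peel_at (gpow b) n') X \<cdot> ?h =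
        Zero C (Dom C ?h) ((gpow b \<star> gpow n') \<star> V)"
      using z by (simp del: comult.simps)
  qed (simp_all del: comult.simps)
  then have "\<exists>g. g \<in> arrows C (gpow (Suc (b + Suc a))) (gpow b \<star> gpow (Suc (Suc a))) \<and>
      peel_at (gpow b) (Suc a) \<cdot> g = ?h"
    by (simp del: comult.simps)
  from someI_ex[OF this] show ?case using Suc by (simp only: comult.simps(2)[of b "Suc a"]
      add_Suc_right)
qed

lemma comult_type [simp]:
  "comult b a \<in> Arr C" "Dom C (comult b a) = gpow (b + a)" "Cod C (comult b a) = gpow b \<star> gpow a"
  using comult_main[of b a] by (simp_all del: comult.simps)

lemma peel_at_comult:
  "peel_at (gpow b) a \<cdot> comult b (Suc a) = rwhisker (comult b a) X \<cdot> peel (b + a)"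
  using comult_main[of b a] by blast

declare comult.simps(2) [simp del]

text \<open>The last factor of the left part is carried past the \<open>a\<close> factors of the
  right part, and each of these adjacent crossings acts as s by \<open>swap_fixed\<close>.\<close>

lemma swap_comult:
  "swap_last (gpow b) X (gpow a) \<cdot> rwhisker (peel b) (gpow a) \<cdot> comult (Suc b) a =
    Scale C (s ^ a) (rwhisker (comult b a) X \<cdot> peel (b + a))"
proof (induction a)
  case 0
  have "RUnit C (gpow b \<star> X) \<cdot> rwhisker (peel b) (Unit C) \<cdot> runit_inv (gpow (Suc b)) = peel b"
    by (simp add: reassoc[OF runit_natural])
  then have "rwhisker (RUnit C (gpow b)) X \<cdot> swap_last (gpow b) X (Unit C) \<cdot>
      rwhisker (peel b) (Unit C) \<cdot> runit_inv (gpow (Suc b)) = peel b"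
    by (simp add: swap_last_Unit[symmetric])
  then have "rwhisker (RUnit C (gpow b)) X \<cdot> swap_last (gpow b) X (Unit C) \<cdot>
      rwhisker (peel b) (Unit C) \<cdot> runit_inv (gpow (Suc b)) =
      rwhisker (RUnit C (gpow b)) X \<cdot> rwhisker (runit_inv (gpow b)) X \<cdot> peel b"
    by simp
  then have "swap_last (gpow b) X (Unit C) \<cdot> rwhisker (peel b) (Unit C) \<cdot> runit_inv (gpow (Suc b)) =
      rwhisker (runit_inv (gpow b)) X \<cdot> peel b"
    by (rule cancel_iso_left[where h = "rwhisker (runit_inv (gpow b)) X"]) simp_all
  then show ?case by simp
next
  case (Suc a)
  let ?P = "peel_at (gpow b) a"
  let ?N = "rwhisker (rwhisker (comult b a) X) X"
  let ?t = "rwhisker (peel (b + a)) X \<cdot> peel (Suc (b + a))"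
  have fixed: "swap_last (gpow (b + a)) X X \<cdot> ?t = Scale C s ?t"
    by (rule swap_fixed) (simp_all add: tail_peel_zero)
  \<comment> \<open>Both sides are compared after one more peeling, which is monomorphic. The
    crossing with \<open>gpow (Suc a)\<close> then splits into one with \<open>gpow a\<close>,
    covered by the induction hypothesis, and one with a single \<open>X\<close>, covered by
    \<open>fixed\<close>.\<close>
  have "rwhisker ?P X \<cdot> swap_last (gpow b) X (gpow (Suc a)) \<cdot> rwhisker (peel b) (gpow (Suc a)) \<cdot>
      comult (Suc b) (Suc a) =
      swap_last (gpow b \<star> gpow a) X X \<cdot> rwhisker (swap_last (gpow b) X (gpow a)) X \<cdot>
      peel_at (gpow b \<star> X) a \<cdot> rwhisker (peel b) (gpow (Suc a)) \<cdot> comult (Suc b) (Suc a)"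
    unfolding peel_at_def by (simp add: reassoc[OF split_last_swap_last])
  also have "peel_at (gpow b \<star> X) a \<cdot> rwhisker (peel b) (gpow (Suc a)) \<cdot> comult (Suc b) (Suc a) =
      rwhisker (rwhisker (peel b) (gpow a)) X \<cdot> peel_at (gpow (Suc b)) a \<cdot> comult (Suc b) (Suc a)"
    unfolding peel_at_def by (simp add: reassoc[OF split_last_natural])
  also have "peel_at (gpow (Suc b)) a \<cdot> comult (Suc b) (Suc a) = rwhisker (comult (Suc b) a) X \<cdot>
      peel (Suc (b + a))"
    using peel_at_comult[of "Suc b" a] by simp
  also have "swap_last (gpow b \<star> gpow a) X X \<cdot> rwhisker (swap_last (gpow b) X (gpow a)) X \<cdot>
      rwhisker (rwhisker (peel b) (gpow a)) X \<cdot> rwhisker (comult (Suc b) a) X \<cdot> peel (Suc (b + a)) =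
      swap_last (gpow b \<star> gpow a) X X \<cdot>
      rwhisker (swap_last (gpow b) X (gpow a) \<cdot> rwhisker (peel b) (gpow a) \<cdot> comult (Suc b) a) X \<cdot>
          peel (Suc (b + a))"
    by simp
  also have "\<dots> = Scale C (s ^ a) (?N \<cdot> swap_last (gpow (b + a)) X X \<cdot> ?t)"
    unfolding Suc by (simp add: reassoc[OF swap_last_right])
  also have "\<dots> = Scale C (s ^ Suc a) (?N \<cdot> ?t)"
    unfolding fixed by (simp add: mult.commute)
  also have "?N \<cdot> ?t = rwhisker (rwhisker (comult b a) X \<cdot> peel (b + a)) X \<cdot> peel (Suc (b + a))"
    by simp
  also have "\<dots> = rwhisker ?P X \<cdot> rwhisker (comult b (Suc a)) X \<cdot> peel (Suc (b + a))"
    unfolding peel_at_comult[symmetric] by simp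
  finally have "rwhisker ?P X \<cdot> swap_last (gpow b) X (gpow (Suc a)) \<cdot>
      rwhisker (peel b) (gpow (Suc a)) \<cdot> comult (Suc b) (Suc a) =
      rwhisker ?P X \<cdot> Scale C (s ^ Suc a) (rwhisker (comult b (Suc a)) X \<cdot> peel (b + Suc a))"
    by simp
  then show ?case
    by (rule mono_cancel[OF mono_rwhisker[OF mono_peel_at], rotated 2]) simp_all
qed

text \<open>
  The shuffle product is defined by its derivation property: the last factor of the product is the
  last factor of the right or of the left argument, the latter being moved with sign \<open>s\<^sup>a\<^sup>+\<^sup>1\<close> past
  the right argument.
\<close>

function gmult :: "nat \<Rightarrow> nat \<Rightarrow> 'm" where
  "gmult b 0 = RUnit C (gpow b)"
| "gmult 0 (Suc a) = (SOME g. g \<in> arrows C (gpow 0 \<star> gpow (Suc a)) (gpow (Suc a)) \<and>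
    peel a \<cdot> g = rwhisker (gmult 0 a) X \<cdot> peel_at (gpow 0) a)"
| "gmult (Suc b) (Suc a) = (SOME g. g \<in> arrows C (gpow (Suc b) \<star> gpow (Suc a))
    (gpow (Suc (Suc (b + a)))) \<and>
    peel (Suc (b + a)) \<cdot> g = Add C (rwhisker (gmult (Suc b) a) X \<cdot> peel_at (gpow (Suc b)) a)
      (Scale C (s ^ Suc a) (rwhisker (gmult b (Suc a)) X \<cdot> swap_last (gpow b) X (gpow (Suc a)) \<cdot>
        rwhisker (peel b) (gpow (Suc a)))))"
  by pat_completeness auto
termination by lexicographic_order

text \<open>The two terms of the derivation rule: \<open>X\<close> is detached from the right
  argument or, in \<open>peel_left\<close>, from the left one. The indices count the factors that
  remain.\<close>

definition "peel_right b a = rwhisker (gmult b a) X \<cdot> peel_at (gpow b) a"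

definition "peel_left b a = Scale C (s ^ a)
  (rwhisker (gmult b a) X \<cdot> swap_last (gpow b) X (gpow a) \<cdot> rwhisker (peel b) (gpow a))"

declare gmult.simps(2,3) [simp del]

text \<open>The \<open>SOME\<close> in \<open>gmult\<close> is meaningful only if the lift exists,
  and the lifting condition involves the derivation rule in lower degrees. Hence typing and
  derivation rule are carried through one induction.\<close>

definition "gmult_ok b a \<longleftrightarrow> gmult b a \<in> arrows C (gpow b \<star> gpow a) (gpow (b + a)) \<and>
  (case (b, a) of (0, 0) \<Rightarrow> True | (Suc b', 0) \<Rightarrow> peel b' \<cdot> gmult b a = peel_left b' 0
    | (0, Suc a') \<Rightarrow> peel a' \<cdot> gmult b a = peel_right 0 a'
    | (Suc b', Suc a') \<Rightarrow> peel (Suc (b' + a')) \<cdot> gmult b a =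
        Add C (peel_right (Suc b') a') (peel_left b' (Suc a')))"

text \<open>Peeling two factors off a product gives four terms. Here both come from the right
  argument, in which they are adjacent, so the test kills them.\<close>

lemma tail_peel_right_zero:
  assumes "gmult b a \<in> arrows C (gpow b \<star> gpow a) (gpow (b + a))"
  shows "tail (gpow (b + a)) \<cdot> rwhisker (peel_right b a) X \<cdot> peel_at (gpow b) (Suc a) =
    Zero C (gpow b \<star> gpow (Suc (Suc a))) (gpow (b + a) \<star> V)"
  using assms by (simp add: peel_right_def reassoc[OF tail_natural] tail_peel_at_zero)

text \<open>Both factors come from the left argument: \<open>tail_move\<close> pulls the test back
  across \<open>gpow a\<close>, where it vanishes.\<close>

lemma tail_peel_left_zero:
  assumes "gmult b a \<in> arrows C (gpow b \<star> gpow a) (gpow (b + a))"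
  shows "tail (gpow (b + a)) \<cdot> rwhisker (peel_left b a) X \<cdot> swap_last (gpow (Suc b)) X (gpow a) \<cdot>
    rwhisker (peel (Suc b)) (gpow a) = Zero C (gpow (Suc (Suc b)) \<star> gpow a) (gpow (b + a) \<star> V)"
proof -
  have [simp]: "gmult b a \<in> Arr C" "Dom C (gmult b a) = gpow b \<star> gpow a" "Cod C (gmult b a) =
      gpow (b + a)"
    using assms by auto
  have "tail (gpow (b + a)) \<cdot> rwhisker (peel_left b a) X \<cdot> swap_last (gpow (Suc b)) X (gpow a) \<cdot>
      rwhisker (peel (Suc b)) (gpow a) =
    Scale C (s ^ a) (rwhisker (gmult b a) V \<cdot> (tail (gpow b \<star> gpow a) \<cdot>
        rwhisker (swap_last (gpow b) X (gpow a)) X \<cdot>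
      swap_last (gpow b \<star> X) X (gpow a)) \<cdot> rwhisker (rwhisker (peel b) X) (gpow a) \<cdot>
          rwhisker (peel (Suc b)) (gpow a))"
    by (simp add: peel_left_def reassoc[OF tail_natural] reassoc[OF swap_last_right])
  also have "\<dots> = Scale C (s ^ a) (rwhisker (gmult b a) V \<cdot> swap_last (gpow b) V (gpow a) \<cdot>
      rwhisker (tail (gpow b) \<cdot> rwhisker (peel b) X \<cdot> peel (Suc b)) (gpow a))"
    unfolding tail_move[OF gpow_peel(1) gpow_peel(1)] by simp
  finally show ?thesis unfolding tail_peel_zero by simp
qed

text \<open>One factor from each argument, in either order. The terms differ by an exchange of the
  last two factors, which \<open>u\<close> turns into - s, and by one more s for crossing a longer
  right argument; they cancel because s * s = 1.\<close>

lemma tail_peel_mixed_zero: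
  assumes "gmult b a \<in> arrows C (gpow b \<star> gpow a) (gpow (b + a))"
  shows "Add C (tail (gpow (b + a)) \<cdot> rwhisker (peel_left b a) X \<cdot> peel_at (gpow (Suc b)) a)
    (Scale C (s ^ Suc a) (tail (gpow (b + a)) \<cdot> rwhisker (peel_right b a) X \<cdot>
        swap_last (gpow b) X (gpow (Suc a)) \<cdot>
      rwhisker (peel b) (gpow (Suc a)))) = Zero C (gpow (Suc b) \<star> gpow (Suc a)) (gpow (b + a) \<star> V)"
proof -
  have [simp]: "gmult b a \<in> Arr C" "Dom C (gmult b a) = gpow b \<star> gpow a" "Cod C (gmult b a) =
      gpow (b + a)"
    using assms by auto
  let ?k = "rwhisker (swap_last (gpow b) X (gpow a)) X \<cdot> peel_at (gpow b \<star> X) a \<cdot>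
      rwhisker (peel b) (gpow (Suc a))"
  let ?t = "rwhisker (gmult b a) V \<cdot> tail (gpow b \<star> gpow a) \<cdot> ?k"
  have nat: "rwhisker (rwhisker (peel b) (gpow a)) X \<cdot> peel_at (gpow (Suc b)) a =
      peel_at (gpow b \<star> X) a \<cdot> rwhisker (peel b) (gpow (Suc a))"
    unfolding peel_at_def by (rule split_last_natural[symmetric]) simp_all
  have 1: "tail (gpow (b + a)) \<cdot> rwhisker (peel_left b a) X \<cdot> peel_at (gpow (Suc b)) a =
      Scale C (s ^ a) ?t"
    by (simp add: peel_left_def nat reassoc[OF tail_natural])
  have "rwhisker (peel_at (gpow b) a) X \<cdot> swap_last (gpow b) X (gpow (Suc a)) =
      swap_last (gpow b \<star> gpow a) X X \<cdot> rwhisker (swap_last (gpow b) X (gpow a)) X \<cdot>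
          peel_at (gpow b \<star> X) a"
    unfolding peel_at_def by (rule split_last_swap_last) simp_all
  note sw = reassoc[OF this]
  have 2: "tail (gpow (b + a)) \<cdot> rwhisker (peel_right b a) X \<cdot> swap_last (gpow b) X (gpow (Suc a)) \<cdot>
      rwhisker (peel b) (gpow (Suc a)) = Scale C (- s) ?t"
    by (simp add: peel_right_def sw reassoc[OF tail_natural] reassoc[OF tail_swap])
  have "s ^ Suc a * s = s ^ a * (s * s)" by (simp add: algebra_simps)
  then have e: "s ^ a - s ^ Suc a * s = 0" by (simp add: sign)
  show ?thesis unfolding 1 2 by (simp add: Add_Scale e del: power_Suc)
qed

lemma gmult_ok_type:
  assumes "gmult_ok b a"
  shows "gmult b a \<in> Arr C" "Dom C (gmult b a) = gpow b \<star> gpow a" "Cod C (gmult b a) = gpow (b + a)"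
    "peel_right b a \<in> Arr C" "Dom C (peel_right b a) = gpow b \<star> gpow (Suc a)"
        "Cod C (peel_right b a) = gpow (b + a) \<star> X"
    "peel_left b a \<in> Arr C" "Dom C (peel_left b a) = gpow (Suc b) \<star> gpow a"
        "Cod C (peel_left b a) = gpow (b + a) \<star> X"
  using assms by (simp_all add: gmult_ok_def peel_right_def peel_left_def)

text \<open>Of the two terms of the derivation rule, the one with both factors from the right
  argument is killed and the mixed one is left; for a = 0 there is only the mixed one.
  \<open>tail_peel_left\<close> is the mirror case.\<close>

lemma tail_peel_right:
  assumes ok: "gmult_ok (Suc b) a" "gmult_ok b a" "\<And>a'. a = Suc a' \<Longrightarrow> gmult_ok (Suc b) a'"
  shows "tail (gpow (b + a)) \<cdot> rwhisker (peel (b + a)) X \<cdot> peel_right (Suc b) a =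
    tail (gpow (b + a)) \<cdot> rwhisker (peel_left b a) X \<cdot> peel_at (gpow (Suc b)) a"
proof -
  note [simp] = gmult_ok_type[OF ok(1)] gmult_ok_type[OF ok(2)]
  have 1: "rwhisker (peel (b + a)) X \<cdot> peel_right (Suc b) a =
      rwhisker (peel (b + a) \<cdot> gmult (Suc b) a) X \<cdot> peel_at (gpow (Suc b)) a"
    by (simp add: peel_right_def)
  show ?thesis
  proof (cases a)
    case 0
    then have "peel (b + a) \<cdot> gmult (Suc b) a = peel_left b a"
      using ok(1) by (simp add: gmult_ok_def)
    then show ?thesis unfolding 1 by simp
  next
    case (Suc a')
    note ok' = ok(3)[OF Suc]
    have 2: "peel (b + a) \<cdot> gmult (Suc b) a = Add C (peel_right (Suc b) a') (peel_left b a)"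
      using ok(1) Suc by (simp add: gmult_ok_def)
    have "tail (gpow (Suc b + a')) \<cdot> rwhisker (peel_right (Suc b) a') X \<cdot>
        peel_at (gpow (Suc b)) (Suc a') =
        Zero C (gpow (Suc b) \<star> gpow (Suc (Suc a'))) (gpow (Suc b + a') \<star> V)"
      by (rule tail_peel_right_zero) (use ok' in \<open>simp add: gmult_ok_def\<close>)
    then have 3: "tail (gpow (b + a)) \<cdot> rwhisker (peel_right (Suc b) a') X \<cdot>
        peel_at (gpow (Suc b)) a =
        Zero C (gpow (Suc b) \<star> gpow (Suc a)) (gpow (b + a) \<star> V)"
      using Suc by simp
    have [simp]: "peel_right (Suc b) a' \<in> Arr C" "Dom C (peel_right (Suc b) a') =
        gpow (Suc b) \<star> gpow a" "Cod C (peel_right (Suc b) a') = gpow (b + a) \<star> X"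
      using Suc gmult_ok_type[OF ok'] by simp_all
    show ?thesis unfolding 1 2 by (simp add: 3)
  qed
qed

lemma tail_peel_left:
  assumes ok: "gmult_ok b (Suc a)" "gmult_ok b a" "\<And>b'. b = Suc b' \<Longrightarrow> gmult_ok b' (Suc a)"
  shows "tail (gpow (b + a)) \<cdot> rwhisker (peel (b + a)) X \<cdot> peel_left b (Suc a) =
    Scale C (s ^ Suc a) (tail (gpow (b + a)) \<cdot> rwhisker (peel_right b a) X \<cdot>
        swap_last (gpow b) X (gpow (Suc a)) \<cdot>
      rwhisker (peel b) (gpow (Suc a)))"
proof -
  note [simp] = gmult_ok_type[OF ok(1)] gmult_ok_type[OF ok(2)]
  let ?k = "swap_last (gpow b) X (gpow (Suc a)) \<cdot> rwhisker (peel b) (gpow (Suc a))"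
  have 1: "rwhisker (peel (b + a)) X \<cdot> peel_left b (Suc a) =
      Scale C (s ^ Suc a) (rwhisker (peel (b + a) \<cdot> gmult b (Suc a)) X \<cdot> ?k)"
    by (simp add: peel_left_def)
  show ?thesis
  proof (cases b)
    case 0
    then have 2: "peel (b + a) \<cdot> gmult b (Suc a) = peel_right b a"
      using ok(1) by (simp add: gmult_ok_def)
    show ?thesis unfolding 1 2 by simp
  next
    case (Suc b')
    note ok' = ok(3)[OF Suc]
    have 2: "peel (b + a) \<cdot> gmult b (Suc a) = Add C (peel_right b a) (peel_left b' (Suc a))"
      using ok(1) Suc by (simp add: gmult_ok_def)
    have "tail (gpow (b' + Suc a)) \<cdot> rwhisker (peel_left b' (Suc a)) X \<cdot>
        swap_last (gpow (Suc b')) X (gpow (Suc a)) \<cdot>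
        rwhisker (peel (Suc b')) (gpow (Suc a)) =
            Zero C (gpow (Suc (Suc b')) \<star> gpow (Suc a)) (gpow (b' + Suc a) \<star> V)"
      by (rule tail_peel_left_zero) (use ok' in \<open>simp add: gmult_ok_def\<close>)
    then have 3: "tail (gpow (b + a)) \<cdot> rwhisker (peel_left b' (Suc a)) X \<cdot> ?k =
        Zero C (gpow (Suc b) \<star> gpow (Suc a)) (gpow (b + a) \<star> V)"
      using Suc by simp
    have [simp]: "peel_left b' (Suc a) \<in> Arr C" "Dom C (peel_left b' (Suc a)) =
        gpow b \<star> gpow (Suc a)" "Cod C (peel_left b' (Suc a)) = gpow (b + a) \<star> X"
      using Suc gmult_ok_type[OF ok'] by simp_all
    show ?thesis unfolding 1 2 by (simp add: 3)
  qed
qed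

lemma gmult_ok: "gmult_ok b a"
proof (induction "b + a" arbitrary: b a rule: less_induct)
  case less
  note IH = less.hyps
  show ?case
  proof (cases a)
    case 0
    \<comment> \<open>With right argument in degree 0 the product is a unitor, and the rule says
      that \<open>X\<close> crosses the unit trivially.\<close>
    have "peel b' \<cdot> RUnit C (gpow (Suc b')) = peel_left b' 0" for b'
      by (simp add: peel_left_def reassoc[OF swap_last_Unit] runit_natural)
    then show ?thesis by (simp add: gmult_ok_def 0 split: nat.split)
  next
    case a: (Suc a')
    show ?thesis
    proof (cases b)
      case 0
      have ok: "gmult_ok 0 a'" by (rule IH) (simp add: 0 a)
      note [simp] = gmult_ok_type[OF ok]
      have "\<exists>g. g \<in> arrows C (Dom C (peel_right 0 a')) (gpow (Suc a')) \<and> peel a' \<cdot> g =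
          peel_right 0 a'"
      proof (rule peel_lift)
        fix n assume n: "a' = Suc n"
        have ok': "gmult_ok 0 n" by (rule IH) (simp add: 0 a n)
        note [simp] = gmult_ok_type[OF ok']
        have e: "peel n \<cdot> gmult 0 (Suc n) = peel_right 0 n"
          using ok n by (simp add: gmult_ok_def)
        have "rwhisker (peel n) X \<cdot> peel_right 0 a' = rwhisker (peel n \<cdot> gmult 0 (Suc n)) X \<cdot>
            peel_at (gpow 0) (Suc n)"
          using gmult_ok_type[OF ok] unfolding n by (simp add: peel_right_def)
        then show "tail (gpow n) \<cdot> rwhisker (peel n) X \<cdot> peel_right 0 a' =
            Zero C (Dom C (peel_right 0 a')) (gpow n \<star> V)"
          unfolding e using tail_peel_right_zero[of 0 n] n gmult_ok_type(5)[OF ok] by simp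
      qed simp_all
      then have "\<exists>g. g \<in> arrows C (gpow 0 \<star> gpow (Suc a')) (gpow (Suc a')) \<and> peel a' \<cdot> g =
          peel_right 0 a'"
        by simp
      from someI_ex[OF this] show ?thesis
        unfolding 0 a gmult_ok_def gmult.simps(2) by (simp add: peel_right_def)
    next
      case b: (Suc b')
      have ok: "gmult_ok (Suc b') a'" "gmult_ok b' (Suc a')" "gmult_ok b' a'"
        by (rule IH, simp add: a b)+
      note [simp] = gmult_ok_type[OF ok(1)] gmult_ok_type[OF ok(2)] gmult_ok_type[OF ok(3)]
      let ?h = "Add C (peel_right (Suc b') a') (peel_left b' (Suc a'))"
      have "\<exists>g. g \<in> arrows C (Dom C ?h) (gpow (Suc (Suc (b' + a')))) \<and> peel (Suc (b' + a')) \<cdot> g =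
          ?h"
      proof (rule peel_lift)
        fix n assume "Suc (b' + a') = Suc n"
        then have n: "n = b' + a'" by simp
        have r: "tail (gpow n) \<cdot> rwhisker (peel n) X \<cdot> peel_right (Suc b') a' =
            tail (gpow (b' + a')) \<cdot> rwhisker (peel_left b' a') X \<cdot> peel_at (gpow (Suc b')) a'"
          unfolding n by (rule tail_peel_right) (auto intro: ok IH simp: a b)
        have l: "tail (gpow n) \<cdot> rwhisker (peel n) X \<cdot> peel_left b' (Suc a') =
            Scale C (s ^ Suc a') (tail (gpow (b' + a')) \<cdot> rwhisker (peel_right b' a') X \<cdot>
                swap_last (gpow b') X (gpow (Suc a')) \<cdot>
            rwhisker (peel b') (gpow (Suc a')))"
          unfolding n by (rule tail_peel_left) (auto intro: ok IH simp: a b)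
        \<comment> \<open>Of the four terms of the double peeling, \<open>r\<close> and
          \<open>l\<close> have discarded those with both factors from one argument; the two mixed
          ones cancel.\<close>
        have "tail (gpow n) \<cdot> rwhisker (peel n) X \<cdot> ?h =
            Add C (tail (gpow n) \<cdot> rwhisker (peel n) X \<cdot> peel_right (Suc b') a')
              (tail (gpow n) \<cdot> rwhisker (peel n) X \<cdot> peel_left b' (Suc a'))"
          by (simp add: n)
        also have "\<dots> = Zero C (Dom C ?h) (gpow n \<star> V)"
          unfolding r l using tail_peel_mixed_zero[of b' a'] by (simp add: n)
        finally show "tail (gpow n) \<cdot> rwhisker (peel n) X \<cdot> ?h = Zero C (Dom C ?h) (gpow n \<star> V)" .
      qed simp_all
      then have "\<exists>g. g \<in> arrows C (gpow (Suc b') \<star> gpow (Suc a')) (gpow (Suc (Suc (b' + a')))) \<and>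
          peel (Suc (b' + a')) \<cdot> g = ?h"
        by simp
      from someI_ex[OF this] show ?thesis
        unfolding a b gmult_ok_def gmult.simps(3) by (simp add: peel_right_def peel_left_def)
    qed
  qed
qed

lemmas gmult_type [simp] = gmult_ok_type[OF gmult_ok]

lemma peel_0_gmult: "peel a \<cdot> gmult 0 (Suc a) = peel_right 0 a"
  and peel_gmult: "peel (Suc (b + a)) \<cdot> gmult (Suc b) (Suc a) =
      Add C (peel_right (Suc b) a) (peel_left b (Suc a))"
  using gmult_ok[of 0 "Suc a"] gmult_ok[of "Suc b" "Suc a"]
  by (simp_all add: gmult_ok_def)

text \<open>Both halves of the derivation rule reproduce
  \<open>gmult b a \<cdot> comult b a\<close>; in \<open>peel_left_comult\<close> the sign of the
  product meets the equal sign of \<open>swap_comult\<close>.\<close>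

lemma peel_right_comult:
  "peel_right b a \<cdot> comult b (Suc a) = rwhisker (gmult b a \<cdot> comult b a) X \<cdot> peel (b + a)"
  by (simp add: peel_right_def peel_at_comult)

lemma peel_left_comult:
  "peel_left b a \<cdot> comult (Suc b) a = rwhisker (gmult b a \<cdot> comult b a) X \<cdot> peel (b + a)"
  by (simp add: peel_left_def swap_comult sign_power)

text \<open>The two terms of the derivation rule contribute the scalars of the two predecessors,
  which is Pascal's rule. The scalar is read off after peeling, \<open>peel\<close> being a
  monomorphism.\<close>

lemma gmult_comult: "gmult b a \<cdot> comult b a = Scale C (of_nat ((b + a) choose a))
    (Id C (gpow (b + a)))"
proof (induction b a rule: gmult.induct)
  case (1 b)
  show ?case by simp
next
  case (2 a)
  have "peel a \<cdot> gmult 0 (Suc a) \<cdot> comult 0 (Suc a) = (peel a \<cdot> gmult 0 (Suc a)) \<cdot>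
      comult 0 (Suc a)" by simp
  also have "\<dots> = peel a"
    unfolding peel_0_gmult peel_right_comult 2 by simp
  finally have "peel a \<cdot> gmult 0 (Suc a) \<cdot> comult 0 (Suc a) = peel a \<cdot> Id C (gpow (Suc a))" by simp
  then have "gmult 0 (Suc a) \<cdot> comult 0 (Suc a) = Id C (gpow (Suc a))"
    by (rule mono_cancel[OF mono_peel]) simp_all
  then show ?case by simp
next
  case (3 b a)
  let ?n = "Suc (b + a)"
  have "peel ?n \<cdot> gmult (Suc b) (Suc a) \<cdot> comult (Suc b) (Suc a) =
      (peel ?n \<cdot> gmult (Suc b) (Suc a)) \<cdot> comult (Suc b) (Suc a)" by simp
  also have "\<dots> = Add C (peel_right (Suc b) a \<cdot> comult (Suc b) (Suc a))
      (peel_left b (Suc a) \<cdot> comult (Suc b) (Suc a))"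
    unfolding peel_gmult by simp
  also have "\<dots> = Scale C (of_nat ((Suc b + Suc a) choose (Suc a))) (peel ?n)"
    unfolding peel_right_comult peel_left_comult 3 by (simp add: Add_Scale)
  finally have "peel ?n \<cdot> gmult (Suc b) (Suc a) \<cdot> comult (Suc b) (Suc a) =
      peel ?n \<cdot> Scale C (of_nat ((Suc b + Suc a) choose (Suc a))) (Id C (gpow (Suc b + Suc a)))"
          by simp
  then show ?case
    by (rule mono_cancel[OF mono_peel]) simp_all
qed

section \<open>Partial traces of the product followed by the coproduct\<close>

lemma comult_gmult_0: "comult 0 a \<cdot> gmult 0 a = Id C (gpow 0 \<star> gpow a)"
proof (induction a)
  case (Suc a)
  have "peel_at (gpow 0) a \<cdot> comult 0 (Suc a) \<cdot> gmult 0 (Suc a) =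
      rwhisker (comult 0 a) X \<cdot> peel a \<cdot> gmult 0 (Suc a)"
    using reassoc[OF peel_at_comult[of 0 a], of "gmult 0 (Suc a)"] by simp
  also have "\<dots> = rwhisker (comult 0 a \<cdot> gmult 0 a) X \<cdot> peel_at (gpow 0) a"
    unfolding peel_0_gmult by (simp add: peel_right_def)
  finally have "peel_at (gpow 0) a \<cdot> comult 0 (Suc a) \<cdot> gmult 0 (Suc a) =
      peel_at (gpow 0) a \<cdot> Id C (gpow 0 \<star> gpow (Suc a))"
    unfolding Suc by simp
  then show ?case
    by (rule mono_cancel[OF mono_peel_at, rotated]) simp_all
qed simp

fun loop :: "nat \<Rightarrow> nat \<Rightarrow> 'k" where
  "loop 0 a = cat_dim C (gpow a)"
| "loop (Suc b) 0 = 1"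
| "loop (Suc b) (Suc a) = loop b (Suc a) + s * loop (Suc b) a"

lemma ptrace_comult_gmult:
  "ptrace (gpow a) (gpow b) (gpow b) (comult b a \<cdot> gmult b a) = Scale C (loop b a) (Id C (gpow b))"
proof (induction b a rule: loop.induct)
  case (1 a)
  \<comment> \<open>For b = 0 product and coproduct are mutually inverse, so an identity runs
    through the loop.\<close>
  show ?case unfolding comult_gmult_0 using ptrace_Scale_Id[of "gpow 0" "gpow a" 1] by simp
next
  case (2 b)
  show ?case using ptrace_Scale_Id[of "gpow (Suc b)" "Unit C" 1] by (simp add: cat_dim_Unit)
next
  case (3 b a)
  let ?A = "gpow (Suc b)" and ?B = "gpow b" and ?P = "gpow a" and ?Q = "gpow (Suc a)"
  let ?T = "comult (Suc b) (Suc a) \<cdot> gmult (Suc b) (Suc a)"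
  let ?g = "comult b (Suc a) \<cdot> gmult (Suc b) a"
  let ?h = "comult b (Suc a) \<cdot> gmult b (Suc a)"
  \<comment> \<open>\<open>swap_comult\<close> solved for the detached factor, by undoing the
    crossing.\<close>
  have sw: "rwhisker (peel b) (gpow c) \<cdot> comult (Suc b) c =
      Scale C (s ^ c) (swap_last ?B (gpow c) X \<cdot> rwhisker (comult b c) X \<cdot> peel (b + c))" for c
  proof -
    have "swap_last ?B (gpow c) X \<cdot> swap_last ?B X (gpow c) \<cdot> rwhisker (peel b) (gpow c) \<cdot>
        comult (Suc b) c =
      Scale C (s ^ c) (swap_last ?B (gpow c) X \<cdot> rwhisker (comult b c) X \<cdot> peel (b + c))"
      unfolding swap_comult by simp
    then show ?thesis by simp
  qed
  have "rwhisker (peel b) ?Q \<cdot> ?T = Scale C (s ^ Suc a) (swap_last ?B ?Q X \<cdot>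
      rwhisker (comult b (Suc a)) X \<cdot> peel (Suc (b + a)) \<cdot> gmult (Suc b) (Suc a))"
    by (simp add: reassoc[OF sw])
  also have "\<dots> = Add C (Scale C (s ^ Suc a) (swap_last ?B ?Q X \<cdot> rwhisker ?g X \<cdot> peel_at ?A a))
      (swap_last ?B ?Q X \<cdot> rwhisker ?h X \<cdot> swap_last ?B X ?Q \<cdot> rwhisker (peel b) ?Q)"
    unfolding peel_gmult using sign_power[of "Suc a"] by
        (simp add: peel_right_def peel_left_def del: power_Suc)
  finally have T: "rwhisker (peel b) ?Q \<cdot> ?T =
      Add C (Scale C (s ^ Suc a) (swap_last ?B ?Q X \<cdot> rwhisker ?g X \<cdot> peel_at ?A a))
      ((swap_last ?B ?Q X \<cdot> rwhisker ?h X \<cdot> swap_last ?B X ?Q) \<cdot> rwhisker (peel b) ?Q)" by simp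
  \<comment> \<open>\<open>X\<close> comes from the loop: \<open>ptrace_slide\<close> carries
    \<open>peel a\<close> round it and leaves \<open>gpow a\<close> inside, and \<open>sw\<close>
    rewrites the result as \<open>peel b\<close> after the smaller trace.\<close>
  have 1: "ptrace ?Q ?A (?B \<star> X) (swap_last ?B ?Q X \<cdot> rwhisker ?g X \<cdot> peel_at ?A a) =
      Scale C (s ^ a * loop (Suc b) a) (peel b)"
  proof -
    have "swap_last ?B ?P X \<cdot> peel_at ?B a \<cdot> ?g =
        swap_last ?B ?P X \<cdot> rwhisker (comult b a) X \<cdot> peel (b + a) \<cdot> gmult (Suc b) a"
      by (simp add: reassoc[OF peel_at_comult])
    also have "\<dots> = Scale C (s ^ a * s ^ a) (swap_last ?B ?P X \<cdot> rwhisker (comult b a) X \<cdot>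
        peel (b + a) \<cdot> gmult (Suc b) a)"
      by (simp add: sign_power)
    also have "\<dots> = Scale C (s ^ a) (rwhisker (peel b) ?P \<cdot> comult (Suc b) a \<cdot> gmult (Suc b) a)"
      by (simp add: reassoc[OF sw])
    finally have e: "swap_last ?B ?P X \<cdot> peel_at ?B a \<cdot> ?g =
        Scale C (s ^ a) (rwhisker (peel b) ?P \<cdot> comult (Suc b) a \<cdot> gmult (Suc b) a)" .
    have "ptrace ?Q ?A (?B \<star> X) (swap_last ?B ?Q X \<cdot> rwhisker ?g X \<cdot> peel_at ?A a) =
        ptrace ?P ?A (?B \<star> X) (swap_last ?B ?P X \<cdot> peel_at ?B a \<cdot> ?g)"
      unfolding peel_at_def by (rule ptrace_slide) simp_all
    also have "\<dots> = Scale C (s ^ a) (peel b \<cdot> ptrace ?P ?A ?A (comult (Suc b) a \<cdot> gmult (Suc b) a))"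
      unfolding e using ptrace_left[of "comult (Suc b) a \<cdot> gmult (Suc b) a" ?A ?P ?A "peel b"
          "?B \<star> X"]
      by (simp add: ptrace_Scale)
    finally show ?thesis unfolding 3 by simp
  qed
  \<comment> \<open>\<open>X\<close> comes from the input and bypasses the loop; the trace with
    \<open>gpow b\<close> in place of \<open>gpow (Suc b)\<close> remains.\<close>
  have 2: "ptrace ?Q ?A (?B \<star> X) ((swap_last ?B ?Q X \<cdot> rwhisker ?h X \<cdot> swap_last ?B X ?Q) \<cdot>
      rwhisker (peel b) ?Q) =
      Scale C (loop b (Suc a)) (peel b)"
  proof -
    have "ptrace ?Q ?A (?B \<star> X) ((swap_last ?B ?Q X \<cdot> rwhisker ?h X \<cdot> swap_last ?B X ?Q) \<cdot>
        rwhisker (peel b) ?Q) =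
        ptrace ?Q (?B \<star> X) (?B \<star> X) (swap_last ?B ?Q X \<cdot> rwhisker ?h X \<cdot> swap_last ?B X ?Q) \<cdot>
            peel b"
      by (rule ptrace_right) simp_all
    also have "ptrace ?Q (?B \<star> X) (?B \<star> X) (swap_last ?B ?Q X \<cdot> rwhisker ?h X \<cdot> swap_last ?B X ?Q) =
        rwhisker (ptrace ?Q ?B ?B ?h) X"
      by (rule ptrace_whisker) simp_all
    finally show ?thesis unfolding 3 by simp
  qed
  have "peel b \<cdot> ptrace ?Q ?A ?A ?T = ptrace ?Q ?A (?B \<star> X) (rwhisker (peel b) ?Q \<cdot> ?T)"
    by (rule ptrace_left[symmetric]) simp_all
  also have "\<dots> = Add C (Scale C (s ^ Suc a * (s ^ a * loop (Suc b) a)) (peel b))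
      (Scale C (loop b (Suc a)) (peel b))"
    unfolding T by (subst ptrace_Add) (simp_all add: ptrace_Scale 1[simplified] 2[simplified])
  also have "\<dots> = peel b \<cdot> Scale C (loop (Suc b) (Suc a)) (Id C ?A)"
  proof -
    have "s ^ Suc a * (s ^ a * loop (Suc b) a) = s * (s ^ a * s ^ a) * loop (Suc b) a"
        by (simp add: mult_ac)
    also have "\<dots> = s * loop (Suc b) a" by (simp add: sign_power)
    finally have e: "s ^ Suc a * (s ^ a * loop (Suc b) a) = s * loop (Suc b) a" .
    show ?thesis unfolding e by (simp add: Add_Scale add.commute)
  qed
  finally show ?case
    by (rule mono_cancel[OF mono_peel]) simp_all
qed

theorem choose_dim_gpow:
  "of_nat ((b + a) choose a) * cat_dim C (gpow (b + a)) = loop b a * cat_dim C (gpow b)"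
  by (rule trace_split[of "gmult b a" "gpow b" "gpow a" "gpow (b + a)" "comult b a"])
    (simp_all add: gmult_comult ptrace_comult_gmult)


subsection \<open>Graded powers inside tensor powers\<close>

text \<open>
  \<open>check n i\<close> plays the role of \<open>u\<close> for the positions \<open>i\<close>, \<open>i + 1\<close> of the \<open>n\<close>-th tensor power;
  only the values for \<open>1 \<le> i < n\<close> matter.
\<close>

fun check :: "nat \<Rightarrow> nat \<Rightarrow> 'm" where
  "check (Suc (Suc (Suc n))) i =
    (if i = Suc (Suc n) then tail (tensor_power C X (Suc n)) else rwhisker (check (Suc (Suc n)) i)
        X)"
| "check n i = u"

text \<open>The index is one less than the degree: \<open>tensor_power\<close> in degree 1 is
  \<open>X\<close> and not \<open>Unit C \<star> X\<close>, so the recursion starts there.\<close>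

primrec inclusion :: "nat \<Rightarrow> 'm" where
  "inclusion 0 = Id C X"
| "inclusion (Suc n) = rwhisker (inclusion n) X \<cdot> peel (Suc n)"

lemma inclusion_type [simp]:
  "inclusion n \<in> Arr C" "Dom C (inclusion n) = gpow (Suc n)" "Cod C (inclusion n) =
      tensor_power C X (Suc n)"
proof -
  have "inclusion n \<in> Arr C \<and> Dom C (inclusion n) = gpow (Suc n) \<and> Cod C (inclusion n) =
      tensor_power C X (Suc n)"
    by (induction n) (simp_all add: gpow_1)
  then show "inclusion n \<in> Arr C" "Dom C (inclusion n) = gpow (Suc n)" "Cod C (inclusion n) =
      tensor_power C X (Suc n)"
    by simp_all
qed

lemma check_type [simp]:
  "i < Suc (Suc n) \<Longrightarrow> check (Suc (Suc n)) i \<in> Arr C \<and> Dom C (check (Suc (Suc n)) i) =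
      tensor_power C X (Suc (Suc n))"
  by (induction n) auto

lemma mono_inclusion: "mono_arrow C (inclusion n)"
proof (induction n)
  case 0
  show ?case by (simp add: mono_arrow_def)
next
  case (Suc n)
  note m = mono_rwhisker[OF Suc X_Obj]
  show ?case unfolding mono_arrow_def
  proof (intro conjI allI ballI impI)
    fix W x y assume x: "x \<in> arrows C W (Dom C (inclusion (Suc n)))"
        and y: "y \<in> arrows C W (Dom C (inclusion (Suc n)))"
      and eq: "inclusion (Suc n) \<cdot> x = inclusion (Suc n) \<cdot> y"
    have "rwhisker (inclusion n) X \<cdot> peel (Suc n) \<cdot> x = rwhisker (inclusion n) X \<cdot> peel (Suc n) \<cdot> y"
      using eq x y by simp
    then have "peel (Suc n) \<cdot> x = peel (Suc n) \<cdot> y"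
      by (rule mono_cancel[OF m]) (use x y in simp_all)
    then show "x = y"
      by (rule mono_cancel[OF mono_peel]) (use x y in simp_all)
  qed simp
qed

lemma tail_Unit: "tail (Unit C) \<cdot> rwhisker (lunit_inv X) X = lunit_inv V \<cdot> u"
proof -
  have "LUnit C (X \<star> X) \<cdot> Assoc C (Unit C) X X \<cdot> rwhisker (lunit_inv X) X = Id C (X \<star> X)"
    by (simp add: reassoc[OF lunit_tensor])
  then have "Assoc C (Unit C) X X \<cdot> rwhisker (lunit_inv X) X = lunit_inv (X \<star> X)"
    by - (rule cancel_iso_left[where f = "LUnit C (X \<star> X)" and h = "lunit_inv (X \<star> X)"], simp_all)
  then show ?thesis by (simp add: tail_def lunit_inv_natural)
qed

lemma tail_inclusion:
  "tail (tensor_power C X (Suc n)) \<cdot> rwhisker (inclusion (Suc n)) X =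
    rwhisker (inclusion n) V \<cdot> tail (gpow (Suc n)) \<cdot> rwhisker (peel (Suc n)) X"
  by (simp add: reassoc[OF tail_natural])

lemma check_inclusion:
  "i < Suc (Suc n) \<Longrightarrow> check (Suc (Suc n)) i \<cdot> inclusion (Suc n) =
    Zero C (gpow (Suc (Suc n))) (Cod C (check (Suc (Suc n)) i))"
proof (induction n)
  case 0
  have "LUnit C V \<cdot> (tail (Unit C) \<cdot> rwhisker (lunit_inv X) X) \<cdot> peel (Suc 0) = LUnit C V \<cdot>
      Zero C (gpow (Suc (Suc 0))) (Unit C \<star> V)"
    using tail_peel_zero[of 0] by (simp add: peel_0 gpow_1)
  then show ?case unfolding tail_Unit by (simp add: gpow_1)
next
  case (Suc n)
  show ?case
  proof (cases "i = Suc (Suc n)")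
    case True
    have "tail (tensor_power C X (Suc n)) \<cdot> inclusion (Suc (Suc n)) =
        (tail (tensor_power C X (Suc n)) \<cdot> rwhisker (inclusion (Suc n)) X) \<cdot> peel (Suc (Suc n))"
      by (simp del: inclusion.simps) (simp add: inclusion.simps(2)[of "Suc n"])
    also have "\<dots> = rwhisker (inclusion n) V \<cdot> tail (gpow (Suc n)) \<cdot> rwhisker (peel (Suc n)) X \<cdot>
        peel (Suc (Suc n))"
      unfolding tail_inclusion by simp
    finally show ?thesis using True by (simp add: tail_peel_zero del: inclusion.simps)
  next
    case False
    then have i: "i < Suc (Suc n)" using Suc.prems by simp
    note [simp] = check_type[OF i]
    have "check (Suc (Suc (Suc n))) i \<cdot> inclusion (Suc (Suc n)) =
        rwhisker (check (Suc (Suc n)) i \<cdot> inclusion (Suc n)) X \<cdot> peel (Suc (Suc n))"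
      using False by (simp del: inclusion.simps) (simp add: inclusion.simps(2)[of "Suc n"] del:
          inclusion.simps)
    then show ?thesis unfolding Suc.IH[OF i] using False by simp
  qed
qed

text \<open>All tests but the last act on the first factors only. Transposing the last
  \<open>X\<close> into the domain makes the induction hypothesis applicable to those, whence
  \<open>h\<close> is arbitrary; the last test then lifts along \<open>peel\<close>.\<close>

lemma inclusion_lift:
  assumes "h \<in> Arr C" "Cod C h = tensor_power C X (Suc (Suc n))"
    and "\<And>i. 1 \<le> i \<Longrightarrow> i < Suc (Suc n) \<Longrightarrow> check (Suc (Suc n)) i \<cdot> h =
        Zero C (Dom C h) (Cod C (check (Suc (Suc n)) i))"
  shows "\<exists>g. g \<in> arrows C (Dom C h) (gpow (Suc (Suc n))) \<and> inclusion (Suc n) \<cdot> g = h"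
  using assms
proof (induction n arbitrary: h)
  case 0
  have z: "u \<cdot> h = Zero C (Dom C h) V" using 0(3)[of 1] by simp
  have "(tail (gpow 0) \<cdot> rwhisker (peel 0) X) \<cdot> h = lunit_inv V \<cdot> u \<cdot> h"
    using 0(1,2) by (simp add: peel_0 tail_Unit[THEN reassoc])
  also have "\<dots> = Zero C (Dom C h) (Unit C \<star> V)" unfolding z using 0(1,2) by simp
  finally have "(tail (gpow 0) \<cdot> rwhisker (peel 0) X) \<cdot> h = Zero C (Dom C h) (Unit C \<star> V)" .
  then obtain g where "g \<in> Arr C" "Dom C g = Dom C h" "Cod C g = Dom C (peel (Suc 0))"
      "peel (Suc 0) \<cdot> g = h"
    by - (rule kernel_lift[OF peel_kernel[of 0], of h], use 0(1,2) in \<open>simp_all add: gpow_1\<close>)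
  then show ?case by (intro exI[of _ g]) (simp add: gpow_1)
next
  case (Suc n)
  let ?T = "tensor_power C X (Suc (Suc n))"
  let ?h = "transpose_left X ?T h"
  have [simp]: "h \<in> Arr C" "Cod C h = ?T \<star> X" using Suc.prems by simp_all
  have z: "check (Suc (Suc n)) i \<cdot> ?h = Zero C (Dom C ?h) (Cod C (check (Suc (Suc n)) i))"
      if i: "1 \<le> i" "i < Suc (Suc n)" for i
  proof -
    note [simp] = check_type[OF i(2)]
    have "rwhisker (check (Suc (Suc n)) i) X \<cdot> h =
        Zero C (Dom C h) (Cod C (check (Suc (Suc n)) i) \<star> X)"
      using Suc.prems(3)[of i] i by simp
    moreover have "check (Suc (Suc n)) i \<cdot> ?h =
        transpose_left X (Cod C (check (Suc (Suc n)) i)) (rwhisker (check (Suc (Suc n)) i) X \<cdot> h)"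
      by (rule transpose_left_Comp[symmetric]) simp_all
    ultimately show ?thesis by (simp add: transpose_left_def)
  qed
  obtain g where g: "g \<in> arrows C (Dom C ?h) (gpow (Suc (Suc n)))" "inclusion (Suc n) \<cdot> g = ?h"
    using Suc.IH[of ?h] z by (auto simp del: inclusion.simps)
  let ?g = "untranspose_left X (Dom C h) g"
  have [simp]: "?g \<in> Arr C" "Dom C ?g = Dom C h" "Cod C ?g = gpow (Suc (Suc n)) \<star> X"
    using g(1) by simp_all
  have "rwhisker (inclusion (Suc n)) X \<cdot> ?g = untranspose_left X (Dom C h) (inclusion (Suc n) \<cdot> g)"
    by (rule untranspose_left_Comp[symmetric]) (use g(1) in simp_all)
  also have "\<dots> = h" unfolding g(2) by (rule untranspose_transpose_left) simp_all
  finally have h: "rwhisker (inclusion (Suc n)) X \<cdot> ?g = h" .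
  have "rwhisker (inclusion n) V \<cdot> tail (gpow (Suc n)) \<cdot> rwhisker (peel (Suc n)) X \<cdot> ?g =
      (rwhisker (inclusion n) V \<cdot> tail (gpow (Suc n)) \<cdot> rwhisker (peel (Suc n)) X) \<cdot> ?g" by simp
  also have "\<dots> = tail (tensor_power C X (Suc n)) \<cdot> rwhisker (inclusion (Suc n)) X \<cdot> ?g"
    unfolding tail_inclusion[symmetric] by (simp del: inclusion.simps)
  also have "\<dots> = Zero C (Dom C h) (tensor_power C X (Suc n) \<star> V)"
    unfolding h using Suc.prems(3)[of "Suc (Suc n)"] by simp
  also have "\<dots> = rwhisker (inclusion n) V \<cdot> Zero C (Dom C h) (gpow (Suc n) \<star> V)" by simp
  finally have "tail (gpow (Suc n)) \<cdot> rwhisker (peel (Suc n)) X \<cdot> ?g =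
      Zero C (Dom C h) (gpow (Suc n) \<star> V)"
    by (rule mono_cancel[OF mono_rwhisker[OF mono_inclusion V_Obj]]) simp_all
  then obtain g' where g': "g' \<in> Arr C" "Dom C g' = Dom C ?g" "Cod C g' =
      Dom C (peel (Suc (Suc n)))" "peel (Suc (Suc n)) \<cdot> g' = ?g"
    by - (rule kernel_lift[OF peel_kernel[of "Suc n"], of ?g], simp_all)
  have "inclusion (Suc (Suc n)) \<cdot> g' = rwhisker (inclusion (Suc n)) X \<cdot> (peel (Suc (Suc n)) \<cdot> g')"
    unfolding inclusion.simps(2)[of "Suc n"] using g'(1-3) by (simp del: inclusion.simps)
  then show ?case unfolding g'(4) h using g'(1-3) by (intro exI[of _ g']) simp
qed

text \<open>\<open>K\<close> is any family of subobjects cut out by the tests, so that kernels and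
  images are both covered. Intersections factor through each other, hence have isomorphic domains,
  and the dimension does not depend on the chosen representative.\<close>

lemma intersection_inclusion:
  assumes K: "\<And>i h. 1 \<le> i \<Longrightarrow> i < Suc (Suc n) \<Longrightarrow> h \<in> Arr C \<Longrightarrow> Cod C h = tensor_power C X (Suc (Suc n)) \<Longrightarrow>
    factors_through C h (K i) \<longleftrightarrow> check (Suc (Suc n)) i \<cdot> h =
        Zero C (Dom C h) (Cod C (check (Suc (Suc n)) i))"
  shows "is_intersection C (tensor_power C X (Suc (Suc n))) (K ` {1..<Suc (Suc n)})
      (inclusion (Suc n))"
    and "is_intersection C (tensor_power C X (Suc (Suc n))) (K ` {1..<Suc (Suc n)}) m \<Longrightarrow>
      cat_dim C (Dom C m) = cat_dim C (gpow (Suc (Suc n)))"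
proof -
  have e: "inclusion (Suc n) \<in> Arr C" "Cod C (inclusion (Suc n)) = tensor_power C X (Suc (Suc n))"
    using inclusion_type[of "Suc n"] by blast+
  have low: "\<forall>k\<in>K ` {1..<Suc (Suc n)}. factors_through C (inclusion (Suc n)) k"
  proof (intro ballI)
    fix k assume "k \<in> K ` {1..<Suc (Suc n)}"
    then obtain i where i: "1 \<le> i" "i < Suc (Suc n)" and k: "k = K i" by auto
    show "factors_through C (inclusion (Suc n)) k"
      unfolding k K[OF i e] inclusion_type(2) by (rule check_inclusion[OF i(2)])
  qed
  have lift: "factors_through C h (inclusion (Suc n))"
    if h: "h \<in> Arr C" "Cod C h = tensor_power C X (Suc (Suc n))"
        "\<forall>k\<in>K ` {1..<Suc (Suc n)}. factors_through C h k" for h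
  proof -
    have "\<exists>g. g \<in> arrows C (Dom C h) (gpow (Suc (Suc n))) \<and> inclusion (Suc n) \<cdot> g = h"
      by (rule inclusion_lift[OF h(1,2)]) (use h(3) K[OF _ _ h(1,2)] in force)
    then show ?thesis unfolding factors_through_def inclusion_type(2) by blast
  qed
  show "is_intersection C (tensor_power C X (Suc (Suc n))) (K ` {1..<Suc (Suc n)})
      (inclusion (Suc n))"
    unfolding is_intersection_def
  proof (intro conjI allI impI)
    fix m' assume "mono_arrow C m' \<and> Cod C m' = tensor_power C X (Suc (Suc n)) \<and>
      (\<forall>k\<in>K ` {1..<Suc (Suc n)}. factors_through C m' k)"
    then show "factors_through C m' (inclusion (Suc n))"
      by (intro lift) (auto simp: mono_arrow_def)
  qed (use mono_inclusion[of "Suc n"] e(2) low in \<open>simp_all del: inclusion.simps\<close>)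
  assume m: "is_intersection C (tensor_power C X (Suc (Suc n))) (K ` {1..<Suc (Suc n)}) m"
  have m1: "mono_arrow C m" and m2: "Cod C m = tensor_power C X (Suc (Suc n))"
    and m3: "\<forall>k\<in>K ` {1..<Suc (Suc n)}. factors_through C m k"
    using m unfolding is_intersection_def by blast+
  have "m \<in> Arr C" using m1 unfolding mono_arrow_def by blast
  note mm = m1 this m2
  obtain f where f: "f \<in> Arr C" "Dom C f = Dom C m" "Cod C f = gpow (Suc (Suc n))"
      "inclusion (Suc n) \<cdot> f = m"
  proof -
    have "factors_through C m (inclusion (Suc n))"
      by (rule lift[OF mm(2,3)]) (rule m3)
    then show thesis using that unfolding factors_through_def inclusion_type(2) Bex_def arrows_iff
        by blast
  qed
  have "factors_through C (inclusion (Suc n)) m"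
    using m mono_inclusion[of "Suc n"] e low unfolding is_intersection_def by blast
  then obtain g where g: "g \<in> Arr C" "Dom C g = gpow (Suc (Suc n))" "Cod C g = Dom C m" "m \<cdot> g =
      inclusion (Suc n)"
    unfolding factors_through_def inclusion_type(2) Bex_def arrows_iff by blast
  have "m \<cdot> g \<cdot> f = (m \<cdot> g) \<cdot> f" using f(1-3) g(1-3) mm by simp
  also have "\<dots> = m \<cdot> Id C (Dom C m)" unfolding g(4) f(4) using mm by simp
  finally have gf: "g \<cdot> f = Id C (Dom C m)"
    by (rule mono_cancel[OF mm(1)]) (use f g mm in auto)
  have "inclusion (Suc n) \<cdot> f \<cdot> g = (inclusion (Suc n) \<cdot> f) \<cdot> g"
      using f(1-3) g(1-3) by (simp del: inclusion.simps)
  also have "\<dots> = inclusion (Suc n) \<cdot> Id C (gpow (Suc (Suc n)))"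
      unfolding g(4) f(4) by (simp del: inclusion.simps)
  finally have fg: "f \<cdot> g = Id C (gpow (Suc (Suc n)))"
    by (rule mono_cancel[OF mono_inclusion]) (use f g in auto)
  show "cat_dim C (Dom C m) = cat_dim C (gpow (Suc (Suc n)))"
    by (rule cat_dim_iso[of f _ _ g]) (use f g fg gf mm in auto)
qed

end

section \<open>Sequences of binomial type\<close>

text \<open>The trace relations in abstract form, with \<open>loop\<close> in the role of
  \<open>c\<close>. For s = - 1 the model is \<open>d n\<close> = (T choose n) with
  \<open>c b a\<close> = (T - b choose a), and the recurrence is Pascal's rule.\<close>

definition binomial_type :: "'k::field \<Rightarrow> (nat \<Rightarrow> 'k) \<Rightarrow> bool" where
  "binomial_type s d \<longleftrightarrow> (\<exists>c. (\<forall>a. c 0 a = d a) \<and> (\<forall>b. c b 0 = 1) \<and>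
    (\<forall>b a. c (Suc b) (Suc a) = c b (Suc a) + s * c (Suc b) a) \<and>
    (\<forall>b a. of_nat ((b + a) choose a) * d (b + a) = c b a * d b))"

text \<open>The substitution of - s z for z in the generating series; it reduces symmetric powers to
  the case s = - 1.\<close>

lemma binomial_type_signed:
  assumes "binomial_type s d" "s * s = 1"
  shows "binomial_type (- 1) (\<lambda>n. (- s) ^ n * d n)"
proof -
  obtain c where c: "\<And>a. c 0 a = d a" "\<And>b. c b 0 = 1"
    "\<And>b a. c (Suc b) (Suc a) = c b (Suc a) + s * c (Suc b) a"
    "\<And>b a. of_nat ((b + a) choose a) * d (b + a) = c b a * d b"
    using assms(1) unfolding binomial_type_def by blast
  show ?thesis unfolding binomial_type_def
  proof (intro exI[of _ "\<lambda>b a. (- s) ^ a * c b a"] conjI allI)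
    fix b a
    have "(- s) ^ Suc a * (s * c (Suc b) a) = (- s) ^ a * (- (s * s) * c (Suc b) a)"
        by (simp add: algebra_simps)
    then show "(- s) ^ Suc a * c (Suc b) (Suc a) =
        (- s) ^ Suc a * c b (Suc a) + - 1 * ((- s) ^ a * c (Suc b) a)"
      unfolding c(3) distrib_left assms(2) by simp
    have "of_nat ((b + a) choose a) * ((- s) ^ (b + a) * d (b + a)) =
        (- s) ^ (b + a) * (of_nat ((b + a) choose a) * d (b + a))" by simp
    also have "\<dots> = (- s) ^ a * c b a * ((- s) ^ b * d b)"
      unfolding c(4) by (simp add: power_add mult_ac)
    finally show "of_nat ((b + a) choose a) * ((- s) ^ (b + a) * d (b + a)) =
        (- s) ^ a * c b a * ((- s) ^ b * d b)" .
  qed (simp_all add: c)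
qed

lemma fps_nth_one_plus_X_power: "fps_nth ((1 + fps_X) ^ m :: 'k::field fps) n = of_nat (m choose n)"
proof -
  have "(1 + fps_X :: 'k fps) ^ m = (\<Sum>k\<le>m. of_nat (m choose k) * fps_X ^ k)"
    by (subst add.commute) (simp add: binomial_ring)
  then have "fps_nth ((1 + fps_X :: 'k fps) ^ m) n =
      (\<Sum>k\<le>m. of_nat (m choose k) * (if n = k then 1 else 0))"
    by (simp add: fps_sum_nth fps_mult_of_nat_nth fps_X_power_nth flip: fps_of_nat)
  also have "\<dots> = (\<Sum>k\<le>m. if n = k then of_nat (m choose k) else 0)"
    by (rule sum.cong) simp_all
  also have "\<dots> = of_nat (m choose n)" by (simp add: binomial_eq_0)
  finally show ?thesis .
qed

text \<open>Since T - b may be negative, \<open>c b a\<close> is taken as a coefficient of the power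
  series (1 + X)^(T - b); the recurrence is multiplication by 1 + X.\<close>

lemma binomial_type_choose: "binomial_type (- 1) (\<lambda>n. of_nat (T choose n) :: 'k::field)"
proof -
  let ?f = "1 + fps_X :: 'k fps"
  let ?c = "\<lambda>b a. fps_nth (?f ^ T * inverse ?f ^ b) a"
  have inv: "inverse ?f * ?f = 1" by (rule inverse_mult_eq_1) simp
  have step: "?f ^ T * inverse ?f ^ Suc b * ?f = ?f ^ T * inverse ?f ^ b" for b
  proof -
    have "?f ^ T * inverse ?f ^ Suc b * ?f = ?f ^ T * inverse ?f ^ b * (inverse ?f * ?f)"
        by (simp only: power_Suc mult_ac)
    then show ?thesis unfolding inv by simp
  qed
  show ?thesis unfolding binomial_type_def
  proof (intro exI[of _ ?c] conjI allI)
    fix b a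
    show "?c b 0 = 1" by (simp add: fps_nth_power_0)
    have "?c b (Suc a) = fps_nth (?f ^ T * inverse ?f ^ Suc b * ?f) (Suc a)" unfolding step ..
    also have "\<dots> = ?c (Suc b) (Suc a) + ?c (Suc b) a"
      by (simp only: distrib_left mult_1_right fps_add_nth) simp
    finally show "?c (Suc b) (Suc a) = ?c b (Suc a) + - 1 * ?c (Suc b) a" by simp
    show "?c 0 a = of_nat (T choose a)" by (simp add: fps_nth_one_plus_X_power)
    show "of_nat ((b + a) choose a) * of_nat (T choose (b + a)) = ?c b a * of_nat (T choose b)"
    proof (cases "b \<le> T")
      case True
      have "?f ^ T * inverse ?f ^ b = ?f ^ (T - b) * (inverse ?f * ?f) ^ b"
        using True by (simp add: power_mult_distrib mult_ac flip: power_add)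
      then have c: "?c b a = of_nat ((T - b) choose a)"
          unfolding inv by (simp add: fps_nth_one_plus_X_power)
      have "((b + a) choose a) * (T choose (b + a)) = (T choose b) * ((T - b) choose a)"
      proof (cases "b + a \<le> T")
        case True
        then show ?thesis using choose_mult[of b "b + a" T] binomial_symmetric[of b "b + a"] by
            (simp add: mult.commute)
      next
        case False
        then show ?thesis using \<open>b \<le> T\<close> by (simp add: binomial_eq_0)
      qed
      then show ?thesis unfolding c by (metis mult.commute of_nat_mult)
    qed (simp add: binomial_eq_0)
  qed
qed

text \<open>For a = 1 the relation reads (b + 1) * d (b + 1) = (d 1 + b) * d b. At b = p - 1 its
  left side is 0 although d 0 = 1, so one of the factors d 1 + b with b < p must vanish.\<close>

lemma binomial_type_prime_field:
  fixes d :: "nat \<Rightarrow> 'k::field"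
  assumes "binomial_type 1 d" "CHAR('k) > 0"
  obtains b where "d 1 = of_nat b"
proof -
  define p where "p = CHAR('k)"
  obtain c where c: "\<And>a. c 0 a = d a" "\<And>b. c b 0 = 1"
    "\<And>b a. c (Suc b) (Suc a) = c b (Suc a) + c (Suc b) a"
    "\<And>b a. of_nat ((b + a) choose a) * d (b + a) = c b a * d b"
    using assms(1) unfolding binomial_type_def by auto
  have c1: "c b 1 = d 1 + of_nat b" for b
    by (induction b) (simp_all add: c(1) c(2) c(3)[of _ 0, simplified])
  have rel: "of_nat (Suc b) * d (Suc b) = (d 1 + of_nat b) * d b" for b
    using c(4)[of b 1] c1 by simp
  have "\<exists>b<p. d 1 + of_nat b = 0"
  proof (rule ccontr)
    assume *: "\<not> (\<exists>b<p. d 1 + of_nat b = 0)"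
    have nz: "d b \<noteq> 0" if "b < p" for b
      using that
    proof (induction b)
      case 0
      show ?case using c(1)[of 0] c(2)[of 0] by simp
    next
      case (Suc b)
      then have "(d 1 + of_nat b) * d b \<noteq> 0" using * by auto
      then show ?case using rel[of b] by auto
    qed
    have p: "p = Suc (p - 1)" using assms(2) by (simp add: p_def)
    have "(d 1 + of_nat (p - 1)) * d (p - 1) = of_nat p * d p" using rel[of "p - 1"] p by (metis)
    also have "\<dots> = 0" by (simp add: p_def)
    finally have "d 1 + of_nat (p - 1) = 0 \<or> d (p - 1) = 0" by (simp only: mult_eq_0_iff)
    moreover have "p - 1 < p" using assms(2) by (simp add: p_def)
    ultimately show False using * nz[of "p - 1"] by blast
  qed
  then obtain b where b: "b < p" "d 1 + of_nat b = 0" by blast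
  have "d 1 = - of_nat b" using b(2) by (simp add: eq_neg_iff_add_eq_0)
  also have "\<dots> = of_nat (p - b)" using b(1) by (simp add: of_nat_diff p_def)
  finally show thesis by (rule that)
qed

section \<open>Binomial coefficients modulo p and p-adic exponents\<close>

locale prime_char =
  fixes p :: nat and type_itself :: "'k::field itself"
  assumes p_CHAR: "p = CHAR('k)" and p_pos: "p > 0"
begin

lemma prime_p: "prime p"
  unfolding p_CHAR by (rule prime_CHAR_semidom) (use p_pos p_CHAR in simp)

lemma p_ge_2: "p \<ge> 2"
  using prime_p by (rule prime_ge_2_nat)

lemma frobenius: "(1 + fps_X :: 'k fps) ^ (p ^ j) = 1 + fps_X ^ (p ^ j)"
proof -
  have "CHAR('k fps) = p" by (simp add: p_CHAR)
  then show ?thesis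
    using freshmans_dream'[of "p ^ j" j "1 :: 'k fps" fps_X] prime_p by simp
qed

text \<open>By Frobenius (1 + X)^(p^J * q) is 1 modulo X^(p^J); digits of the exponent from position
  J on are invisible in lower degrees.\<close>

lemma choose_add_power_mult:
  assumes "n < p ^ J"
  shows "(of_nat ((T + p ^ J * q) choose n) :: 'k) = of_nat (T choose n)"
proof -
  obtain g where g: "(1 + fps_X ^ (p ^ J) :: 'k fps) ^ q = 1 + fps_X ^ (p ^ J) * g"
  proof -
    have "fps_X ^ (p ^ J) dvd (1 + fps_X ^ (p ^ J) :: 'k fps) ^ q - 1"
      using dvd_triv_left[of "1 + fps_X ^ (p ^ J) - 1 :: 'k fps"] by (simp add: power_diff_1_eq)
    then obtain g where "(1 + fps_X ^ (p ^ J) :: 'k fps) ^ q - 1 = fps_X ^ (p ^ J) * g"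
        by (rule dvdE)
    then show thesis by (intro that[of g]) (simp add: algebra_simps)
  qed
  have "(1 + fps_X :: 'k fps) ^ (T + p ^ J * q) =
      (1 + fps_X) ^ T + fps_X ^ (p ^ J) * ((1 + fps_X) ^ T * g)"
    unfolding power_add power_mult frobenius g by (simp add: algebra_simps)
  then have "fps_nth ((1 + fps_X :: 'k fps) ^ (T + p ^ J * q)) n = fps_nth ((1 + fps_X) ^ T) n"
    using assms by (simp add: fps_X_power_mult_nth)
  then show ?thesis by (simp add: fps_nth_one_plus_X_power)
qed

text \<open>A case of Lucas' theorem: modulo X^(2 * p^j) the factor (1 + X)^(p^j * q) is 1 + q
  X^(p^j), while (1 + X)^T has degree below p^j.\<close>

lemma choose_prime_power:
  assumes "T < p ^ j"
  shows "(of_nat ((T + p ^ j * q) choose (p ^ j)) :: 'k) = of_nat q"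
proof -
  have pj: "p ^ j > 0" using p_pos by simp
  obtain g where g: "(1 + fps_X ^ (p ^ j) :: 'k fps) ^ q =
      1 + of_nat q * fps_X ^ (p ^ j) + fps_X ^ (p ^ j + p ^ j) * g"
  proof (induction q arbitrary: thesis)
    case 0
    show ?case by (rule 0[of 0]) simp
  next
    case (Suc q)
    obtain g where g: "(1 + fps_X ^ (p ^ j) :: 'k fps) ^ q =
        1 + of_nat q * fps_X ^ (p ^ j) + fps_X ^ (p ^ j + p ^ j) * g"
      by (rule Suc.IH)
    show ?case
      by (rule Suc.prems[of "g + of_nat q + fps_X ^ (p ^ j) * g"])
        (simp add: g power_add algebra_simps)
  qed
  have "(1 + fps_X :: 'k fps) ^ (T + p ^ j * q) =
      (1 + fps_X) ^ T + fps_X ^ (p ^ j) * (of_nat q * (1 + fps_X) ^ T) + fps_X ^ (p ^ j + p ^ j) *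
          ((1 + fps_X) ^ T * g)"
    unfolding power_add power_mult frobenius g by (simp add: algebra_simps)
  then have "fps_nth ((1 + fps_X :: 'k fps) ^ (T + p ^ j * q)) (p ^ j) =
      of_nat (T choose (p ^ j)) + fps_nth (of_nat q * (1 + fps_X) ^ T) 0"
    using pj by (simp add: fps_X_power_mult_nth fps_nth_one_plus_X_power)
  then show ?thesis using assms by (simp add: fps_nth_one_plus_X_power binomial_eq_0
      fps_nth_power_0)
qed

text \<open>By Frobenius the product of the first J factors is (1 + X)^(d J), and later digits do
  not affect coefficients below p^J.\<close>

lemma one_plus_power_nth:
  assumes d: "d \<in> carrier (padic_ring p)" and n: "n < p ^ J"
  shows "fps_nth (one_plus_power p d :: 'k fps) n = of_nat (nat (d J) choose n)"
proof -
  let ?P = "\<lambda>N. \<Prod>j<N. (1 + fps_X ^ (p ^ j)) ^ padic_digit p d j :: 'k fps"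
  let ?T = "\<lambda>N. \<Sum>j<N. padic_digit p d j * p ^ j"
  have T: "nat (d N) = ?T N" for N
  proof -
    have "nat (d N) = nat (\<Sum>j<N. int (padic_digit p d j) * int p ^ j)"
      by (rule arg_cong[OF padic_digit_expansion[OF p_pos d]])
    then show ?thesis by (simp flip: of_nat_mult of_nat_power of_nat_sum)
  qed
  have P: "?P N = (1 + fps_X) ^ ?T N" for N
    by (induction N) (simp_all add: power_add frobenius[symmetric] power_mult[symmetric]
        mult.commute)
  have "\<exists>q. ?T (J + N) = ?T J + p ^ J * q" for N
  proof (induction N)
    case 0
    show ?case by (rule exI[of _ 0]) simp
  next
    case (Suc N)
    then obtain q where "?T (J + N) = ?T J + p ^ J * q" ..
    then have "?T (J + Suc N) = ?T J + p ^ J * (q + padic_digit p d (J + N) * p ^ N)"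
      by (simp add: power_add algebra_simps)
    then show ?case ..
  qed
  note T_add = this
  have stable: "fps_nth (?P N) n = of_nat (?T J choose n)" if "N \<ge> J" for N
  proof -
    obtain M where "N = J + M" using \<open>N \<ge> J\<close> le_Suc_ex by blast
    then obtain q where q: "?T N = ?T J + p ^ J * q" using T_add[of M] by auto
    show ?thesis unfolding P fps_nth_one_plus_X_power q by (rule choose_add_power_mult[OF n])
  qed
  have "?P \<longlonglongrightarrow> one_plus_power p d"
    using one_plus_power_has_prod[OF p_ge_2, of d, where 'k = 'k] by (rule has_prod_imp_tendsto')
  then have "eventually (\<lambda>N. fps_nth (?P N) n = fps_nth (one_plus_power p d :: 'k fps) n)
      sequentially"
    unfolding tendsto_fps_iff by blast
  then obtain M where "\<And>N. N \<ge> M \<Longrightarrow> fps_nth (?P N) n = fps_nth (one_plus_power p d :: 'k fps) n"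
    unfolding eventually_sequentially by blast
  from this[of "max M J"] stable[of "max M J"] show ?thesis unfolding T by simp
qed

text \<open>The bound \<open>N\<close> allows a comparison with (T choose n) for a natural number T
  that matches only finitely many digits.\<close>

lemma binomial_type_unique:
  fixes t t' :: "nat \<Rightarrow> 'k"
  assumes "binomial_type (- 1) t" "binomial_type (- 1) t'"
    and eq: "\<And>j. p ^ j \<le> N \<Longrightarrow> t (p ^ j) = t' (p ^ j)"
  shows "n \<le> N \<Longrightarrow> t n = t' n"
proof (induction n rule: less_induct)
  case (less n)
  obtain c where c: "\<And>a. c 0 a = t a" "\<And>b. c b 0 = 1"
    "\<And>b a. c (Suc b) (Suc a) = c b (Suc a) - c (Suc b) a"
    "\<And>b a. of_nat ((b + a) choose a) * t (b + a) = c b a * t b"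
    using assms(1) unfolding binomial_type_def by auto
  obtain c' where c': "\<And>a. c' 0 a = t' a" "\<And>b. c' b 0 = 1"
    "\<And>b a. c' (Suc b) (Suc a) = c' b (Suc a) - c' (Suc b) a"
    "\<And>b a. of_nat ((b + a) choose a) * t' (b + a) = c' b a * t' b"
    using assms(2) unfolding binomial_type_def by auto
  \<comment> \<open>\<open>c b a\<close> depends only on the values of \<open>t\<close> in degrees
    up to \<open>a\<close>, where the sequences agree by induction.\<close>
  have cc: "c b a = c' b a" if "a < n" for b a
    using that
  proof (induction a arbitrary: b)
    case (Suc a)
    then have lt: "a < n" "Suc a < n" by simp_all
    note IH = Suc.IH[OF lt(1)]
    show ?case
    proof (induction b)
      case 0
      show ?case using less.IH[OF lt(2)] less.prems lt by (simp add: c(1) c'(1))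
    next
      case (Suc b)
      show ?case unfolding c(3) c'(3) Suc IH ..
    qed
  qed (simp add: c(2) c'(2))
  show ?case
  proof (cases "n = 0")
    case True
    then show ?thesis using c(1)[of 0] c(2)[of 0] c'(1)[of 0] c'(2)[of 0] by simp
  next
    case False
    then obtain j where j: "p ^ j \<le> n" "n < p ^ Suc j"
      using ex_power_ivl1[OF p_ge_2, of n] by auto
    show ?thesis
    proof (cases "n = p ^ j")
      case True
      then show ?thesis using eq less.prems by auto
    next
      case False
      let ?b = "n - p ^ j"
      have b: "?b + p ^ j = n" "p ^ j < n" "?b < n" using j False p_pos by auto
      \<comment> \<open>n div p^j is the leading base p digit of n, so it lies between 1 and p - 1;
        by \<open>choose_prime_power\<close> it is the coefficient to be cancelled.\<close>
      have q: "n = n mod p ^ j + p ^ j * (n div p ^ j)" by simp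
      have "n mod p ^ j < p ^ j" using p_pos by simp
      from choose_prime_power[OF this, of "n div p ^ j"]
      have ch: "(of_nat (n choose (p ^ j)) :: 'k) = of_nat (n div p ^ j)" by simp
      have "0 < n div p ^ j" "n div p ^ j < p"
        using j p_pos by (auto simp: div_greater_zero_iff less_mult_imp_div_less)
      then have "\<not> p dvd n div p ^ j" by (meson nat_dvd_not_less)
      then have nz: "(of_nat (n choose (p ^ j)) :: 'k) \<noteq> 0"
        unfolding ch by (simp add: of_nat_eq_0_iff_char_dvd p_CHAR)
      have "of_nat (n choose (p ^ j)) * t n = of_nat (n choose (p ^ j)) * t' n"
        using c(4)[of ?b "p ^ j"] c'(4)[of ?b "p ^ j"] cc[OF b(2), of ?b] less.IH[OF b(3)]
            less.prems b by simp
      then show ?thesis using nz by simp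
    qed
  qed
qed

theorem binomial_type_one_plus_power:
  fixes t :: "nat \<Rightarrow> 'k"
  assumes t: "binomial_type (- 1) t" and "\<And>n. \<exists>b. t n = of_nat b"
  shows "\<exists>!d. d \<in> carrier (padic_ring p) \<and> Abs_fps t = one_plus_power p d"
proof (rule ex_ex1I)
  \<comment> \<open>The value in degree p^j, reduced modulo p, is going to be the j-th
    digit.\<close>
  have "\<exists>e. t (p ^ j) = of_nat e \<and> e < p" for j
  proof -
    obtain b where "t (p ^ j) = of_nat b" using assms(2) by blast
    then have "t (p ^ j) = of_nat (b mod p)"
      by (simp add: of_nat_eq_iff_cong_CHAR p_CHAR cong_def)
    then show ?thesis using p_pos by (intro exI[of _ "b mod p"]) simp
  qed
  then obtain e where e: "\<And>j. t (p ^ j) = of_nat (e j)" "\<And>j. e j < p" by metis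
  define T where "T n = (\<Sum>j<n. e j * p ^ j)" for n
  have T_less: "T n < p ^ n" for n
  proof (induction n)
    case (Suc n)
    have "T (Suc n) < p ^ n + e n * p ^ n" using Suc by (simp add: T_def)
    also have "\<dots> = Suc (e n) * p ^ n" by simp
    also have "\<dots> \<le> p * p ^ n" using e(2)[of n] by (intro mult_right_mono) auto
    finally show ?case by simp
  qed (simp add: T_def)
  let ?d = "\<lambda>n. int (T n)"
  have "?d (Suc n) mod int p ^ n = ?d n" for n
  proof -
    have "T (Suc n) mod p ^ n = T n" using T_less[of n] by (simp add: T_def)
    then show ?thesis by (metis of_nat_mod of_nat_power)
  qed
  then have d: "?d \<in> carrier (padic_ring p)"
    using T_less by (auto simp: padic_ring_def simp flip: of_nat_power)
  have T_add: "\<exists>q. T (J + N) = T J + p ^ J * q" for J N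
  proof (induction N)
    case 0
    show ?case by (rule exI[of _ 0]) simp
  next
    case (Suc N)
    then obtain q where "T (J + N) = T J + p ^ J * q" ..
    then have "T (J + Suc N) = T J + p ^ J * (q + e (J + N) * p ^ N)"
      by (simp add: T_def power_add algebra_simps)
    then show ?case ..
  qed
  \<comment> \<open>\<open>T (Suc n)\<close> contains every digit that matters up to degree n,
    because p^j <= n forces j < Suc n.\<close>
  have "t n = of_nat (T (Suc n) choose n)" for n
  proof (rule binomial_type_unique[OF t binomial_type_choose])
    fix j assume "p ^ j \<le> n"
    moreover have "j < p ^ j" using p_ge_2 by (simp add: power_gt_expt)
    ultimately have "Suc j \<le> Suc n" by simp
    then obtain M where M: "Suc n = Suc j + M" using le_Suc_ex by blast
    obtain q where q: "T (Suc n) = T (Suc j) + p ^ Suc j * q" using T_add[of "Suc j" M] M by auto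
    have "(of_nat (T (Suc n) choose (p ^ j)) :: 'k) = of_nat (T (Suc j) choose (p ^ j))"
      unfolding q by (rule choose_add_power_mult) (use p_ge_2 in simp)
    also have "T (Suc j) = T j + p ^ j * e j" by (simp add: T_def)
    finally show "t (p ^ j) = of_nat (T (Suc n) choose (p ^ j))"
      using choose_prime_power[OF T_less, of j "e j"] by (simp add: e(1))
  qed simp
  note t_eq = this
  have "Abs_fps t = one_plus_power p ?d"
  proof (rule fps_ext)
    fix n
    have "n < p ^ Suc n" using power_gt_expt[of p "Suc n"] p_ge_2 by simp
    from one_plus_power_nth[OF d this]
    show "fps_nth (Abs_fps t) n = fps_nth (one_plus_power p ?d) n" by (simp add: t_eq)
  qed
  then show "\<exists>d. d \<in> carrier (padic_ring p) \<and> Abs_fps t = one_plus_power p d" using d by blast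
next
  fix d d' assume "d \<in> carrier (padic_ring p) \<and> Abs_fps t = one_plus_power p d"
    "d' \<in> carrier (padic_ring p) \<and> Abs_fps t = one_plus_power p d'"
  then have d: "d \<in> carrier (padic_ring p)" "d' \<in> carrier (padic_ring p)"
    and eq: "one_plus_power p d = (one_plus_power p d' :: 'k fps)" by auto
  \<comment> \<open>Uniqueness: the coefficient in degree p^j is the residue of the j-th digit, and
    a digit is determined by its residue.\<close>
  have dig: "fps_nth (one_plus_power p d :: 'k fps) (p ^ j) = of_nat (padic_digit p d j)"
    if d: "d \<in> carrier (padic_ring p)" for d j
  proof -
    have "p ^ j < p ^ Suc j" using p_ge_2 by simp
    have "0 \<le> d j" "d j < int p ^ j" using d by (auto simp: padic_ring_def)
    then have less: "nat (d j) < p ^ j" by (simp add: nat_less_iff)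
    have "d (Suc j) = d j + int (p ^ j * padic_digit p d j)"
      using padic_digit_expansion[OF p_pos d, of "Suc j"] padic_digit_expansion[OF p_pos d, of j]
      by (simp add: mult.commute)
    then have "nat (d (Suc j)) = nat (d j) + p ^ j * padic_digit p d j"
      using \<open>0 \<le> d j\<close> by (simp add: nat_add_distrib nat_mult_distrib nat_power_eq)
    then show ?thesis
      using one_plus_power_nth[OF d \<open>p ^ j < p ^ Suc j\<close>] choose_prime_power[OF less] by simp
  qed
  have "padic_digit p d j = padic_digit p d' j" for j
  proof -
    have "(of_nat (padic_digit p d j) :: 'k) = of_nat (padic_digit p d' j)"
      using dig[OF d(1), of j] dig[OF d(2), of j] eq by simp
    then show ?thesis
      using padic_digit_less[OF p_pos d(1), of j] padic_digit_less[OF p_pos d(2), of j]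
      by (simp add: of_nat_eq_iff_cong_CHAR cong_def flip: p_CHAR)
  qed
  note dig' = this
  show "d = d'"
  proof
    fix n
    show "d n = d' n"
      using padic_digit_expansion[OF p_pos d(1), of n] padic_digit_expansion[OF p_pos d(2), of n]
      by (simp add: dig')
  qed
qed

end

section \<open>Dimensions of symmetric and exterior powers\<close>

context graded_power
begin

text \<open>The assumption says that \<open>check\<close> and c_i - 1 annihilate the same morphisms.
  Hence \<open>inclusion\<close> and the chosen invariants are intersections of families with the
  same factorization property; degrees 0 and 1 hold by convention.\<close>

lemma sym_power_dim:
  assumes iff: "\<And>n i h. i < Suc (Suc n) \<Longrightarrow> h \<in> Arr C \<Longrightarrow> Cod C h = tensor_power C X (Suc (Suc n)) \<Longrightarrow>
    check (Suc (Suc n)) i \<cdot> h = Zero C (Dom C h) (Cod C (check (Suc (Suc n)) i)) \<longleftrightarrow>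
    braid_minus_one C X (Suc (Suc n)) i \<cdot> h = Zero C (Dom C h) (tensor_power C X (Suc (Suc n)))"
  shows "cat_dim C (sym_power C X n) = cat_dim C (gpow n)"
proof -
  have main: "cat_dim C (sym_power C X n) = cat_dim C (gpow n)" if n: "n = Suc (Suc m)" for m
  proof -
    have fac: "factors_through C h k \<longleftrightarrow> check n i \<cdot> h = Zero C (Dom C h) (Cod C (check n i))"
      if k: "is_kernel C (braid_minus_one C X n i) k" and i: "i < n"
        and h: "h \<in> Arr C" "Cod C h = tensor_power C X n" for i h k
    proof -
      note kt = kernel_type[OF k]
      have "factors_through C h k \<longleftrightarrow> braid_minus_one C X n i \<cdot> h =
          Zero C (Dom C h) (tensor_power C X n)"
      proof
        assume "factors_through C h k"
        then obtain g where g: "g \<in> Arr C" "Dom C g = Dom C h" "Cod C g = Dom C k" "k \<cdot> g = h"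
          unfolding factors_through_def Bex_def arrows_iff by blast
        have "braid_minus_one C X n i \<cdot> h = (braid_minus_one C X n i \<cdot> k) \<cdot> g"
          unfolding g(4)[symmetric] using kt(1-3) g(1-3) by simp
        then show "braid_minus_one C X n i \<cdot> h = Zero C (Dom C h) (tensor_power C X n)"
          unfolding kt(4) using kt(1-3) g(1-3) n by simp
      next
        assume "braid_minus_one C X n i \<cdot> h = Zero C (Dom C h) (tensor_power C X n)"
        then obtain g where "g \<in> Arr C" "Dom C g = Dom C h" "Cod C g = Dom C k" "k \<cdot> g = h"
          by - (rule kernel_lift[OF k, of h], use h n in simp_all)
        then show "factors_through C h k" unfolding factors_through_def Bex_def arrows_iff by blast
      qed
      also have "\<dots> \<longleftrightarrow> check n i \<cdot> h = Zero C (Dom C h) (Cod C (check n i))"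
        unfolding n using iff i h n by blast
      finally show ?thesis .
    qed
    have "\<forall>i\<in>{1..<n}. \<exists>k. is_kernel C (braid_minus_one C X n i) k"
      using n by (intro ballI ex_kernel) simp
    then obtain K where K: "\<forall>i\<in>{1..<n}. is_kernel C (braid_minus_one C X n i) (K i)"
      by (rule bchoice[THEN exE])
    then have "is_invariants C X n (inclusion (Suc m))"
      unfolding is_invariants_def n by (intro exI[of _ K] conjI intersection_inclusion(1))
          (use fac n in auto)
    then have "is_invariants C X n (SOME m. is_invariants C X n m)" by (rule someI)
    then obtain K' where K': "\<forall>i\<in>{1..<n}. is_kernel C (braid_minus_one C X n i) (K' i)"
      "is_intersection C (tensor_power C X n) (K' ` {1..<n}) (SOME m. is_invariants C X n m)"
      unfolding is_invariants_def by blast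
    have "cat_dim C (Dom C (SOME m. is_invariants C X n m)) = cat_dim C (gpow n)"
      unfolding n by (rule intersection_inclusion(2)) (use fac K' n in auto)
    then show ?thesis using n by (simp add: sym_power_def)
  qed
  show ?thesis
    by (cases n rule: nat.exhaust[case_product nat.exhaust[of "n - 1"]])
      (use main in \<open>auto simp: sym_power_def gpow_1\<close>)
qed

text \<open>The image of c_i - 1 is the kernel of its cokernel \<open>q\<close>, so factoring
  through it means being annihilated by \<open>q\<close>, which the assumption compares with
  \<open>check\<close>.\<close>

lemma ext_power_dim:
  assumes iff: "\<And>n i h q. i < Suc (Suc n) \<Longrightarrow> h \<in> Arr C \<Longrightarrow> Cod C h = tensor_power C X (Suc (Suc n)) \<Longrightarrow>
    is_cokernel C (braid_minus_one C X (Suc (Suc n)) i) q \<Longrightarrow>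
    check (Suc (Suc n)) i \<cdot> h = Zero C (Dom C h) (Cod C (check (Suc (Suc n)) i)) \<longleftrightarrow>
    q \<cdot> h = Zero C (Dom C h) (Cod C q)"
  shows "cat_dim C (ext_power C X n) = cat_dim C (gpow n)"
proof -
  have main: "cat_dim C (ext_power C X n) = cat_dim C (gpow n)" if n: "n = Suc (Suc m)" for m
  proof -
    have fac: "factors_through C h k \<longleftrightarrow> check n i \<cdot> h = Zero C (Dom C h) (Cod C (check n i))"
      if k: "is_image C (braid_minus_one C X n i) k" and i: "i < n"
        and h: "h \<in> Arr C" "Cod C h = tensor_power C X n" for i h k
    proof -
      obtain q where q: "is_cokernel C (braid_minus_one C X n i) q" and k: "is_kernel C q k"
        using k unfolding is_image_def by blast
      note qt = cokernel_type(1-3)[OF q]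
      note kt = kernel_type[OF k]
      have "factors_through C h k \<longleftrightarrow> q \<cdot> h = Zero C (Dom C h) (Cod C q)"
      proof
        assume "factors_through C h k"
        then obtain g where g: "g \<in> Arr C" "Dom C g = Dom C h" "Cod C g = Dom C k" "k \<cdot> g = h"
          unfolding factors_through_def Bex_def arrows_iff by blast
        have "q \<cdot> h = (q \<cdot> k) \<cdot> g"
          unfolding g(4)[symmetric] using kt(1-3) g(1-3) by simp
        then show "q \<cdot> h = Zero C (Dom C h) (Cod C q)"
          unfolding kt(4) using kt(1-3) g(1-3) n by simp
      next
        assume "q \<cdot> h = Zero C (Dom C h) (Cod C q)"
        then obtain g where "g \<in> Arr C" "Dom C g = Dom C h" "Cod C g = Dom C k" "k \<cdot> g = h"
          by - (rule kernel_lift[OF k, of h], use h n qt in simp_all)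
        then show "factors_through C h k" unfolding factors_through_def Bex_def arrows_iff by blast
      qed
      also have "\<dots> \<longleftrightarrow> check n i \<cdot> h = Zero C (Dom C h) (Cod C (check n i))"
        unfolding n using iff i h q n by blast
      finally show ?thesis .
    qed
    have "\<exists>k. is_image C (braid_minus_one C X n i) k" for i
    proof -
      obtain q where q: "is_cokernel C (braid_minus_one C X n i) q"
        using ex_cokernel[of "braid_minus_one C X n i"] n by auto
      then obtain k where "is_kernel C q k"
        using ex_kernel[OF cokernel_type(2)[OF q]] by blast
      then show ?thesis using q unfolding is_image_def by blast
    qed
    then have "\<forall>i\<in>{1..<n}. \<exists>k. is_image C (braid_minus_one C X n i) k" by blast
    then obtain K where K: "\<forall>i\<in>{1..<n}. is_image C (braid_minus_one C X n i) (K i)"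
      by (rule bchoice[THEN exE])
    then have "is_alternating C X n (inclusion (Suc m))"
      unfolding is_alternating_def n by (intro exI[of _ K] conjI intersection_inclusion(1))
          (use fac n in auto)
    then have "is_alternating C X n (SOME m. is_alternating C X n m)" by (rule someI)
    then obtain K' where K': "\<forall>i\<in>{1..<n}. is_image C (braid_minus_one C X n i) (K' i)"
      "is_intersection C (tensor_power C X n) (K' ` {1..<n}) (SOME m. is_alternating C X n m)"
      unfolding is_alternating_def by blast
    have "cat_dim C (Dom C (SOME m. is_alternating C X n m)) = cat_dim C (gpow n)"
      unfolding n by (rule intersection_inclusion(2)) (use fac K' n in auto)
    then show ?thesis using n by (simp add: ext_power_def)
  qed
  show ?thesis
    by (cases n rule: nat.exhaust[case_product nat.exhaust[of "n - 1"]])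
      (use main in \<open>auto simp: ext_power_def gpow_1\<close>)
qed

end

lemma (in graded_power) binomial_type_gpow: "binomial_type s (\<lambda>n. cat_dim C (gpow n))"
proof -
  have "loop b 0 = 1" for b by (cases b) (simp_all add: cat_dim_Unit)
  then show ?thesis unfolding binomial_type_def
    by (intro exI[of _ loop]) (auto simp: choose_dim_gpow)
qed

section \<open>The symmetric and the exterior case\<close>

context symmetric_tensor_category
begin

text \<open>Here \<open>v\<close> is - 1: c - (c - 1) = 1, and (c - 1) c = - (c - 1) because c is an
  involution.\<close>

lemma graded_power_sym:
  assumes [simp]: "X \<in> Obj C"
  shows "graded_power C X (X \<star> X) (braid_minus_one C X (Suc (Suc 0)) (Suc 0))
      (Scale C (- 1) (Id C (X \<star> X))) 1"
proof unfold_locales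
  let ?c = "Braid C X X" and ?I = "Id C (X \<star> X)" and ?u =
      "braid_minus_one C X (Suc (Suc 0)) (Suc 0)"
  show "?u \<in> arrows C (X \<star> X) (X \<star> X)" "Scale C (- 1) ?I \<in> arrows C (X \<star> X) (X \<star> X)"
    unfolding braid_minus_one_2 by simp_all
  show "?u \<cdot> ?c = Scale C (- 1) ?u"
    unfolding braid_minus_one_2 by (simp add: Add_commute[of ?I])
  show "Add C (Scale C 1 ?c) (Scale C (- 1) ?I \<cdot> ?u) = ?I"
    unfolding braid_minus_one_2 using Add_assoc[of ?c "Scale C (- 1) ?c" ?I] by
        (simp add: Add_minus)
qed simp_all

text \<open>Since (c + 1) (c - 1) = 0, the sum c + 1 factors through the cokernel as
  \<open>v \<cdot> q\<close>, and - c + (c + 1) = 1. Moreover q (c - 1) = 0 gives q c = q, which is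
  \<open>u_Braid\<close> for s = - 1.\<close>

lemma graded_power_ext:
  assumes [simp]: "X \<in> Obj C" and q: "is_cokernel C (braid_minus_one C X (Suc (Suc 0)) (Suc 0)) q"
  obtains v where "graded_power C X (Cod C q) q v (- 1)"
proof -
  let ?c = "Braid C X X" and ?I = "Id C (X \<star> X)" and ?u =
      "braid_minus_one C X (Suc (Suc 0)) (Suc 0)"
  note [simp] = cokernel_type(1-3)[OF q]
  have [simp]: "Dom C ?u = X \<star> X" "Cod C ?u = X \<star> X" unfolding braid_minus_one_2 by simp_all
  have z: "Add C ?c ?I \<cdot> ?u = Zero C (X \<star> X) (X \<star> X)"
  proof -
    have "Add C (Add C ?I ?c) (Add C (Scale C (- 1) ?c) (Scale C (- 1) ?I)) =
        Zero C (X \<star> X) (X \<star> X)"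
      using Add_assoc[of ?I ?c "Add C (Scale C (- 1) ?c) (Scale C (- 1) ?I)"]
        Add_assoc[of ?c "Scale C (- 1) ?c" "Scale C (- 1) ?I"] by (simp add: Add_minus)
    moreover have "Add C ?c ?I \<cdot> ?u = Add C (Add C ?I ?c)
        (Add C (Scale C (- 1) ?c) (Scale C (- 1) ?I))"
      unfolding braid_minus_one_2 by simp
    ultimately show ?thesis by simp
  qed
  obtain v where v: "v \<in> Arr C" "Dom C v = Cod C q" "Cod C v = X \<star> X" "v \<cdot> q = Add C ?c ?I"
    by (rule cokernel_desc[OF q, of "Add C ?c ?I"]) (use z in simp_all)
  have qc: "q \<cdot> ?c = q"
  proof (rule eq_if_diff_Zero)
    show "Add C (q \<cdot> ?c) (Scale C (- 1) q) = Zero C (Dom C (q \<cdot> ?c)) (Cod C (q \<cdot> ?c))"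
      using cokernel_type(4)[OF q] unfolding braid_minus_one_2 by simp
  qed simp_all
  have "graded_power C X (Cod C q) q v (- 1)"
  proof unfold_locales
    show "Add C (Scale C (- 1) ?c) (v \<cdot> q) = ?I"
      unfolding v(4) using Add_assoc[of "Scale C (- 1) ?c" ?c ?I]
          Add_commute[of "Scale C (- 1) ?c" ?c]
      by (simp add: Add_minus)
  qed (use v qc in simp_all)
  then show thesis by (rule that)
qed

text \<open>The second claim realises each dimension in the sequence by an object, to which the
  prime field argument can then be applied in degree 1.\<close>

lemma sym_power_dims:
  assumes [simp]: "X \<in> Obj C"
  shows "binomial_type 1 (\<lambda>n. cat_dim C (sym_power C X n))"
    and "\<exists>Y \<in> Obj C. cat_dim C (sym_power C X n) = cat_dim C Y"
proof -
  let ?b = "braid_minus_one C X"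
  interpret graded_power C X "X \<star> X" "?b (Suc (Suc 0)) (Suc 0)" "Scale C (- 1) (Id C (X \<star> X))" 1
    by (rule graded_power_sym) simp
  \<comment> \<open>The two tests differ by an associator, possibly whiskered. A factorization in
    each direction is all that equality of their kernels requires.\<close>
  have rel: "\<exists>w w'. w \<in> arrows C (tensor_power C X (Suc (Suc n))) (Cod C (check (Suc (Suc n)) i)) \<and>
      w' \<in> arrows C (Cod C (check (Suc (Suc n)) i)) (tensor_power C X (Suc (Suc n))) \<and>
      check (Suc (Suc n)) i = w \<cdot> ?b (Suc (Suc n)) i \<and> ?b (Suc (Suc n)) i = w' \<cdot>
          check (Suc (Suc n)) i"
    if "i < Suc (Suc n)" for n i
    using that
  proof (induction n)
    case 0
    have "?b (Suc (Suc 0)) i = ?b (Suc (Suc 0)) (Suc 0)" by (simp add: braid_minus_one_def)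
    then show ?case by (intro exI[of _ "Id C (X \<star> X)"]) simp
  next
    case (Suc n)
    let ?T = "tensor_power C X (Suc n)"
    show ?case
    proof (cases "i = Suc (Suc n)")
      case True
      have "tail ?T = Assoc C ?T X X \<cdot> ?b (Suc (Suc (Suc n))) i"
        unfolding True braid_minus_one_last[OF assms] by (simp add: tail_def)
      moreover have "?b (Suc (Suc (Suc n))) i = assoc_inv ?T X X \<cdot> tail ?T"
        unfolding True braid_minus_one_last[OF assms] by (simp add: tail_def)
      ultimately show ?thesis using True
        by (intro exI[of _ "Assoc C ?T X X"] exI[of _ "assoc_inv ?T X X"]) simp
    next
      case False
      then have i: "i < Suc (Suc n)" using Suc.prems by simp
      note [simp] = check_type[OF i]
      obtain w w' where w: "w \<in> arrows C (tensor_power C X (Suc (Suc n)))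
          (Cod C (check (Suc (Suc n)) i))"
        "w' \<in> arrows C (Cod C (check (Suc (Suc n)) i)) (tensor_power C X (Suc (Suc n)))"
        and e: "check (Suc (Suc n)) i = w \<cdot> ?b (Suc (Suc n)) i" "?b (Suc (Suc n)) i = w' \<cdot>
            check (Suc (Suc n)) i"
        using Suc.IH[OF i] by blast
      have "rwhisker (check (Suc (Suc n)) i) X = rwhisker w X \<cdot> rwhisker (?b (Suc (Suc n)) i) X"
        by (subst e(1)) (use w in simp)
      moreover have "rwhisker (?b (Suc (Suc n)) i) X = rwhisker w' X \<cdot>
          rwhisker (check (Suc (Suc n)) i) X"
        by (subst e(2)) (use w in simp)
      ultimately show ?thesis using False w
        by (intro exI[of _ "rwhisker w X"] exI[of _ "rwhisker w' X"])
            (simp add: braid_minus_one_whisker)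
    qed
  qed
  have dim: "cat_dim C (sym_power C X n) = cat_dim C (gpow n)" for n
  proof (rule sym_power_dim)
    fix n i h assume i: "i < Suc (Suc n)" and h: "h \<in> Arr C" "Cod C h =
        tensor_power C X (Suc (Suc n))"
    let ?k = "check (Suc (Suc n)) i"
    note [simp] = check_type[OF i]
    obtain w w' where w: "w \<in> arrows C (tensor_power C X (Suc (Suc n))) (Cod C ?k)"
        "w' \<in> arrows C (Cod C ?k) (tensor_power C X (Suc (Suc n)))"
        and e: "?k = w \<cdot> ?b (Suc (Suc n)) i" "?b (Suc (Suc n)) i = w' \<cdot> ?k"
      using rel[OF i] by blast
    show "?k \<cdot> h = Zero C (Dom C h) (Cod C ?k) \<longleftrightarrow>
        ?b (Suc (Suc n)) i \<cdot> h = Zero C (Dom C h) (tensor_power C X (Suc (Suc n)))"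
    proof
      assume z: "?k \<cdot> h = Zero C (Dom C h) (Cod C ?k)"
      have "?b (Suc (Suc n)) i \<cdot> h = w' \<cdot> ?k \<cdot> h" by (subst e(2)) (use w h in simp)
      then show "?b (Suc (Suc n)) i \<cdot> h = Zero C (Dom C h) (tensor_power C X (Suc (Suc n)))"
        unfolding z using w h by simp
    next
      assume z: "?b (Suc (Suc n)) i \<cdot> h = Zero C (Dom C h) (tensor_power C X (Suc (Suc n)))"
      have "?k \<cdot> h = w \<cdot> ?b (Suc (Suc n)) i \<cdot> h" by (subst e(1)) (use w h in simp)
      then show "?k \<cdot> h = Zero C (Dom C h) (Cod C ?k)"
        unfolding z using w h by simp
    qed
  qed
  show "binomial_type 1 (\<lambda>n. cat_dim C (sym_power C X n))"
    unfolding dim by (rule binomial_type_gpow)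
  show "\<exists>Y \<in> Obj C. cat_dim C (sym_power C X n) = cat_dim C Y"
    unfolding dim by (rule bexI[of _ "gpow n"]) simp_all
qed

lemma ext_power_dims:
  assumes [simp]: "X \<in> Obj C"
  shows "binomial_type (- 1) (\<lambda>n. cat_dim C (ext_power C X n))"
    and "\<exists>Y \<in> Obj C. cat_dim C (ext_power C X n) = cat_dim C Y"
proof -
  let ?b = "braid_minus_one C X"
  have b2: "?b (Suc (Suc 0)) i = ?b (Suc (Suc 0)) (Suc 0)" for i
    by (simp add: braid_minus_one_def)
  obtain q where q: "is_cokernel C (?b (Suc (Suc 0)) (Suc 0)) q"
    using ex_cokernel[of "?b (Suc (Suc 0)) (Suc 0)"] unfolding braid_minus_one_2 by auto
  define V where "V = Cod C q"
  obtain v where "graded_power C X V q v (- 1)"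
    unfolding V_def by (rule graded_power_ext[OF assms q])
  then interpret graded_power C X V q v "- 1" .
  have zero: "check (Suc (Suc n)) i \<cdot> ?b (Suc (Suc n)) i =
      Zero C (tensor_power C X (Suc (Suc n))) (Cod C (check (Suc (Suc n)) i))"
    if "i < Suc (Suc n)" for n i
    using that
  proof (induction n)
    case 0
    then show ?case using cokernel_type(4)[OF q] unfolding b2[of i] by simp
  next
    case (Suc n)
    let ?T = "tensor_power C X (Suc n)"
    show ?case
    proof (cases "i = Suc (Suc n)")
      case True
      have [simp]: "?b (Suc (Suc 0)) (Suc 0) \<in> Arr C" "Dom C (?b (Suc (Suc 0)) (Suc 0)) = X \<star> X"
          "Cod C (?b (Suc (Suc 0)) (Suc 0)) = X \<star> X"
        unfolding braid_minus_one_2 by simp_all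
      have "tail ?T \<cdot> ?b (Suc (Suc (Suc n))) i = lwhisker ?T (q \<cdot> ?b (Suc (Suc 0)) (Suc 0)) \<cdot>
          Assoc C ?T X X"
        unfolding True braid_minus_one_last[OF assms] by (simp add: tail_def)
      then show ?thesis unfolding cokernel_type(4)[OF q] using True by simp
    next
      case False
      then have i: "i < Suc (Suc n)" using Suc.prems by simp
      note [simp] = check_type[OF i]
      have "rwhisker (check (Suc (Suc n)) i) X \<cdot> rwhisker (?b (Suc (Suc n)) i) X =
          rwhisker (check (Suc (Suc n)) i \<cdot> ?b (Suc (Suc n)) i) X" by simp
      then show ?thesis unfolding Suc.IH[OF i] using False by (simp add: braid_minus_one_whisker)
    qed
  qed
  \<comment> \<open>With \<open>zero\<close> this makes \<open>check\<close> a weak cokernel of c_i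
    - 1. At the last position tensoring preserves the cokernel \<open>q\<close>; elsewhere
    \<open>X\<close> is transposed into the codomain so that the induction hypothesis
    applies.\<close>
  have desc: "\<exists>g. g \<in> arrows C (Cod C (check (Suc (Suc n)) i)) (Cod C h) \<and> g \<cdot>
      check (Suc (Suc n)) i = h"
    if "i < Suc (Suc n)" "h \<in> Arr C" "Dom C h = tensor_power C X (Suc (Suc n))"
      "h \<cdot> ?b (Suc (Suc n)) i = Zero C (tensor_power C X (Suc (Suc n))) (Cod C h)" for n i h
    using that
  proof (induction n arbitrary: h)
    case 0
    obtain g where "g \<in> Arr C" "Dom C g = Cod C q" "Cod C g = Cod C h" "g \<cdot> q = h"
      by (rule cokernel_desc[OF q, of h]) (use 0 b2[of i] in \<open>simp_all add: braid_minus_one_2\<close>)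
    then show ?case by (intro exI[of _ g]) simp
  next
    case (Suc n)
    let ?T = "tensor_power C X (Suc n)"
    note [simp] = Suc.prems(2,3)
    show ?case
    proof (cases "i = Suc (Suc n)")
      case True
      have [simp]: "?b (Suc (Suc 0)) (Suc 0) \<in> Arr C" "Dom C (?b (Suc (Suc 0)) (Suc 0)) = X \<star> X"
          "Cod C (?b (Suc (Suc 0)) (Suc 0)) = X \<star> X"
        unfolding braid_minus_one_2 by simp_all
      have "(h \<cdot> assoc_inv ?T X X) \<cdot> lwhisker ?T (?b (Suc (Suc 0)) (Suc 0)) =
          (h \<cdot> ?b (Suc (Suc (Suc n))) i) \<cdot> assoc_inv ?T X X"
        unfolding True braid_minus_one_last[OF assms] by simp
      then have z: "(h \<cdot> assoc_inv ?T X X) \<cdot> lwhisker ?T (?b (Suc (Suc 0)) (Suc 0)) =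
          Zero C (?T \<star> X \<star> X) (Cod C h)"
        unfolding Suc.prems(4) by simp
      obtain g where g: "g \<in> Arr C" "Dom C g = ?T \<star> Cod C q" "Cod C g = Cod C h" "g \<cdot>
          lwhisker ?T q = h \<cdot> assoc_inv ?T X X"
        by (rule cokernel_desc_left[OF q, of "h \<cdot> assoc_inv ?T X X" ?T]) (use z in simp_all)
      have "g \<cdot> tail ?T = (g \<cdot> lwhisker ?T q) \<cdot> Assoc C ?T X X" using g(1-3) by (simp add: tail_def)
      also have "\<dots> = h" unfolding g(4) by simp
      finally show ?thesis using True g(1-3) by (intro exI[of _ g]) simp
    next
      case False
      then have i: "i < Suc (Suc n)" using Suc.prems by simp
      note [simp] = check_type[OF i]
      let ?S = "tensor_power C X (Suc (Suc n))"
      let ?h = "transpose_right X ?S h"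
      have "?h \<cdot> ?b (Suc (Suc n)) i = transpose_right X ?S (h \<cdot> rwhisker (?b (Suc (Suc n)) i) X)"
        by (rule transpose_right_Comp[symmetric]) simp_all
      also have "\<dots> = Zero C ?S (Cod C ?h)"
        using Suc.prems(4) unfolding braid_minus_one_whisker[OF assms False] by
            (simp add: transpose_right_def)
      finally have z: "?h \<cdot> ?b (Suc (Suc n)) i = Zero C ?S (Cod C ?h)" .
      obtain g where g: "g \<in> arrows C (Cod C (check (Suc (Suc n)) i)) (Cod C ?h)" "g \<cdot>
          check (Suc (Suc n)) i = ?h"
        using Suc.IH[OF i _ _ z] by auto
      have "untranspose_right X (Cod C h) g \<cdot> rwhisker (check (Suc (Suc n)) i) X =
          untranspose_right X (Cod C h) (g \<cdot> check (Suc (Suc n)) i)"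
        by (rule untranspose_right_Comp[symmetric]) (use g(1) in simp_all)
      also have "\<dots> = h" unfolding g(2) by (rule untranspose_transpose_right) simp_all
      finally show ?thesis using False g(1) by (intro exI[of _ "untranspose_right X (Cod C h) g"])
          simp
    qed
  qed
  have dim: "cat_dim C (ext_power C X n) = cat_dim C (gpow n)" for n
  proof (rule ext_power_dim)
    fix n i h r assume i: "i < Suc (Suc n)" and h: "h \<in> Arr C" "Cod C h =
        tensor_power C X (Suc (Suc n))"
      and r: "is_cokernel C (?b (Suc (Suc n)) i) r"
    let ?k = "check (Suc (Suc n)) i"
    note [simp] = check_type[OF i] cokernel_type(1-3)[OF r]
    \<comment> \<open>\<open>check\<close> and the cokernel \<open>r\<close> factor through each
      other, so they annihilate the same morphisms.\<close>
    obtain w where w: "w \<in> Arr C" "Dom C w = Cod C r" "Cod C w = Cod C ?k" "w \<cdot> r = ?k"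
      by (rule cokernel_desc[OF r, of ?k]) (use zero[OF i] in simp_all)
    obtain w' where w': "w' \<in> arrows C (Cod C ?k) (Cod C r)" "w' \<cdot> ?k = r"
      using desc[OF i, of r] cokernel_type(4)[OF r] by auto
    show "?k \<cdot> h = Zero C (Dom C h) (Cod C ?k) \<longleftrightarrow> r \<cdot> h = Zero C (Dom C h) (Cod C r)"
    proof
      assume z: "?k \<cdot> h = Zero C (Dom C h) (Cod C ?k)"
      have "r \<cdot> h = w' \<cdot> ?k \<cdot> h" using reassoc[OF w'(2), of h] w'(1) h by simp
      then show "r \<cdot> h = Zero C (Dom C h) (Cod C r)"
        unfolding z using w' h by simp
    next
      assume z: "r \<cdot> h = Zero C (Dom C h) (Cod C r)"
      have "?k \<cdot> h = w \<cdot> r \<cdot> h" by (subst w(4)[symmetric]) (use w(1-3) h in simp)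
      then show "?k \<cdot> h = Zero C (Dom C h) (Cod C ?k)"
        unfolding z using w(1-3) h by simp
    qed
  qed
  show "binomial_type (- 1) (\<lambda>n. cat_dim C (ext_power C X n))"
    unfolding dim by (rule binomial_type_gpow)
  show "\<exists>Y \<in> Obj C. cat_dim C (ext_power C X n) = cat_dim C Y"
    unfolding dim by (rule bexI[of _ "gpow n"]) simp_all
qed

end

text \<open>\<open>Y\<close> is its own symmetric power in degree 1, so the relations for s = 1
  apply to the dimension of any object.\<close>

lemma cat_dim_prime_field:
  fixes C :: "('o, 'm, 'k::field, 'z) tensor_data_scheme"
  assumes "symmetric_tensor_category C" "CHAR('k) > 0" "Y \<in> Obj C"
  obtains b where "cat_dim C Y = of_nat b"
  using binomial_type_prime_field[OF symmetric_tensor_category.sym_power_dims(1)[OF assms(1,3)]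
      assms(2)]
  by (auto simp: sym_power_def)

theorem theorem2p3:
  fixes C :: "('o, 'm, 'k::alg_closed_field) tensor_data" and X :: 'o and p :: nat
  assumes "p = CHAR('k)" and "p > 0"
    and "symmetric_tensor_category C"
    and "X \<in> Obj C"
  shows "(\<exists>!d. d \<in> carrier (padic_ring p) \<and>
            Abs_fps (\<lambda>j. cat_dim C (sym_power C X j)) =
              one_minus_power p (\<ominus>\<^bsub>padic_ring p\<^esub> d)) \<and>
         (\<exists>!d. d \<in> carrier (padic_ring p) \<and>
            Abs_fps (\<lambda>j. cat_dim C (ext_power C X j)) = one_plus_power p d)"
proof
  interpret symmetric_tensor_category C by (rule assms(3))
  interpret prime_char p "TYPE('k)" by unfold_locales (use assms in auto)
  interpret R: cring "padic_ring p" by (rule padic_cring[OF assms(2)])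
  have prime_field: "\<exists>b. cat_dim C Y = of_nat b" if "Y \<in> Obj C" for Y
    using cat_dim_prime_field[OF assms(3) _ that] assms(1,2) by metis
  show "\<exists>!d. d \<in> carrier (padic_ring p) \<and> Abs_fps (\<lambda>j. cat_dim C (ext_power C X j)) =
      one_plus_power p d"
  proof (rule binomial_type_one_plus_power[OF ext_power_dims(1)[OF assms(4)]])
    show "\<exists>b. cat_dim C (ext_power C X n) = of_nat b" for n
      using ext_power_dims(2)[OF assms(4), of n] prime_field by metis
  qed
  let ?s = "\<lambda>j. cat_dim C (sym_power C X j)"
  \<comment> \<open>The signs absorb the substitution z -> - z that turns (1 + z)^e into (1 -
    z)^e.\<close>
  let ?t = "\<lambda>j. (- 1) ^ j * ?s j"
  have "binomial_type (- 1) ?t"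
    by (rule binomial_type_signed[OF sym_power_dims(1)[OF assms(4)]]) simp
  moreover have "\<exists>b. ?t n = of_nat b" for n
  proof -
    obtain b where b: "?s n = of_nat b"
      using sym_power_dims(2)[OF assms(4), of n] prime_field by metis
    have "(- 1 :: 'k) = of_nat (p - 1)" using assms(1,2) by (simp add: of_nat_diff)
    then have "?t n = of_nat ((p - 1) ^ n * b)" unfolding b by simp
    then show ?thesis ..
  qed
  ultimately have ex1: "\<exists>!e. e \<in> carrier (padic_ring p) \<and> Abs_fps ?t = one_plus_power p e"
    by (rule binomial_type_one_plus_power)
  have sign: "Abs_fps ?s = one_minus_power p e \<longleftrightarrow> Abs_fps ?t = one_plus_power p e" for e
  proof -
    have "?s n = (- 1) ^ n * x \<longleftrightarrow> (- 1) ^ n * ?s n = x" for n and x :: 'k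
      by (cases "even n") auto
    then show ?thesis
      by (simp add: one_minus_power_def fps_compose_uminus' fps_eq_iff)
  qed
  from ex1 obtain e where e: "e \<in> carrier (padic_ring p)" "Abs_fps ?t = one_plus_power p e" by blast
  \<comment> \<open>The exponent in the claim is - d, so d is the negative of the exponent
    \<open>e\<close> of the signed series; uniqueness carries over because negation is an
    involution.\<close>
  show "\<exists>!d. d \<in> carrier (padic_ring p) \<and> Abs_fps ?s = one_minus_power p (\<ominus>\<^bsub>padic_ring p\<^esub> d)"
  proof (rule ex1I[of _ "\<ominus>\<^bsub>padic_ring p\<^esub> e"])
    show "\<ominus>\<^bsub>padic_ring p\<^esub> e \<in> carrier (padic_ring p) \<and>
        Abs_fps ?s = one_minus_power p (\<ominus>\<^bsub>padic_ring p\<^esub> (\<ominus>\<^bsub>padic_ring p\<^esub> e))"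
      using e sign[of e] by simp
  next
    fix d assume d: "d \<in> carrier (padic_ring p) \<and> Abs_fps ?s =
        one_minus_power p (\<ominus>\<^bsub>padic_ring p\<^esub> d)"
    then have "\<ominus>\<^bsub>padic_ring p\<^esub> d = e" using ex1 e sign[of "\<ominus>\<^bsub>padic_ring p\<^esub> d"] by auto
    then show "d = \<ominus>\<^bsub>padic_ring p\<^esub> e" using d R.minus_minus[of d] by auto
  qed
qed

end
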